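(* Let $G$ be a group satisfying the Burghelea conjecture, i.e. $\bigoplus_{[g]\in\langle G\rangle^{\infty}}T^G_\ast(g;\mathbb{C})=0$. Then $G$ satisfies the strong Bass conjecture: the image of the Hattori--Stallings trace map $K_0^{\mathrm{alg}}(\mathbb{C}G)\to HH_0(\mathbb{C}G)\cong\bigoplus_{[g]\in\langle G\rangle}\mathbb{C}$ is contained in the summand $\bigoplus_{[g]\in\langle G\rangle^{\mathrm{fin}}}\mathbb{C}$ corresponding to conjugacy classes of finite order elements.
   Context: For a group $G$, $\langle G\rangle$, $\langle G\rangle^{\mathrm{fin}}$, $\langle G\rangle^{\infty}$ are the sets of conjugacy classes of all elements, of finite order elements and of infinite order elements; $C_g<G$ is the centralizer of $g$. For $g$ of infinite order, $T^G_\ast(g;\mathbb{C}):=\varprojlim\big(\cdots\xrightarrow{S}H_{\ast+2n}(C_g/\langle g\rangle;\mathbb{C})\xrightarrow{S}H_{\ast+2n-2}(C_g/\langle g\rangle;\mathbb{C})\xrightarrow{S}\cdots\big)$, $\ast\in\{0,1\}$, where $S$ is the Gysin homomorphism of the fibration $S^1=B\langle g\rangle\to BC_g\to B(C_g/\langle g\rangle)$, i.e. cap product with the Euler class in $H^2(C_g/\langle g\rangle;\mathbb{Z})$ of the central extension $1\to\langle g\rangle\to C_g\to C_g/\langle g\rangle\to1$. $HH_0(\mathbb{C}G)=\mathbb{C}G/[\mathbb{C}G,\mathbb{C}G]$ is the zeroth Hochschild homology, and the map from $K_0^{\mathrm{alg}}(\mathbb{C}G)$ sends the class of an idempotent matrix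 to the class of its trace. *)

theory Defs
  imports Complex_Main "HOL-Algebra.Algebra" "HOL-Library.Poly_Mapping"
begin

section \<open>Group homology and cohomology via the bar complex\<close>

text \<open>The simplex [q1|...|qn] is the list of its entries; simplicial chains with complex
  coefficients are finitely supported functions on simplices. Homology groups are formed as
  abelian groups, written multiplicatively as always in HOL-Algebra.\<close>

definition bar_simplices :: "('q, 'm) monoid_scheme \<Rightarrow> nat \<Rightarrow> 'q list set" where
  "bar_simplices Q n = {xs. set xs \<subseteq> carrier Q \<and> length xs = n}"

definition face :: "('q, 'm) monoid_scheme \<Rightarrow> nat \<Rightarrow> 'q list \<Rightarrow> 'q list" where
  "face Q i xs =
     (if i = 0 then tl xs
      else if i = length xs then butlast xs
      else take (i - 1) xs @ [xs ! (i - 1) \<otimes>\<^bsub>Q\<^esub> xs ! i] @ drop (i + 1) xs)"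

definition chain_group :: "('q, 'm) monoid_scheme \<Rightarrow> nat \<Rightarrow> ('q list \<Rightarrow>\<^sub>0 complex) monoid" where
  "chain_group Q n =
     \<lparr>carrier = {c. Poly_Mapping.keys c \<subseteq> bar_simplices Q n}, monoid.mult = (+), one = 0\<rparr>"

text \<open>The empty simplex is excluded because the boundary vanishes in degree 0.\<close>

definition bar_boundary ::
  "('q, 'm) monoid_scheme \<Rightarrow> ('q list \<Rightarrow>\<^sub>0 complex) \<Rightarrow> ('q list \<Rightarrow>\<^sub>0 complex)" where
  "bar_boundary Q c =
     (\<Sum>xs \<in> Poly_Mapping.keys c - {[]}. \<Sum>i\<le>length xs.
        Poly_Mapping.single (face Q i xs) ((- 1) ^ i * Poly_Mapping.lookup c xs))"

definition cycle_group :: "('q, 'm) monoid_scheme \<Rightarrow> nat \<Rightarrow> ('q list \<Rightarrow>\<^sub>0 complex) monoid" where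
  "cycle_group Q n =
     (chain_group Q n)\<lparr>carrier := {c \<in> carrier (chain_group Q n). bar_boundary Q c = 0}\<rparr>"

definition boundaries :: "('q, 'm) monoid_scheme \<Rightarrow> nat \<Rightarrow> ('q list \<Rightarrow>\<^sub>0 complex) set" where
  "boundaries Q n = bar_boundary Q ` carrier (chain_group Q (Suc n))"

definition homology :: "('q, 'm) monoid_scheme \<Rightarrow> nat \<Rightarrow> ('q list \<Rightarrow>\<^sub>0 complex) set monoid" where
  "homology Q n = cycle_group Q n Mod boundaries Q n"

definition cochain_group :: "('q, 'm) monoid_scheme \<Rightarrow> nat \<Rightarrow> ('q list \<Rightarrow> int) monoid" where
  "cochain_group Q n = product_group (bar_simplices Q n) (\<lambda>_. integer_group)"

definition coboundary ::
  "('q, 'm) monoid_scheme \<Rightarrow> nat \<Rightarrow> ('q list \<Rightarrow> int) \<Rightarrow> ('q list \<Rightarrow> int)" where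
  "coboundary Q n \<phi> = (\<lambda>xs \<in> bar_simplices Q (Suc n). \<Sum>i\<le>Suc n. (- 1) ^ i * \<phi> (face Q i xs))"

definition cocycle_group :: "('q, 'm) monoid_scheme \<Rightarrow> nat \<Rightarrow> ('q list \<Rightarrow> int) monoid" where
  "cocycle_group Q n =
     (cochain_group Q n)\<lparr>carrier :=
       {\<phi> \<in> carrier (cochain_group Q n). coboundary Q n \<phi> = \<one>\<^bsub>cochain_group Q (Suc n)\<^esub>}\<rparr>"

definition coboundaries :: "('q, 'm) monoid_scheme \<Rightarrow> nat \<Rightarrow> ('q list \<Rightarrow> int) set" where
  "coboundaries Q n =
     (case n of 0 \<Rightarrow> {\<one>\<^bsub>cochain_group Q 0\<^esub>}
      | Suc m \<Rightarrow> coboundary Q m ` carrier (cochain_group Q m))"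

definition cohomology :: "('q, 'm) monoid_scheme \<Rightarrow> nat \<Rightarrow> ('q list \<Rightarrow> int) set monoid" where
  "cohomology Q n = cocycle_group Q n Mod coboundaries Q n"

definition cap_chain ::
  "nat \<Rightarrow> ('q list \<Rightarrow> int) \<Rightarrow> ('q list \<Rightarrow>\<^sub>0 complex) \<Rightarrow> ('q list \<Rightarrow>\<^sub>0 complex)" where
  "cap_chain p \<phi> c =
     (\<Sum>xs \<in> Poly_Mapping.keys c.
        Poly_Mapping.single (drop p xs) (of_int (\<phi> (take p xs)) * Poly_Mapping.lookup c xs))"

text \<open>Here, and for the other maps between quotients below, the value on a coset is the union of
  the cosets obtained from all choices of representatives; all of these coincide.
  The argument n is the degree of the result.\<close>

definition cap_product ::
  "('q, 'm) monoid_scheme \<Rightarrow> nat \<Rightarrow> nat \<Rightarrow> ('q list \<Rightarrow> int) set \<Rightarrow>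
   ('q list \<Rightarrow>\<^sub>0 complex) set \<Rightarrow> ('q list \<Rightarrow>\<^sub>0 complex) set" where
  "cap_product Q p n e x =
     (\<Union>\<phi>\<in>e. \<Union>c\<in>x. boundaries Q n #>\<^bsub>cycle_group Q n\<^esub> cap_chain p \<phi> c)"


section \<open>The Burghelea conjecture\<close>

definition conj_class :: "('a, 'm) monoid_scheme \<Rightarrow> 'a \<Rightarrow> 'a set" where
  "conj_class G g = {x \<otimes>\<^bsub>G\<^esub> g \<otimes>\<^bsub>G\<^esub> inv\<^bsub>G\<^esub> x | x. x \<in> carrier G}"

definition conj_classes :: "('a, 'm) monoid_scheme \<Rightarrow> 'a set set" where
  "conj_classes G = conj_class G ` carrier G"

text \<open>In HOL-Algebra the order of an element of infinite order is 0.\<close>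

definition fin_conj_classes :: "('a, 'm) monoid_scheme \<Rightarrow> 'a set set" where
  "fin_conj_classes G = conj_class G ` {g \<in> carrier G. group.ord G g \<noteq> 0}"

definition inf_conj_classes :: "('a, 'm) monoid_scheme \<Rightarrow> 'a set set" where
  "inf_conj_classes G = conj_class G ` {g \<in> carrier G. group.ord G g = 0}"

definition centralizer :: "('a, 'm) monoid_scheme \<Rightarrow> 'a \<Rightarrow> ('a, 'm) monoid_scheme" where
  "centralizer G g = G\<lparr>carrier := {h \<in> carrier G. h \<otimes>\<^bsub>G\<^esub> g = g \<otimes>\<^bsub>G\<^esub> h}\<rparr>"

definition reduced_centralizer :: "('a, 'm) monoid_scheme \<Rightarrow> 'a \<Rightarrow> 'a set monoid" where
  "reduced_centralizer G g = centralizer G g Mod generate G {g}"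

text \<open>A set-theoretic section of the projection from the centralizer determines a 2-cocycle with
  values in the infinite cyclic group generated by g, identified with the integers by sending
  g to 1; its class is the Euler class. The opposite sign convention would replace the Gysin
  homomorphism by its negative, which does not affect the inverse limit below up to isomorphism.\<close>

definition centralizer_sections :: "('a, 'm) monoid_scheme \<Rightarrow> 'a \<Rightarrow> ('a set \<Rightarrow> 'a) set" where
  "centralizer_sections G g = Pi (carrier (reduced_centralizer G g)) (\<lambda>q. q)"

definition factor_set ::
  "('a, 'm) monoid_scheme \<Rightarrow> 'a \<Rightarrow> ('a set \<Rightarrow> 'a) \<Rightarrow> ('a set list \<Rightarrow> int)" where
  "factor_set G g s =
     (\<lambda>xs \<in> bar_simplices (reduced_centralizer G g) 2.
        THE k::int. s (xs ! 0) \<otimes>\<^bsub>G\<^esub> s (xs ! 1) =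
          g [^]\<^bsub>G\<^esub> k \<otimes>\<^bsub>G\<^esub> s (xs ! 0 \<otimes>\<^bsub>reduced_centralizer G g\<^esub> xs ! 1))"

definition euler_class :: "('a, 'm) monoid_scheme \<Rightarrow> 'a \<Rightarrow> ('a set list \<Rightarrow> int) set" where
  "euler_class G g =
     (\<Union>s \<in> centralizer_sections G g.
        coboundaries (reduced_centralizer G g) 2
          #>\<^bsub>cocycle_group (reduced_centralizer G g) 2\<^esub> factor_set G g s)"

definition gysin ::
  "('a, 'm) monoid_scheme \<Rightarrow> 'a \<Rightarrow> nat \<Rightarrow>
   ('a set list \<Rightarrow>\<^sub>0 complex) set \<Rightarrow> ('a set list \<Rightarrow>\<^sub>0 complex) set" where
  "gysin G g n = cap_product (reduced_centralizer G g) 2 n (euler_class G g)"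

definition burghelea_T ::
  "('a, 'm) monoid_scheme \<Rightarrow> 'a \<Rightarrow> nat \<Rightarrow> (nat \<Rightarrow> ('a set list \<Rightarrow>\<^sub>0 complex) set) monoid" where
  "burghelea_T G g k =
     (let P = product_group UNIV (\<lambda>n. homology (reduced_centralizer G g) (k + 2 * n))
      in P\<lparr>carrier := {x \<in> carrier P. \<forall>n. gysin G g (k + 2 * n) (x (Suc n)) = x n}\<rparr>)"

text \<open>Up to isomorphism the direct sum does not depend on the chosen representatives.\<close>

definition burghelea_conjecture :: "('a, 'm) monoid_scheme \<Rightarrow> bool" where
  "burghelea_conjecture G \<longleftrightarrow>
     (\<forall>k \<in> {0, 1}.
        trivial_group (sum_group (inf_conj_classes G) (\<lambda>C. burghelea_T G (SOME g. g \<in> C) k)))"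


section \<open>Algebraic K-theory in degree 0 and the Hattori--Stallings trace\<close>

text \<open>An m by n matrix over a ring is a function of two indices that vanishes outside the range.\<close>

definition matrices :: "('r, 'm) ring_scheme \<Rightarrow> nat \<Rightarrow> nat \<Rightarrow> (nat \<Rightarrow> nat \<Rightarrow> 'r) set" where
  "matrices R m n =
     {A. (\<forall>i j. A i j \<in> carrier R) \<and> (\<forall>i j. \<not> (i < m \<and> j < n) \<longrightarrow> A i j = \<zero>\<^bsub>R\<^esub>)}"

definition matrix_mult ::
  "('r, 'm) ring_scheme \<Rightarrow> nat \<Rightarrow> (nat \<Rightarrow> nat \<Rightarrow> 'r) \<Rightarrow> (nat \<Rightarrow> nat \<Rightarrow> 'r) \<Rightarrow> (nat \<Rightarrow> nat \<Rightarrow> 'r)" where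
  "matrix_mult R n A B = (\<lambda>i j. \<Oplus>\<^bsub>R\<^esub>k\<in>{..<n}. A i k \<otimes>\<^bsub>R\<^esub> B k j)"

definition matrix_trace :: "('r, 'm) ring_scheme \<Rightarrow> nat \<times> (nat \<Rightarrow> nat \<Rightarrow> 'r) \<Rightarrow> 'r" where
  "matrix_trace R = (\<lambda>(n, A). \<Oplus>\<^bsub>R\<^esub>i\<in>{..<n}. A i i)"

definition idempotents :: "('r, 'm) ring_scheme \<Rightarrow> (nat \<times> (nat \<Rightarrow> nat \<Rightarrow> 'r)) set" where
  "idempotents R = {(n, P). P \<in> matrices R n n \<and> matrix_mult R n P P = P}"

text \<open>Idempotents P and Q define isomorphic finitely generated projective modules if and only if
  P = AB and Q = BA for some matrices A and B.\<close>

definition idem_equiv ::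
  "('r, 'm) ring_scheme \<Rightarrow> nat \<times> (nat \<Rightarrow> nat \<Rightarrow> 'r) \<Rightarrow> nat \<times> (nat \<Rightarrow> nat \<Rightarrow> 'r) \<Rightarrow> bool" where
  "idem_equiv R = (\<lambda>(m, P) (n, Q). \<exists>A \<in> matrices R m n. \<exists>B \<in> matrices R n m.
     P = matrix_mult R n A B \<and> Q = matrix_mult R m B A)"

definition block_sum ::
  "('r, 'm) ring_scheme \<Rightarrow> nat \<times> (nat \<Rightarrow> nat \<Rightarrow> 'r) \<Rightarrow> nat \<times> (nat \<Rightarrow> nat \<Rightarrow> 'r) \<Rightarrow>
   nat \<times> (nat \<Rightarrow> nat \<Rightarrow> 'r)" where
  "block_sum R = (\<lambda>(m, P) (n, Q). (m + n, \<lambda>i j.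
     if i < m \<and> j < m then P i j
     else if m \<le> i \<and> m \<le> j then Q (i - m) (j - m)
     else \<zero>\<^bsub>R\<^esub>))"

text \<open>The Grothendieck group: the pair (p, q) represents the formal difference [p] - [q].\<close>

definition K0_rel ::
  "('r, 'm) ring_scheme \<Rightarrow>
   ((nat \<times> (nat \<Rightarrow> nat \<Rightarrow> 'r)) \<times> (nat \<times> (nat \<Rightarrow> nat \<Rightarrow> 'r))) rel" where
  "K0_rel R = {((p, q), (p', q')) | p q p' q'.
     {p, q, p', q'} \<subseteq> idempotents R \<and>
     (\<exists>t \<in> idempotents R. idem_equiv R
        (block_sum R (block_sum R p q') t) (block_sum R (block_sum R p' q) t))}"

definition K0 ::
  "('r, 'm) ring_scheme \<Rightarrow>
   ((nat \<times> (nat \<Rightarrow> nat \<Rightarrow> 'r)) \<times> (nat \<times> (nat \<Rightarrow> nat \<Rightarrow> 'r))) set monoid" where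
  "K0 R =
     \<lparr>carrier = (idempotents R \<times> idempotents R) // K0_rel R,
      monoid.mult = (\<lambda>U V. \<Union>(p, q)\<in>U. \<Union>(p', q')\<in>V. K0_rel R `` {(block_sum R p p', block_sum R q q')}),
      one = K0_rel R `` {((0, \<lambda>_ _. \<zero>\<^bsub>R\<^esub>), (0, \<lambda>_ _. \<zero>\<^bsub>R\<^esub>))}\<rparr>"

text \<open>For an algebra over a field this additive subgroup is also the linear span of the commutators,
  since a scalar can be moved into one of the factors.\<close>

definition commutator_subgroup :: "('r, 'm) ring_scheme \<Rightarrow> 'r set" where
  "commutator_subgroup R =
     generate (add_monoid R)
       {a \<otimes>\<^bsub>R\<^esub> b \<ominus>\<^bsub>R\<^esub> b \<otimes>\<^bsub>R\<^esub> a | a b. a \<in> carrier R \<and> b \<in> carrier R}"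

definition HH0 :: "('r, 'm) ring_scheme \<Rightarrow> 'r set monoid" where
  "HH0 R = add_monoid R Mod commutator_subgroup R"

definition hattori_stallings ::
  "('r, 'm) ring_scheme \<Rightarrow>
   ((nat \<times> (nat \<Rightarrow> nat \<Rightarrow> 'r)) \<times> (nat \<times> (nat \<Rightarrow> nat \<Rightarrow> 'r))) set \<Rightarrow> 'r set" where
  "hattori_stallings R U =
     (\<Union>(p, q)\<in>U. commutator_subgroup R
        #>\<^bsub>add_monoid R\<^esub> (matrix_trace R p \<ominus>\<^bsub>R\<^esub> matrix_trace R q))"


section \<open>The strong Bass conjecture\<close>

definition group_ring :: "('a, 'm) monoid_scheme \<Rightarrow> ('a \<Rightarrow>\<^sub>0 complex) ring" where
  "group_ring G =
     \<lparr>carrier = {a. Poly_Mapping.keys a \<subseteq> carrier G},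
      monoid.mult = (\<lambda>a b. \<Sum>x \<in> Poly_Mapping.keys a. \<Sum>y \<in> Poly_Mapping.keys b.
        Poly_Mapping.single (x \<otimes>\<^bsub>G\<^esub> y) (Poly_Mapping.lookup a x * Poly_Mapping.lookup b y)),
      one = Poly_Mapping.single \<one>\<^bsub>G\<^esub> 1,
      ring.zero = 0,
      ring.add = (+)\<rparr>"

text \<open>Direct sums of copies of the complex numbers indexed by conjugacy classes are groups of
  finitely supported functions on the set of conjugacy classes.\<close>

definition class_sums :: "('a, 'm) monoid_scheme \<Rightarrow> ('a \<Rightarrow>\<^sub>0 complex) \<Rightarrow> ('a set \<Rightarrow>\<^sub>0 complex)" where
  "class_sums G a =
     (\<Sum>x \<in> Poly_Mapping.keys a. Poly_Mapping.single (conj_class G x) (Poly_Mapping.lookup a x))"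

text \<open>The isomorphism from the zeroth Hochschild homology group of the group ring to the direct
  sum over all conjugacy classes.\<close>

definition HH0_decomposition ::
  "('a, 'm) monoid_scheme \<Rightarrow> ('a \<Rightarrow>\<^sub>0 complex) set \<Rightarrow> ('a set \<Rightarrow>\<^sub>0 complex)" where
  "HH0_decomposition G u = the_elem (class_sums G ` u)"

definition fin_summand :: "('a, 'm) monoid_scheme \<Rightarrow> ('a set \<Rightarrow>\<^sub>0 complex) set" where
  "fin_summand G = {f. Poly_Mapping.keys f \<subseteq> fin_conj_classes G}"

definition strong_bass_conjecture :: "('a, 'm) monoid_scheme \<Rightarrow> bool" where
  "strong_bass_conjecture G \<longleftrightarrow>
     HH0_decomposition G ` hattori_stallings (group_ring G) ` carrier (K0 (group_ring G))
       \<subseteq> fin_summand G"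

end

theory Submission
  imports Defs
begin

text \<open>
  Let P be an idempotent matrix over the group ring and g an element of infinite order, with
  centralizer Z and Q = Z/<g>. The Hattori--Stallings coefficient of P at the conjugacy class of g is
  lifted to an element of the inverse limit T(g), which vanishes by hypothesis.

  The (2n)-chain of the lift is a sum over words w = (x_0, ..., x_2n) in G with product conjugate to
  g, weighted by the trace of P(x_0) ... P(x_2n). Conjugating the product to g turns w into a
  sequence of vertices y_i in G with y_(i+2n+1) = g y_i, well defined up to Z; a Z-equivariant
  retraction of G onto Z maps it to a simplex of the bar complex of Q, on which the cyclic shift by g
  acts trivially. After antisymmetrization, P P = P says that deleting any vertex of the sum of all
  words with m+1 letters gives the sum of all words with m letters, so these chains are cycles.

  The pullback of the Euler cocycle to Z is the coboundary of a 1-cochain a with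
  a(x, g y) = a(x, y) - 1. Computing the cap product by means of a, up to boundaries everything
  cancels except the contributions of this shift by 1, and the result is a nonzero multiple of the
  previous cycle.
\<close>

section \<open>Chains with complex coefficients\<close>

text \<open>The parity of the number of vertices shapes the construction. With an odd number of
  vertices the alternating sum over the deletions has an odd number of equal terms, so it leaves one
  copy of the sum over words with one letter less instead of cancelling. That remainder has an even
  number of vertices, where the cyclic shift is an odd permutation; so after antisymmetrization it
  equals its own negative.

  The multiple produced by the cap product depends on n, whereas in the inverse limit each class has
  to map exactly to its predecessor. Hence the cycles are rescaled by c_n with c_0 = 1 and c_(n+1) =
  - c_n (2n+1) / ((2n+3)(n+1)), that is, c_n = (-1)^n / ((2n+1) n!). This is the coefficient (-1)^n
  (2n)! / n! known from the Chern character of an idempotent in cyclic homology, divided by the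
  (2n+1)! permutations of the antisymmetrization.

  In degree 0 the only boundary is 0 and the cycle is the Hattori--Stallings coefficient itself, so
  the vanishing of the class is the vanishing of the number.\<close>

definition smul :: "complex \<Rightarrow> ('b \<Rightarrow>\<^sub>0 complex) \<Rightarrow> ('b \<Rightarrow>\<^sub>0 complex)" where
  "smul c f = Poly_Mapping.map ((*) c) f"

lemma lookup_smul [simp]: "Poly_Mapping.lookup (smul c f) x = c * Poly_Mapping.lookup f x"
  unfolding smul_def by (simp add: Poly_Mapping.map.rep_eq when_def)

interpretation chains: vector_space smul
  by unfold_locales (auto intro!: poly_mapping_eqI simp: lookup_add algebra_simps)

lemma smul_single [simp]: "smul c (Poly_Mapping.single x d) = Poly_Mapping.single x (c * d)"
  by (intro poly_mapping_eqI) (simp add: lookup_single when_def)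

lemma keys_smul_subset: "Poly_Mapping.keys (smul c f) \<subseteq> Poly_Mapping.keys f"
  by (auto simp: in_keys_iff)

text \<open>Boundaries, cap products and class sums are all of this form, so linearity, composition
  and testing on basis elements are settled here once.\<close>

definition lin :: "('x \<Rightarrow> ('y \<Rightarrow>\<^sub>0 complex)) \<Rightarrow> ('x \<Rightarrow>\<^sub>0 complex) \<Rightarrow> ('y \<Rightarrow>\<^sub>0 complex)" where
  "lin f c = (\<Sum>x\<in>Poly_Mapping.keys c. smul (Poly_Mapping.lookup c x) (f x))"

lemma lin_superset:
  assumes "finite A" "Poly_Mapping.keys c \<subseteq> A"
  shows "lin f c = (\<Sum>x\<in>A. smul (Poly_Mapping.lookup c x) (f x))"
  unfolding lin_def
  by (rule sum.mono_neutral_left) (use assms in \<open>auto simp: in_keys_iff\<close>)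

lemma lin_zero [simp]: "lin f 0 = 0"
  by (simp add: lin_def)

lemma lin_single [simp]: "lin f (Poly_Mapping.single x a) = smul a (f x)"
  by (subst lin_superset[of "{x}"]) (auto split: if_splits)

lemma lin_add: "lin f (c + d) = lin f c + lin f d"
proof -
  let ?X = "Poly_Mapping.keys c \<union> Poly_Mapping.keys d"
  have "Poly_Mapping.keys (c + d) \<subseteq> ?X" by (rule keys_add)
  then show ?thesis
    by (simp add: lin_superset[of ?X] lookup_add chains.scale_left_distrib sum.distrib)
qed

lemma lin_smul: "lin f (smul a c) = smul a (lin f c)"
  using keys_smul_subset[of a c]
  by (simp add: lin_superset[of "Poly_Mapping.keys c"] chains.scale_sum_right)

lemma lin_uminus: "lin f (- c) = - lin f c"
  using lin_smul[of f "-1" c] by simp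

lemma lin_diff: "lin f (c - d) = lin f c - lin f d"
  using lin_add[of f c "- d"] by (simp add: lin_uminus)

lemma lin_sum: "lin f (\<Sum>i\<in>I. c i) = (\<Sum>i\<in>I. lin f (c i))"
  by (induction I rule: infinite_finite_induct) (auto simp: lin_add)

lemma lin_cong:
  "(\<And>x. x \<in> Poly_Mapping.keys c \<Longrightarrow> f x = g x) \<Longrightarrow> lin f c = lin g c"
  by (simp add: lin_def)

lemma lin_fun_add: "lin (\<lambda>x. f x + g x) c = lin f c + lin g c"
  by (simp add: lin_def chains.scale_right_distrib sum.distrib)

lemma lin_lin: "lin f (lin g c) = lin (\<lambda>x. lin f (g x)) c"
  by (simp add: lin_def[of g] lin_def[of "\<lambda>x. lin f (g x)"] lin_sum lin_smul)

lemma keys_lin: "Poly_Mapping.keys (lin f c) \<subseteq> (\<Union>x\<in>Poly_Mapping.keys c. Poly_Mapping.keys (f x))"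
proof -
  have "Poly_Mapping.keys (lin f c)
      \<subseteq> (\<Union>x\<in>Poly_Mapping.keys c. Poly_Mapping.keys (smul (Poly_Mapping.lookup c x) (f x)))"
    unfolding lin_def by (rule keys_sum)
  also have "\<dots> \<subseteq> (\<Union>x\<in>Poly_Mapping.keys c. Poly_Mapping.keys (f x))"
    by (intro UN_mono keys_smul_subset subset_refl)
  finally show ?thesis .
qed

lemma smul_power_minus_one [simp]: "smul ((- 1) ^ n) f = (if even n then f else - f)"
  by (cases "even n") auto


section \<open>Alternating sums over lists\<close>

text \<open>In closed form: the sum over i of (-1)^i f (x_i) (xs without x_i).\<close>

primrec asum :: "'v list \<Rightarrow> ('v \<Rightarrow> 'v list \<Rightarrow> 'b :: ab_group_add) \<Rightarrow> 'b" where
  "asum [] f = 0"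
| "asum (x # xs) f = f x xs - asum xs (\<lambda>y ys. f y (x # ys))"

lemma asum_cong:
  assumes "\<And>y ys. y \<in> set xs \<Longrightarrow> set ys \<subseteq> set xs \<Longrightarrow> Suc (length ys) = length xs \<Longrightarrow> f y ys = g y ys"
  shows "asum xs f = asum xs g"
  using assms
proof (induction xs arbitrary: f g)
  case (Cons x xs)
  have "asum xs (\<lambda>y ys. f y (x # ys)) = asum xs (\<lambda>y ys. g y (x # ys))"
    by (intro Cons.IH Cons.prems) auto
  moreover have "f x xs = g x xs" using Cons.prems by auto
  ultimately show ?case by simp
qed simp

lemma asum_add: "asum xs (\<lambda>y ys. f y ys + g y ys) = asum xs f + asum xs g"
  by (induction xs arbitrary: f g) (auto simp: algebra_simps)

lemma asum_uminus: "asum xs (\<lambda>y ys. - f y ys) = - asum xs f"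
  by (induction xs arbitrary: f) (auto simp: algebra_simps)

lemma asum_diff: "asum xs (\<lambda>y ys. f y ys - g y ys) = asum xs f - asum xs g"
  by (induction xs arbitrary: f g) (auto simp: algebra_simps)

lemma asum_smul: "asum xs (\<lambda>y ys. smul a (f y ys)) = smul a (asum xs f)"
  by (induction xs arbitrary: f) (auto simp: chains.scale_right_diff_distrib)

lemma lin_asum: "lin h (asum xs f) = asum xs (\<lambda>y ys. lin h (f y ys))"
  by (induction xs arbitrary: f) (auto simp: lin_diff)

lemma asum_map: "asum (map q xs) f = asum xs (\<lambda>y ys. f (q y) (map q ys))"
  by (induction xs arbitrary: f) auto

text \<open>Taking out x before y or y before x leaves the same rest with opposite signs, since in
  one of the two orders the later position drops by one. This is the reason why the boundary squares
  to zero, and the source of most signs below.\<close>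

lemma asum_asum:
  "asum xs (\<lambda>x ys. asum ys (\<lambda>y zs. f x y zs)) = - asum xs (\<lambda>y ys. asum ys (\<lambda>x zs. f x y zs))"
proof (induction xs arbitrary: f)
  case (Cons a xs)
  show ?case
    by (simp add: asum_diff Cons[of "\<lambda>x y zs. f x y (a # zs)"])
qed simp

lemma asum_snoc:
  "asum (xs @ [x]) f = asum xs (\<lambda>y ys. f y (ys @ [x])) + (if even (length xs) then f x xs else - f x xs)"
  by (induction xs arbitrary: f) auto

definition del :: "nat \<Rightarrow> 'v list \<Rightarrow> 'v list" where
  "del k xs = take k xs @ drop (Suc k) xs"

lemma del_Cons [simp]: "del 0 (x # xs) = xs" "del (Suc k) (x # xs) = x # del k xs"
  by (auto simp: del_def)

lemma length_del: "k < length xs \<Longrightarrow> length (del k xs) = length xs - 1"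
  by (auto simp: del_def)

lemma set_del: "set (del k xs) \<subseteq> set xs"
  by (auto simp: del_def dest: in_set_takeD in_set_dropD)

lemma map_del: "map f (del k xs) = del k (map f xs)"
  by (simp add: del_def take_map drop_map)

lemma del_snoc: "k < length xs \<Longrightarrow> del k (xs @ [x]) = del k xs @ [x]"
  by (auto simp: del_def)

lemma del_last: "del (length xs) (xs @ [x]) = xs"
  by (auto simp: del_def)

text \<open>Passage to explicit positions, because \<open>ev_del\<close> evaluates the deletion of
  each vertex separately.\<close>

lemma asum_conv_sum:
  "asum xs f = (\<Sum>k<length xs. smul ((- 1) ^ k) (f (xs ! k) (del k xs)))"
proof (induction xs arbitrary: f)
  case (Cons x xs)
  have "(\<Sum>k<length (x # xs). smul ((- 1) ^ k) (f ((x # xs) ! k) (del k (x # xs))))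
    = f x xs + (\<Sum>k<length xs. smul ((- 1) ^ Suc k) (f (xs ! k) (x # del k xs)))"
    unfolding length_Cons sum.lessThan_Suc_shift by (simp del: smul_power_minus_one power_Suc)
  also have "\<dots> = f x xs + (\<Sum>k<length xs. - smul ((- 1) ^ k) (f (xs ! k) (x # del k xs)))"
    by (intro arg_cong2[of _ _ _ _ "(+)"] sum.cong refl) auto
  also have "\<dots> = asum (x # xs) f" by (simp add: Cons sum_negf del: smul_power_minus_one)
  finally show ?case by simp
qed simp

section \<open>Antisymmetrization over the positions of a list\<close>

primrec alt_n :: "nat \<Rightarrow> 'v list \<Rightarrow> ('v list \<Rightarrow> 'b :: ab_group_add) \<Rightarrow> 'b" where
  "alt_n 0 xs f = f []"
| "alt_n (Suc n) xs f = asum xs (\<lambda>y ys. alt_n n ys (\<lambda>l. f (y # l)))"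

text \<open>In closed form: the sum of sgn(s) f(s xs) over all permutations s of the positions of xs.\<close>

definition alt :: "'v list \<Rightarrow> ('v list \<Rightarrow> 'b :: ab_group_add) \<Rightarrow> 'b" where
  "alt xs f = alt_n (length xs) xs f"

lemma alt_Nil [simp]: "alt [] f = f []"
  by (simp add: alt_def)

lemma alt_rec: "xs \<noteq> [] \<Longrightarrow> alt xs f = asum xs (\<lambda>y ys. alt ys (\<lambda>l. f (y # l)))"
  by (cases xs) (auto simp: alt_def simp del: asum.simps intro!: asum_cong)

lemma alt_singleton [simp]: "alt [x] f = f [x]"
  by (simp add: alt_def)

text \<open>\<open>asum\<close> takes out an entry anywhere in the list, so the hypothesis has to
  cover all lists shorter by one and not only the tail.\<close>

lemma alt_induct [case_names Nil step]:
  assumes "P []"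
    and "\<And>xs. xs \<noteq> [] \<Longrightarrow> (\<And>ys. Suc (length ys) = length xs \<Longrightarrow> P ys) \<Longrightarrow> P xs"
  shows "P xs"
proof (induction "length xs" arbitrary: xs)
  case 0 then show ?case using assms(1) by simp
next
  case (Suc n)
  have "P ys" if "Suc (length ys) = length xs" for ys
    using Suc that by simp
  moreover have "xs \<noteq> []" using Suc.hyps(2) by auto
  ultimately show ?case by (rule assms(2)[rotated])
qed

lemma alt_cong:
  assumes "\<And>l. set l \<subseteq> set xs \<Longrightarrow> length l = length xs \<Longrightarrow> f l = g l"
  shows "alt xs f = alt xs g"
  using assms
proof (induction xs arbitrary: f g rule: alt_induct)
  case (step xs)
  have "alt ys (\<lambda>l. f (y # l)) = alt ys (\<lambda>l. g (y # l))"
    if "y \<in> set xs" "set ys \<subseteq> set xs" "Suc (length ys) = length xs" for y ys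
    by (rule step.IH) (use that step.prems in auto)
  then show ?case using step.hyps by (auto simp: alt_rec intro!: asum_cong)
qed simp

lemma alt_smul: "alt xs (\<lambda>l. smul a (f l)) = smul a (alt xs f)"
proof (induction xs arbitrary: f rule: alt_induct)
  case (step xs)
  have "alt xs (\<lambda>l. smul a (f l)) = asum xs (\<lambda>y ys. smul a (alt ys (\<lambda>l. f (y # l))))"
    unfolding alt_rec[OF step.hyps(1)] by (rule asum_cong) (simp add: step.IH)
  then show ?case by (simp add: asum_smul alt_rec[OF step.hyps(1)])
qed simp

lemma alt_add: "alt xs (\<lambda>l. f l + g l) = alt xs f + alt xs g"
  by (induction xs arbitrary: f g rule: alt_induct)
     (auto simp: alt_rec simp flip: asum_add intro!: asum_cong)

lemma alt_diff: "alt xs (\<lambda>l. f l - g l) = alt xs f - alt xs g"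
  by (induction xs arbitrary: f g rule: alt_induct)
     (auto simp: alt_rec simp flip: asum_diff intro!: asum_cong)

lemma lin_alt: "lin h (alt xs f) = alt xs (\<lambda>l. lin h (f l))"
  by (induction xs arbitrary: f rule: alt_induct)
     (auto simp: alt_rec lin_asum intro!: asum_cong)

lemma alt_map: "alt (map q xs) f = alt xs (\<lambda>l. f (map q l))"
  by (induction xs arbitrary: f rule: alt_induct)
     (auto simp: alt_rec asum_map intro!: asum_cong)

text \<open>The rotation is a cycle on \<open>length xs + 1\<close> positions, whose sign is
  (-1)^(length xs).\<close>

lemma alt_rotate:
  fixes x :: 'v
  shows "alt (x # xs) f = (if even (length xs) then alt (xs @ [x]) f else - alt (xs @ [x]) f)"
proof (induction xs arbitrary: f rule: alt_induct)
  case (step xs)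
  have *: "asum xs (\<lambda>y ys. alt (x # ys) (\<lambda>l. f (y # l)))
     = asum xs (\<lambda>y ys. if even (length xs) then - alt (ys @ [x]) (\<lambda>l. f (y # l)) else alt (ys @ [x]) (\<lambda>l. f (y # l)))"
  proof (rule asum_cong)
    fix y and ys :: "'v list" assume "Suc (length ys) = length xs"
    moreover from this have "even (length xs) \<longleftrightarrow> odd (length ys)" by (metis even_Suc)
    ultimately show "alt (x # ys) (\<lambda>l. f (y # l)) = (if even (length xs) then - alt (ys @ [x]) (\<lambda>l. f (y # l))
        else alt (ys @ [x]) (\<lambda>l. f (y # l)))"
      using step.IH by simp
  qed
  show ?case using step.hyps
    by (simp add: alt_rec[of "x # xs"] alt_rec[of "xs @ [x]"] asum_snoc * asum_uminus)
qed simp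

text \<open>Deleting position k with sign (-1)^k has the same antisymmetrization for every k,
  because moving that position to the front costs the same sign; this gives the factor
  \<open>length xs\<close>.\<close>

lemma alt_boundary:
  fixes xs :: "'v list"
  assumes "xs \<noteq> []"
  shows "alt xs (\<lambda>l. asum l (\<lambda>_ r. f r)) = smul (of_nat (length xs)) (asum xs (\<lambda>_ ys. alt ys f))"
  using assms
proof (induction xs arbitrary: f rule: alt_induct)
  case (step xs)
  let ?D = "asum xs (\<lambda>_ ys. alt ys f)"
  have *: "alt ys (\<lambda>l. asum (y # l) (\<lambda>_ r. f r))
     = alt ys f - smul (of_nat (length xs - 1)) (asum ys (\<lambda>_ zs. alt zs (\<lambda>r. f (y # r))))"
    if "Suc (length ys) = length xs" for y ys
  proof (cases "ys = []")
    case False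
    have "length xs - 1 = length ys" using that by simp
    with False show ?thesis using step.IH[OF that False, of "\<lambda>r. f (y # r)"]
      by (simp add: alt_diff)
  qed simp
  have "alt xs (\<lambda>l. asum l (\<lambda>_ r. f r))
     = asum xs (\<lambda>y ys. alt ys f - smul (of_nat (length xs - 1)) (asum ys (\<lambda>_ zs. alt zs (\<lambda>r. f (y # r)))))"
    using step.hyps unfolding alt_rec[OF step.hyps(1)] by (intro asum_cong *) auto
  also have "\<dots> = ?D - smul (of_nat (length xs - 1)) (asum xs (\<lambda>y ys. asum ys (\<lambda>_ zs. alt zs (\<lambda>r. f (y # r)))))"
    by (simp add: asum_diff asum_smul)
  \<comment> \<open>The deleted entry is exchanged with the first entry kept, so that it comes out
    first and the rest recombines to an \<open>alt\<close>.\<close>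
  also have "asum xs (\<lambda>y ys. asum ys (\<lambda>_ zs. alt zs (\<lambda>r. f (y # r))))
     = - asum xs (\<lambda>_ ys. asum ys (\<lambda>y zs. alt zs (\<lambda>r. f (y # r))))"
    by (rule asum_asum)
  finally have 1: "alt xs (\<lambda>l. asum l (\<lambda>_ r. f r)) = ?D
     + smul (of_nat (length xs - 1)) (asum xs (\<lambda>_ ys. asum ys (\<lambda>y zs. alt zs (\<lambda>r. f (y # r)))))"
    by simp
    have 2: "smul (of_nat (length xs - 1)) (asum xs (\<lambda>_ ys. asum ys (\<lambda>y zs. alt zs (\<lambda>r. f (y # r)))))
     = smul (of_nat (length xs - 1)) ?D"
  \<comment> \<open>With one entry the inner lists are empty and \<open>alt_rec\<close> does not
    apply, but then the factor \<open>length xs - 1\<close> is 0.\<close>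
  proof (cases "length xs = 1")
    case False
    show ?thesis
    proof (intro arg_cong[of _ _ "smul _"] asum_cong)
      fix y :: 'v and ys :: "'v list" assume "Suc (length ys) = length xs"
      then have "ys \<noteq> []" using False by auto
      then show "asum ys (\<lambda>y zs. alt zs (\<lambda>r. f (y # r))) = alt ys f"
        by (rule alt_rec[symmetric])
    qed
  qed simp
  have "alt xs (\<lambda>l. asum l (\<lambda>_ r. f r)) = smul (1 + of_nat (length xs - 1)) ?D"
    unfolding 1 2 by (simp add: chains.scale_left_distrib)
  moreover have "(1 :: complex) + of_nat (length xs - 1) = of_nat (length xs)"
    using step.hyps by (cases xs) auto
  ultimately show ?case by simp
qed simp


section \<open>The bar complex in homogeneous coordinates\<close>

text \<open>The list has one entry fewer than there are vertices, and left translation of all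
  vertices does not change it.\<close>

fun bars :: "('q, 'm) monoid_scheme \<Rightarrow> 'q list \<Rightarrow> 'q list" where
  "bars Q (x # y # r) = (inv\<^bsub>Q\<^esub> x \<otimes>\<^bsub>Q\<^esub> y) # bars Q (y # r)"
| "bars Q _ = []"

definition bar_chain :: "('q, 'm) monoid_scheme \<Rightarrow> 'q list \<Rightarrow> ('q list \<Rightarrow>\<^sub>0 complex)" where
  "bar_chain Q l = Poly_Mapping.single (bars Q l) 1"

text \<open>These are c, c x_1, c x_1 x_2 and so on, as many as there are letters: the point reached
  after the last letter is left out. For a word whose product is conjugated to g by c, that point is
  g c.\<close>

primrec vertices :: "('q, 'm) monoid_scheme \<Rightarrow> 'q \<Rightarrow> 'q list \<Rightarrow> 'q list" where
  "vertices Q c [] = []"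
| "vertices Q c (x # xs) = c # vertices Q (c \<otimes>\<^bsub>Q\<^esub> x) xs"

lemma length_vertices [simp]: "length (vertices Q c xs) = length xs"
  by (induction xs arbitrary: c) auto

lemma length_bars [simp]: "length (bars Q l) = length l - 1"
  by (induction Q l rule: bars.induct) auto

lemma face_Cons: "i \<noteq> 0 \<Longrightarrow> xs \<noteq> [] \<Longrightarrow> i \<le> length xs \<Longrightarrow> face Q (Suc i) (x # xs) = x # face Q i xs"
  by (cases i) (auto simp: face_def)

lemma bar_boundary_lin:
  "bar_boundary Q c = lin (\<lambda>xs. if xs = [] then 0
      else \<Sum>i\<le>length xs. Poly_Mapping.single (face Q i xs) ((- 1) ^ i)) c"
proof -
  have *: "Poly_Mapping.single (face Q i xs) ((- 1) ^ i * Poly_Mapping.lookup c xs)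
    = smul (Poly_Mapping.lookup c xs) (Poly_Mapping.single (face Q i xs) ((- 1) ^ i))" for i xs
    by (simp add: mult.commute)
  show ?thesis
    unfolding bar_boundary_def lin_def * chains.scale_sum_right[symmetric]
    by (rule sum.mono_neutral_cong_left) auto
qed

lemma bar_boundary_add: "bar_boundary Q (c + d) = bar_boundary Q c + bar_boundary Q d"
  and bar_boundary_zero [simp]: "bar_boundary Q 0 = 0"
  and bar_boundary_smul: "bar_boundary Q (smul a c) = smul a (bar_boundary Q c)"
  and bar_boundary_asum: "bar_boundary Q (asum xs h) = asum xs (\<lambda>y ys. bar_boundary Q (h y ys))"
  and bar_boundary_alt: "bar_boundary Q (alt xs k) = alt xs (\<lambda>l. bar_boundary Q (k l))"
  by (simp_all add: bar_boundary_lin lin_add lin_diff lin_smul lin_sum lin_asum lin_alt)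

lemma cap_chain_lin:
  "cap_chain p \<phi> c = lin (\<lambda>xs. Poly_Mapping.single (drop p xs) (of_int (\<phi> (take p xs)))) c"
  by (simp add: cap_chain_def lin_def mult.commute)

lemma cap_chain_add: "cap_chain p \<phi> (c + d) = cap_chain p \<phi> c + cap_chain p \<phi> d"
  and cap_chain_smul: "cap_chain p \<phi> (smul a c) = smul a (cap_chain p \<phi> c)"
  and cap_chain_asum: "cap_chain p \<phi> (asum xs h) = asum xs (\<lambda>y ys. cap_chain p \<phi> (h y ys))"
  and cap_chain_alt: "cap_chain p \<phi> (alt xs k) = alt xs (\<lambda>l. cap_chain p \<phi> (k l))"
  by (simp_all add: cap_chain_lin lin_add lin_smul lin_sum lin_asum lin_alt)

definition chains :: "('q, 'm) monoid_scheme \<Rightarrow> nat \<Rightarrow> ('q list \<Rightarrow>\<^sub>0 complex) set" where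
  "chains Q n = {c. Poly_Mapping.keys c \<subseteq> bar_simplices Q n}"

lemma chains_zero [simp]: "0 \<in> chains Q n"
  by (simp add: chains_def)

lemma chains_add: "c \<in> chains Q n \<Longrightarrow> d \<in> chains Q n \<Longrightarrow> c + d \<in> chains Q n"
  using keys_add[of c d] by (auto simp: chains_def)

lemma chains_smul: "c \<in> chains Q n \<Longrightarrow> smul a c \<in> chains Q n"
  using keys_smul_subset[of a c] by (auto simp: chains_def)

lemma chains_sum: "(\<And>i. i \<in> I \<Longrightarrow> f i \<in> chains Q n) \<Longrightarrow> (\<Sum>i\<in>I. f i) \<in> chains Q n"
  by (induction I rule: infinite_finite_induct) (auto intro: chains_add)

lemma chains_single: "xs \<in> bar_simplices Q n \<Longrightarrow> Poly_Mapping.single xs a \<in> chains Q n"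
  by (auto simp: chains_def)

lemma chains_lin:
  "(\<And>xs. xs \<in> Poly_Mapping.keys c \<Longrightarrow> f xs \<in> chains Q n) \<Longrightarrow> lin f c \<in> chains Q n"
  unfolding lin_def by (intro chains_sum chains_smul) auto

lemma chains_asum:
  assumes "\<And>y ys. y \<in> set xs \<Longrightarrow> set ys \<subseteq> set xs \<Longrightarrow> Suc (length ys) = length xs \<Longrightarrow> f y ys \<in> chains Q n"
  shows "asum xs f \<in> chains Q n"
  unfolding asum_conv_sum
proof (intro chains_sum chains_smul assms)
  fix k assume "k \<in> {..<length xs}"
  then show "xs ! k \<in> set xs" "set (del k xs) \<subseteq> set xs" "Suc (length (del k xs)) = length xs"
    by (auto simp: length_del set_del subsetD[OF set_del])
qed

lemma chains_alt:
  assumes "\<And>l. set l \<subseteq> set xs \<Longrightarrow> length l = length xs \<Longrightarrow> f l \<in> chains Q n"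
  shows "alt xs f \<in> chains Q n"
  using assms
proof (induction xs arbitrary: f rule: alt_induct)
  case (step xs)
  show ?case
    unfolding alt_rec[OF step.hyps(1)]
    by (intro chains_asum step.IH step.prems) auto
qed simp

lemma boundaries_eq: "boundaries Q n = bar_boundary Q ` chains Q (Suc n)"
  by (simp add: boundaries_def chains_def chain_group_def)

lemma boundaries_zero [simp]: "0 \<in> boundaries Q n"
  unfolding boundaries_eq by (rule image_eqI[of _ _ 0]) auto

lemma boundaries_add: "x \<in> boundaries Q n \<Longrightarrow> y \<in> boundaries Q n \<Longrightarrow> x + y \<in> boundaries Q n"
  unfolding boundaries_eq using chains_add by (fastforce simp: bar_boundary_add[symmetric])

lemma boundaries_smul: "x \<in> boundaries Q n \<Longrightarrow> smul a x \<in> boundaries Q n"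
  unfolding boundaries_eq using chains_smul by (fastforce simp: bar_boundary_smul[symmetric])

lemma boundaries_diff: "x \<in> boundaries Q n \<Longrightarrow> y \<in> boundaries Q n \<Longrightarrow> x - y \<in> boundaries Q n"
  using boundaries_add[of x Q n "smul (- 1) y"] boundaries_smul[of y Q n "-1"] by simp

lemma eq_neg_chain: "(x :: 'b \<Rightarrow>\<^sub>0 complex) = - x \<longleftrightarrow> x = 0"
proof
  assume "x = - x"
  then have "smul 2 x = 0" using chains.scale_left_distrib[of 1 1 x] by (simp add: eq_neg_iff_add_eq_0)
  then show "x = 0" by simp
qed simp

context group begin

lemma bars_simplices:
  "set l \<subseteq> carrier G \<Longrightarrow> length l = Suc n \<Longrightarrow> bars G l \<in> bar_simplices G n"
proof (induction l arbitrary: n rule: induct_list012)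
  case (3 x y r)
  then show ?case by (cases n) (auto simp: bar_simplices_def)
qed (auto simp: bar_simplices_def)

lemma bar_chain_chains:
  "set l \<subseteq> carrier G \<Longrightarrow> length l = Suc n \<Longrightarrow> bar_chain G l \<in> chains G n"
  unfolding bar_chain_def by (intro chains_single bars_simplices)

text \<open>Multiplying two neighbouring entries cancels the vertex between them, so faces are
  deletions in vertex coordinates and the boundary becomes an \<open>asum\<close>.\<close>

lemma face_bars:
  "set l \<subseteq> carrier G \<Longrightarrow> length l \<ge> 2 \<Longrightarrow> i < length l \<Longrightarrow> face G i (bars G l) = bars G (del i l)"
proof (induction l arbitrary: i rule: induct_list012)
  case (3 x y r)
  consider "i = 0" | "i = 1" | j where "i = Suc (Suc j)"
    by (cases i; cases "i - 1") auto
  then show ?case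
  proof cases
    case 1 then show ?thesis by (simp add: face_def)
  next
    case 2
    have "inv x \<otimes> y \<otimes> (inv y \<otimes> z) = inv x \<otimes> z" if "z \<in> carrier G" for z
      using 3(3) that by (simp add: m_assoc) (simp add: m_assoc[symmetric])
    with 2 show ?thesis using 3(3)
      by (cases r) (auto simp: face_def)
  next
    case (3 j)
    with "3.prems" have r: "r \<noteq> []" by auto
    then have "face G (Suc (Suc j)) (bars G (x # y # r)) = (inv x \<otimes> y) # face G (Suc j) (bars G (y # r))"
      using "3.prems" 3 r by (cases r) (simp_all add: face_Cons)
    also have "face G (Suc j) (bars G (y # r)) = bars G (del (Suc j) (y # r))"
      using "3.prems" 3 r by (intro "3.IH") (cases r; simp)+
    finally show ?thesis by (simp add: 3)
  qed
qed auto

lemma bar_boundary_bar_chain: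
  assumes "set l \<subseteq> carrier G" "length l \<ge> 2"
  shows "bar_boundary G (bar_chain G l) = asum l (\<lambda>_ r. bar_chain G r)"
proof -
  have "bars G l \<noteq> []" using assms(2) by (auto simp: length_Suc_conv numeral_2_eq_2 Suc_le_length_iff)
  moreover have "{..length (bars G l)} = {..<length l}" using assms(2) by auto
  ultimately have "bar_boundary G (bar_chain G l) = (\<Sum>k<length l. Poly_Mapping.single (face G k (bars G l)) ((- 1) ^ k))"
    by (simp add: bar_boundary_lin bar_chain_def)
  also have "\<dots> = asum l (\<lambda>_ r. bar_chain G r)"
    unfolding asum_conv_sum
    by (rule sum.cong) (use assms face_bars in \<open>auto simp: bar_chain_def\<close>)
  finally show ?thesis .
qed

lemma set_vertices: "c \<in> carrier G \<Longrightarrow> set xs \<subseteq> carrier G \<Longrightarrow> set (vertices G c xs) \<subseteq> carrier G"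
  by (induction xs arbitrary: c) auto

lemma bars_vertices:
  "c \<in> carrier G \<Longrightarrow> x \<in> carrier G \<Longrightarrow> set xs \<subseteq> carrier G \<Longrightarrow> bars G (vertices G c (xs @ [x])) = xs"
proof (induction xs arbitrary: c)
  case (Cons y ys)
  then have "bars G (vertices G (c \<otimes> y) (ys @ [x])) = ys" by simp
  moreover have "inv c \<otimes> (c \<otimes> y) = y" using Cons.prems by (simp add: m_assoc[symmetric])
  ultimately show ?case by (cases ys) auto
qed simp

lemma bar_simplex_cases:
  assumes "xs \<in> bar_simplices G n"
  obtains l where "set l \<subseteq> carrier G" "length l = Suc n" "bars G l = xs"
proof
  have xs: "set xs \<subseteq> carrier G" "length xs = n"
    using assms by (auto simp: bar_simplices_def)
  show "set (vertices G \<one> (xs @ [\<one>])) \<subseteq> carrier G"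
    by (rule set_vertices) (use xs in auto)
  show "length (vertices G \<one> (xs @ [\<one>])) = Suc n"
      "bars G (vertices G \<one> (xs @ [\<one>])) = xs"
    using xs by (auto simp: bars_vertices)
qed

text \<open>Every simplex has vertices, namely the partial products starting at the unit, so linear
  identities on chains may be checked on \<open>bar_chain\<close>.\<close>

lemma chain_eqI:
  assumes "c \<in> chains G n"
    and "\<And>l. set l \<subseteq> carrier G \<Longrightarrow> length l = Suc n \<Longrightarrow> lin f (bar_chain G l) = lin h (bar_chain G l)"
  shows "lin f c = lin h c"
proof (rule lin_cong)
  fix xs assume "xs \<in> Poly_Mapping.keys c"
  with assms(1) have "xs \<in> bar_simplices G n" by (auto simp: chains_def)
  then obtain l where "set l \<subseteq> carrier G" "length l = Suc n" "bars G l = xs" by (rule bar_simplex_cases)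
  then show "f xs = h xs" using assms(2)[of l] by (simp add: bar_chain_def)
qed

lemma bar_boundary_chains:
  assumes "c \<in> chains G (Suc n)"
  shows "bar_boundary G c \<in> chains G n"
  unfolding bar_boundary_lin
proof (rule chains_lin)
  fix xs assume "xs \<in> Poly_Mapping.keys c"
  with assms have "xs \<in> bar_simplices G (Suc n)" by (auto simp: chains_def)
  then obtain l where l: "set l \<subseteq> carrier G" "length l = Suc (Suc n)" "bars G l = xs" by (rule bar_simplex_cases)
  have "bar_boundary G (bar_chain G l) \<in> chains G n"
    by (subst bar_boundary_bar_chain) (use l in \<open>auto intro!: chains_asum bar_chain_chains\<close>)
  then show "(if xs = [] then 0 else \<Sum>i\<le>length xs. Poly_Mapping.single (face G i xs) ((- 1) ^ i)) \<in> chains G n"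
    by (simp add: bar_boundary_lin bar_chain_def l(3))
qed

lemma bar_boundary_bar_boundary:
  assumes "c \<in> chains G (Suc n)"
  shows "bar_boundary G (bar_boundary G c) = 0"
proof -
  let ?d = "\<lambda>xs. if xs = [] then 0 else \<Sum>i\<le>length xs. Poly_Mapping.single (face G i xs) ((- 1) ^ i)"
  have "lin (\<lambda>xs. lin ?d (?d xs)) c = lin (\<lambda>_. 0) c"
  proof (rule chain_eqI[OF assms])
    fix l assume l: "set l \<subseteq> carrier G" "length l = Suc (Suc n)"
    have "lin (\<lambda>xs. lin ?d (?d xs)) (bar_chain G l) = bar_boundary G (bar_boundary G (bar_chain G l))"
      by (simp add: bar_boundary_lin lin_lin)
    also have "\<dots> = asum l (\<lambda>_ r. bar_boundary G (bar_chain G r))"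
      using l by (simp add: bar_boundary_bar_chain bar_boundary_asum)
    also have "\<dots> = 0"
    proof (cases n)
      \<comment> \<open>Single vertices give the empty simplex, on which the boundary is 0 by
        definition; the formula by deletions does not cover it.\<close>
      case 0
      then have "bar_boundary G (bar_chain G r) = 0" if "Suc (length r) = length l" for r
        using that l by (auto simp: bar_boundary_lin bar_chain_def length_Suc_conv)
      then have "asum l (\<lambda>_ r. bar_boundary G (bar_chain G r)) = asum l (\<lambda>_ r. 0)"
        by (intro asum_cong) auto
      then show ?thesis by (simp add: asum_conv_sum)
    next
      case (Suc m)
      then have "asum l (\<lambda>_ r. bar_boundary G (bar_chain G r)) = asum l (\<lambda>_ r. asum r (\<lambda>_ r'. bar_chain G r'))"
        using l by (intro asum_cong bar_boundary_bar_chain) auto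
      then show ?thesis using asum_asum[of l "\<lambda>_ _ r'. bar_chain G r'"]
        by (simp add: eq_neg_chain)
    qed
    finally show "lin (\<lambda>xs. lin ?d (?d xs)) (bar_chain G l) = lin (\<lambda>_. 0) (bar_chain G l)"
      by (simp add: bar_chain_def)
  qed
  then show ?thesis by (simp add: bar_boundary_lin lin_lin lin_def[of "\<lambda>_. 0"])
qed

section \<open>Cap products\<close>

lemma cap_chain_chains:
  assumes "c \<in> chains G (p + n)"
  shows "cap_chain p \<phi> c \<in> chains G n"
  unfolding cap_chain_lin
proof (intro chains_lin chains_single)
  fix xs assume "xs \<in> Poly_Mapping.keys c"
  then show "drop p xs \<in> bar_simplices G n"
    using assms by (auto simp: chains_def bar_simplices_def dest: in_set_dropD)
qed

lemma cap_chain_1_bar_chain: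
  "cap_chain 1 \<psi> (bar_chain G (x # y # r)) = smul (of_int (\<psi> [inv x \<otimes> y])) (bar_chain G (y # r))"
  by (simp add: cap_chain_lin bar_chain_def)

lemma cap_chain_2_bar_chain:
  "cap_chain 2 \<phi> (bar_chain G (x # y # z # r))
    = smul (of_int (\<phi> [inv x \<otimes> y, inv y \<otimes> z])) (bar_chain G (z # r))"
  by (simp add: cap_chain_lin bar_chain_def numeral_2_eq_2)

lemma lin_ext: "c \<in> chains G n \<Longrightarrow> (\<And>xs. xs \<in> bar_simplices G n \<Longrightarrow> f xs = h xs) \<Longrightarrow> lin f c = lin h c"
  by (rule lin_cong) (auto simp: chains_def)

text \<open>The faces without x, y or z all leave the simplex on \<open>w # r\<close>, and by the
  cocycle identity their coefficients add up to the value at x, y, z. This supplies the first face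
  in the boundary of the capped simplex.\<close>

lemma cap_chain_2_boundary:
  assumes cocycle: "\<And>x y z w. {x, y, z, w} \<subseteq> carrier G \<Longrightarrow>
      \<phi> [inv y \<otimes> z, inv z \<otimes> w] - \<phi> [inv x \<otimes> z, inv z \<otimes> w]
      + \<phi> [inv x \<otimes> y, inv y \<otimes> w] - \<phi> [inv x \<otimes> y, inv y \<otimes> z] = 0"
    and c: "c \<in> chains G (Suc (Suc (Suc n)))"
  shows "cap_chain 2 \<phi> (bar_boundary G c) = bar_boundary G (cap_chain 2 \<phi> c)"
proof -
  have "cap_chain 2 \<phi> (bar_boundary G (bar_chain G l)) = bar_boundary G (cap_chain 2 \<phi> (bar_chain G l))"
    if "set l \<subseteq> carrier G" "length l = Suc (Suc (Suc (Suc n)))" for l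
  proof -
    from that obtain x y z w r where l: "l = x # y # z # w # r"
      by (auto simp: length_Suc_conv)
    let ?\<phi> = "\<lambda>x y z. complex_of_int (\<phi> [inv x \<otimes> y, inv y \<otimes> z])"
    have "?\<phi> y z w - ?\<phi> x z w + ?\<phi> x y w - ?\<phi> x y z = 0"
      using cocycle[of x y z w] that(1) unfolding l
      by (simp flip: of_int_diff of_int_add)
    then have *: "?\<phi> y z w - ?\<phi> x z w + ?\<phi> x y w = ?\<phi> x y z" by simp
    have "cap_chain 2 \<phi> (bar_boundary G (bar_chain G l))
       = asum l (\<lambda>_ r. cap_chain 2 \<phi> (bar_chain G r))"
      using that by (simp add: bar_boundary_bar_chain cap_chain_asum)
    also have "\<dots> = smul (?\<phi> y z w - ?\<phi> x z w + ?\<phi> x y w) (bar_chain G (w # r))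
        - smul (?\<phi> x y z) (bar_chain G (z # r)) + smul (?\<phi> x y z) (asum r (\<lambda>_ r. bar_chain G (z # w # r)))"
      by (simp add: l cap_chain_2_bar_chain chains.scale_left_distrib chains.scale_left_diff_distrib
          chains.scale_right_diff_distrib asum_smul)
    also have "\<dots> = smul (?\<phi> x y z) (asum (z # w # r) (\<lambda>_ r. bar_chain G r))"
      unfolding * by (simp add: algebra_simps chains.scale_right_distrib chains.scale_right_diff_distrib)
    also have "\<dots> = bar_boundary G (cap_chain 2 \<phi> (bar_chain G l))"
      using that by (simp add: l cap_chain_2_bar_chain bar_boundary_smul bar_boundary_bar_chain)
    finally show ?thesis .
  qed
  then show ?thesis
    using chain_eqI[OF c] unfolding cap_chain_lin bar_boundary_lin lin_lin by blast
qed

text \<open>Leibniz rule for the cap product. On cycles it turns the cap product with a coboundary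
  into a boundary, so the choice of a cocycle in the Euler class does not matter.\<close>

lemma cap_chain_coboundary:
  assumes c: "c \<in> chains G (Suc (Suc n))"
  shows "cap_chain 2 (coboundary G 1 \<psi>) c = cap_chain 1 \<psi> (bar_boundary G c) + bar_boundary G (cap_chain 1 \<psi> c)"
proof -
  have "cap_chain 2 (coboundary G 1 \<psi>) (bar_chain G l)
     = cap_chain 1 \<psi> (bar_boundary G (bar_chain G l)) + bar_boundary G (cap_chain 1 \<psi> (bar_chain G l))"
    if "set l \<subseteq> carrier G" "length l = Suc (Suc (Suc n))" for l
  proof -
    from that obtain x y z r where l: "l = x # y # z # r"
      by (auto simp: length_Suc_conv)
    let ?\<psi> = "\<lambda>x y. complex_of_int (\<psi> [inv x \<otimes> y])"
    have "bars G [x, y, z] \<in> bar_simplices G 2"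
      by (rule bars_simplices) (use that l in auto)
    then have "coboundary G 1 \<psi> (bars G [x, y, z]) = (\<Sum>i\<le>2. (- 1) ^ i * \<psi> (face G i (bars G [x, y, z])))"
      by (simp add: coboundary_def numeral_2_eq_2)
    also have "\<dots> = (\<Sum>i\<le>2. (- 1) ^ i * \<psi> (bars G (del i [x, y, z])))"
      using that by (intro sum.cong refl arg_cong2[of _ _ _ _ "(*)"] arg_cong[of _ _ \<psi>] face_bars) (auto simp: l)
    also have "\<dots> = \<psi> [inv y \<otimes> z] - \<psi> [inv x \<otimes> z] + \<psi> [inv x \<otimes> y]"
      by (simp add: numeral_2_eq_2)
    finally have "cap_chain 2 (coboundary G 1 \<psi>) (bar_chain G l)
       = smul (?\<psi> y z - ?\<psi> x z + ?\<psi> x y) (bar_chain G (z # r))"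
      by (simp add: l cap_chain_2_bar_chain)
    moreover have "cap_chain 1 \<psi> (bar_boundary G (bar_chain G l))
       = smul (?\<psi> y z - ?\<psi> x z) (bar_chain G (z # r)) + smul (?\<psi> x y) (bar_chain G (y # r))
         - smul (?\<psi> x y) (asum r (\<lambda>_ r. bar_chain G (y # z # r)))"
    proof -
      have "cap_chain 1 \<psi> (bar_boundary G (bar_chain G l)) = asum l (\<lambda>_ r. cap_chain 1 \<psi> (bar_chain G r))"
        using that by (simp add: bar_boundary_bar_chain cap_chain_asum)
      then show ?thesis
        by (simp add: l cap_chain_1_bar_chain[unfolded One_nat_def] chains.scale_left_diff_distrib
            chains.scale_right_diff_distrib asum_smul)
    qed
    moreover have "bar_boundary G (cap_chain 1 \<psi> (bar_chain G l))
        = smul (?\<psi> x y) (asum (y # z # r) (\<lambda>_ r. bar_chain G r))"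
      using that unfolding l cap_chain_1_bar_chain by (simp add: bar_boundary_smul bar_boundary_bar_chain)
    ultimately show ?thesis
      by (simp add: chains.scale_left_distrib chains.scale_left_diff_distrib
          chains.scale_right_distrib chains.scale_right_diff_distrib)
  qed
  then show ?thesis
    using chain_eqI[OF c] unfolding cap_chain_lin bar_boundary_lin lin_lin lin_fun_add[symmetric] by blast
qed

end


section \<open>Cyclic words with idempotent coefficients\<close>

primrec word_prod :: "('a, 'm) monoid_scheme \<Rightarrow> 'a list \<Rightarrow> 'a" where
  "word_prod G [] = \<one>\<^bsub>G\<^esub>"
| "word_prod G (x # w) = x \<otimes>\<^bsub>G\<^esub> word_prod G w"

primrec contract :: "('a, 'm) monoid_scheme \<Rightarrow> nat \<Rightarrow> 'a list \<Rightarrow> 'a list" where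
  "contract G 0 w = (hd w \<otimes>\<^bsub>G\<^esub> hd (tl w)) # tl (tl w)"
| "contract G (Suc k) w = hd w # contract G k (tl w)"

definition words :: "'a set \<Rightarrow> nat \<Rightarrow> 'a list set" where
  "words S n = {w. set w \<subseteq> S \<and> length w = n}"

lemma words_0 [simp]: "words S 0 = {[]}"
  by (auto simp: words_def)

lemma sum_words_Suc: "(\<Sum>w\<in>words S (Suc n). f w) = (\<Sum>x\<in>S. \<Sum>w\<in>words S n. f (x # w))"
proof -
  have "(\<Sum>w\<in>words S (Suc n). f w) = (\<Sum>(x, w)\<in>S \<times> words S n. f (x # w))"
    by (rule sum.reindex_bij_witness[where j = "\<lambda>w. (hd w, tl w)" and i = "\<lambda>(x, w). x # w"])
       (auto simp: words_def length_Suc_conv)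
  then show ?thesis by (simp add: sum.cartesian_product)
qed

lemma sum_words_rotate: "(\<Sum>w\<in>words S n. f (rotate1 w)) = (\<Sum>w\<in>words S n. f w)"
proof (rule sum.reindex_bij_witness[where j = rotate1 and i = "rotate (n - 1)"])
  fix w assume "w \<in> words S n"
  then have w: "set w \<subseteq> S" "length w = n" by (auto simp: words_def)
  show "rotate (n - 1) (rotate1 w) = w"
    using w by (cases n) (auto simp: rotate_id simp flip: rotate_Suc rotate1_rotate_swap)
  show "rotate1 (rotate (n - 1) w) = w"
    using w by (cases n) (auto simp: rotate_id simp flip: rotate_Suc)
  show "rotate1 w \<in> words S n" "rotate (n - 1) w \<in> words S n"
    using w by (auto simp: words_def)
qed simp

context group begin

lemma inv_cancel_left:
  "x \<in> carrier G \<Longrightarrow> y \<in> carrier G \<Longrightarrow> inv x \<otimes> (x \<otimes> y) = y"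
  "x \<in> carrier G \<Longrightarrow> y \<in> carrier G \<Longrightarrow> x \<otimes> (inv x \<otimes> y) = y"
  by (simp_all add: m_assoc[symmetric])

lemma word_prod_closed [simp]: "set w \<subseteq> carrier G \<Longrightarrow> word_prod G w \<in> carrier G"
  by (induction w) auto

lemma word_prod_snoc:
  "set w \<subseteq> carrier G \<Longrightarrow> x \<in> carrier G \<Longrightarrow> word_prod G (w @ [x]) = word_prod G w \<otimes> x"
  by (induction w) (auto simp: m_assoc)

lemma vertices_snoc:
  "c \<in> carrier G \<Longrightarrow> set w \<subseteq> carrier G \<Longrightarrow> vertices G c (w @ [x]) = vertices G c w @ [c \<otimes> word_prod G w]"
  by (induction w arbitrary: c) (auto simp: m_assoc)

lemma map_vertices:
  "z \<in> carrier G \<Longrightarrow> c \<in> carrier G \<Longrightarrow> set w \<subseteq> carrier G \<Longrightarrow>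
    map ((\<otimes>) z) (vertices G c w) = vertices G (z \<otimes> c) w"
  by (induction w arbitrary: c) (auto simp: m_assoc)

text \<open>Multiplying the letters k and k + 1 erases the vertex between them, which has index k +
  1. Vertex 0 cannot be erased in this way.\<close>

lemma contract_props:
  "c \<in> carrier G \<Longrightarrow> set w \<subseteq> carrier G \<Longrightarrow> Suc k < length w \<Longrightarrow>
    word_prod G (contract G k w) = word_prod G w
    \<and> vertices G c (contract G k w) = del (Suc k) (vertices G c w)"
proof (induction k arbitrary: c w)
  case 0
  then obtain a b v where "w = a # b # v" by (auto simp: Suc_le_length_iff less_eq_Suc_le)
  with 0 show ?case by (auto simp: m_assoc)
next
  case (Suc k)
  then obtain a v where w: "w = a # v" by (cases w) auto
  with Suc.prems Suc.IH[of "c \<otimes> a" v] Suc.IH[of c v] show ?case by auto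
qed

end

text \<open>The parameter ty only serves to fix the type of the simplices.\<close>

locale cyclic_words = group G for G :: "('a, 'm) monoid_scheme" (structure) +
  fixes S :: "'a set" and C :: "'a list \<Rightarrow> complex" and g :: 'a and ty :: "'b itself"
  assumes finite_letters: "finite S" and letters: "S \<subseteq> carrier G" and g_closed: "g \<in> carrier G"
    and coeff_rotate: "C (w @ [x]) = C (x # w)"
    and coeff_contract: "\<And>\<Theta> :: 'a \<Rightarrow> ('b \<Rightarrow>\<^sub>0 complex).
      (\<Sum>a\<in>S. \<Sum>b\<in>S. smul (C (u @ a # b # v)) (\<Theta> (a \<otimes> b))) = (\<Sum>x\<in>S. smul (C (u @ x # v)) (\<Theta> x))"
begin

definition conj_to_g :: "'a \<Rightarrow> bool" where
  "conj_to_g h \<longleftrightarrow> (\<exists>c\<in>carrier G. c \<otimes> h = g \<otimes> c)"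

definition conjugator :: "'a \<Rightarrow> 'a" where
  "conjugator h = (SOME c. c \<in> carrier G \<and> c \<otimes> h = g \<otimes> c)"

lemma conjugator:
  assumes "conj_to_g h"
  shows "conjugator h \<in> carrier G" "conjugator h \<otimes> h = g \<otimes> conjugator h"
  using someI_ex[of "\<lambda>c. c \<in> carrier G \<and> c \<otimes> h = g \<otimes> c"] assms
  unfolding conj_to_g_def conjugator_def by blast+

definition term_at :: "('a list \<Rightarrow> ('b \<Rightarrow>\<^sub>0 complex)) \<Rightarrow> 'a list \<Rightarrow> ('b \<Rightarrow>\<^sub>0 complex)" where
  "term_at \<Phi> w = (if conj_to_g (word_prod G w)
     then \<Phi> (vertices G (conjugator (word_prod G w)) w) else 0)"

text \<open>The cycles and the chains bounding their differences are values of \<open>ev n\<close>.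
  Since it is linear in its argument, identities between functions of vertex lists become identities
  between sums over words.\<close>

definition ev :: "nat \<Rightarrow> ('a list \<Rightarrow> ('b \<Rightarrow>\<^sub>0 complex)) \<Rightarrow> ('b \<Rightarrow>\<^sub>0 complex)" where
  "ev n \<Phi> = (\<Sum>w\<in>words S n. smul (C w) (term_at \<Phi> w))"

text \<open>Left translation by the centralizer of g is exactly the ambiguity in the choice of
  \<open>conjugator\<close>.\<close>

definition invariant :: "('a list \<Rightarrow> ('b \<Rightarrow>\<^sub>0 complex)) \<Rightarrow> bool" where
  "invariant \<Phi> \<longleftrightarrow> (\<forall>z\<in>carrier G. \<forall>l. z \<otimes> g = g \<otimes> z \<longrightarrow> set l \<subseteq> carrier G \<longrightarrow>
     \<Phi> (map ((\<otimes>) z) l) = \<Phi> l)"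

lemma words_letters: "w \<in> words S n \<Longrightarrow> set w \<subseteq> carrier G" "w \<in> words S n \<Longrightarrow> length w = n"
  using letters by (auto simp: words_def)

lemma ev_cong:
  assumes "\<And>l. set l \<subseteq> carrier G \<Longrightarrow> length l = n \<Longrightarrow> \<Phi> l = \<Psi> l"
  shows "ev n \<Phi> = ev n \<Psi>"
  unfolding ev_def term_at_def
proof (intro sum.cong refl arg_cong[of _ _ "smul _"] if_cong assms)
  fix w assume w: "w \<in> words S n" and "conj_to_g (word_prod G w)"
  then show "set (vertices G (conjugator (word_prod G w)) w) \<subseteq> carrier G"
    using words_letters[OF w] by (intro set_vertices conjugator) auto
  show "length (vertices G (conjugator (word_prod G w)) w) = n"
    using words_letters[OF w] by simp
qed

lemma ev_add: "ev n (\<lambda>l. \<Phi> l + \<Psi> l) = ev n \<Phi> + ev n \<Psi>"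
proof -
  have "term_at (\<lambda>l. \<Phi> l + \<Psi> l) w = term_at \<Phi> w + term_at \<Psi> w" for w
    by (simp add: term_at_def)
  then show ?thesis by (simp add: ev_def chains.scale_right_distrib sum.distrib)
qed

lemma ev_smul: "ev n (\<lambda>l. smul a (\<Phi> l)) = smul a (ev n \<Phi>)"
proof -
  have "smul (C w) (term_at (\<lambda>l. smul a (\<Phi> l)) w) = smul a (smul (C w) (term_at \<Phi> w))" for w
    by (simp add: term_at_def mult.commute)
  then show ?thesis by (simp add: ev_def chains.scale_sum_right del: chains.scale_scale)
qed

lemma ev_diff: "ev n (\<lambda>l. \<Phi> l - \<Psi> l) = ev n \<Phi> - ev n \<Psi>"
  using ev_add[of n \<Phi> "\<lambda>l. smul (- 1) (\<Psi> l)"] ev_smul[of n "-1" \<Psi>] by simp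

lemma ev_zero [simp]: "ev n (\<lambda>l. 0) = 0"
  by (simp add: ev_def term_at_def)

lemma ev_sum: "ev n (\<lambda>l. \<Sum>i\<in>I. \<Phi> i l) = (\<Sum>i\<in>I. ev n (\<Phi> i))"
  by (induction I rule: infinite_finite_induct) (auto simp: ev_add)

lemma ev_linear:
  assumes "\<And>x y. F (x + y) = F x + F y" "\<And>a x. F (smul a x) = smul a (F x)"
  shows "F (ev n \<Phi>) = ev n (\<lambda>l. F (\<Phi> l))"
proof -
  have F0: "F 0 = 0" using assms(2)[of 0] by simp
  have "F (\<Sum>w\<in>A. h w) = (\<Sum>w\<in>A. F (h w))" for A :: "'a list set" and h
    by (induction A rule: infinite_finite_induct) (auto simp: F0 assms)
  moreover have "F (term_at \<Phi> w) = term_at (\<lambda>l. F (\<Phi> l)) w" for w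
    by (simp add: term_at_def F0)
  ultimately show ?thesis by (simp add: ev_def assms)
qed

text \<open>If c and d both conjugate the product of w to g, then c d^-1 commutes with g, and left
  translation by it carries the vertices starting at d to those starting at c.\<close>

lemma term_at_eq:
  assumes "invariant \<Phi>" "set w \<subseteq> carrier G" "c \<in> carrier G" "c \<otimes> word_prod G w = g \<otimes> c"
  shows "term_at \<Phi> w = \<Phi> (vertices G c w)"
proof -
  let ?h = "word_prod G w" and ?d = "conjugator (word_prod G w)"
  have conj: "conj_to_g ?h" using assms by (auto simp: conj_to_g_def)
  note d = conjugator[OF conj]
  let ?z = "c \<otimes> inv ?d"
  have h: "?h \<in> carrier G" using assms by simp
  have "?z \<otimes> g = c \<otimes> (inv ?d \<otimes> (g \<otimes> ?d) \<otimes> inv ?d)"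
    using d h assms g_closed by (simp add: m_assoc)
  also have "\<dots> = c \<otimes> ?h \<otimes> inv ?d"
    using d(1) h assms(3) g_closed unfolding d(2)[symmetric]
    by (simp add: m_assoc inv_cancel_left)
  also have "\<dots> = g \<otimes> ?z" unfolding assms(4) using d(1) assms(3) g_closed by (simp add: m_assoc)
  finally have "\<Phi> (map ((\<otimes>) ?z) (vertices G ?d w)) = \<Phi> (vertices G ?d w)"
    using assms d g_closed by (auto simp: invariant_def set_vertices)
  moreover have "map ((\<otimes>) ?z) (vertices G ?d w) = vertices G c w"
    using assms d by (subst map_vertices) (auto simp: m_assoc)
  ultimately show ?thesis using conj by (simp add: term_at_def)
qed

text \<open>Moving the first letter x of a word to its end conjugates the product: if c conjugates
  the old product to g, then c x does so for the new one. The new vertices are the old ones without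
  c, followed by the closing point g c, and the coefficients are cyclically invariant.\<close>

lemma ev_rotate:
  assumes "invariant \<Phi>"
  shows "ev (Suc n) (\<lambda>l. \<Phi> (tl l @ [g \<otimes> hd l])) = ev (Suc n) \<Phi>"
proof -
  have "smul (C w) (term_at (\<lambda>l. \<Phi> (tl l @ [g \<otimes> hd l])) w) = smul (C (rotate1 w)) (term_at \<Phi> (rotate1 w))"
    if w: "w \<in> words S (Suc n)" for w
  proof -
    obtain x u where xu: "w = x # u" using words_letters(2)[OF w] by (cases w) auto
    have cl: "x \<in> carrier G" "set u \<subseteq> carrier G" using words_letters(1)[OF w] xu by auto
    let ?h = "word_prod G w" and ?c = "conjugator (word_prod G w)"
    have h: "?h = x \<otimes> word_prod G u" "word_prod G (u @ [x]) = word_prod G u \<otimes> x"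
      using cl by (simp_all add: xu word_prod_snoc)
    have "term_at (\<lambda>l. \<Phi> (tl l @ [g \<otimes> hd l])) w = term_at \<Phi> (u @ [x])"
    proof (cases "conj_to_g ?h")
      case True
      note c = conjugator[OF True]
      have 1: "?c \<otimes> x \<otimes> word_prod G u = g \<otimes> ?c"
        using c cl h by (simp add: m_assoc)
      then have "?c \<otimes> x \<otimes> word_prod G (u @ [x]) = g \<otimes> (?c \<otimes> x)"
        using c(1) cl g_closed unfolding h by (simp add: m_assoc[symmetric])
      then have "term_at \<Phi> (u @ [x]) = \<Phi> (vertices G (?c \<otimes> x) (u @ [x]))"
        using c cl assms by (intro term_at_eq) auto
      also have "vertices G (?c \<otimes> x) (u @ [x]) = vertices G (?c \<otimes> x) u @ [g \<otimes> ?c]"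
        using c(1) cl 1 by (subst vertices_snoc) auto
      finally show ?thesis using True by (simp add: term_at_def xu)
    next
      case False
      have "\<not> conj_to_g (word_prod G (u @ [x]))"
      proof
        assume "conj_to_g (word_prod G (u @ [x]))"
        then obtain c where c: "c \<in> carrier G" "c \<otimes> (word_prod G u \<otimes> x) = g \<otimes> c"
          unfolding h by (auto simp: conj_to_g_def)
        have "c \<otimes> inv x \<otimes> ?h = c \<otimes> (word_prod G u \<otimes> x) \<otimes> inv x"
          using c(1) cl unfolding h by (simp add: m_assoc inv_cancel_left)
        also have "\<dots> = g \<otimes> (c \<otimes> inv x)"
          unfolding c(2) using c(1) cl g_closed by (simp add: m_assoc)
        finally have "conj_to_g ?h" unfolding conj_to_g_def using c(1) cl by blast
        with False show False by simp
      qed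
      with False show ?thesis by (simp add: term_at_def)
    qed
    then show ?thesis by (simp add: xu coeff_rotate)
  qed
  then show ?thesis
    unfolding ev_def by (subst sum_words_rotate[symmetric]) (rule sum.cong, auto)
qed

text \<open>This is \<open>coeff_contract\<close>, the abstract form of P P = P, at the letters k
  and k + 1; the prefix u collects the letters already passed in the induction.\<close>

lemma sum_words_contract:
  "k < n \<Longrightarrow> (\<Sum>w\<in>words S (Suc n). smul (C (u @ w)) (\<Theta> (contract G k w)))
    = (\<Sum>w\<in>words S n. smul (C (u @ w)) (\<Theta> w))" for \<Theta> :: "'a list \<Rightarrow> ('b \<Rightarrow>\<^sub>0 complex)"
proof (induction k arbitrary: n u \<Theta>)
  case 0
  then obtain m where n: "n = Suc m" by (cases n) auto
  have "(\<Sum>w\<in>words S (Suc n). smul (C (u @ w)) (\<Theta> (contract G 0 w)))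
    = (\<Sum>a\<in>S. \<Sum>b\<in>S. \<Sum>v\<in>words S m. smul (C (u @ a # b # v)) (\<Theta> ((a \<otimes> b) # v)))"
    by (simp add: n sum_words_Suc)
  also have "\<dots> = (\<Sum>a\<in>S. \<Sum>v\<in>words S m. \<Sum>b\<in>S. smul (C (u @ a # b # v)) (\<Theta> ((a \<otimes> b) # v)))"
    by (intro sum.cong refl sum.swap)
  also have "\<dots> = (\<Sum>v\<in>words S m. \<Sum>a\<in>S. \<Sum>b\<in>S. smul (C (u @ a # b # v)) (\<Theta> ((a \<otimes> b) # v)))"
    by (rule sum.swap)
  also have "\<dots> = (\<Sum>v\<in>words S m. \<Sum>x\<in>S. smul (C (u @ x # v)) (\<Theta> (x # v)))"
    by (intro sum.cong refl coeff_contract)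
  also have "\<dots> = (\<Sum>x\<in>S. \<Sum>v\<in>words S m. smul (C (u @ x # v)) (\<Theta> (x # v)))"
    by (rule sum.swap)
  finally show ?case by (simp add: n sum_words_Suc)
next
  case (Suc k)
  from Suc.prems obtain m where n: "n = Suc m" "k < m" by (cases n) auto
  have "(\<Sum>w\<in>words S (Suc m). smul (C (u @ x # w)) (\<Theta> (x # contract G k w)))
     = (\<Sum>w\<in>words S m. smul (C (u @ x # w)) (\<Theta> (x # w)))" for x
    using Suc.IH[OF n(2), of "u @ [x]" "\<lambda>w. \<Theta> (x # w)"] by simp
  then show ?case by (simp add: n(1) sum_words_Suc[where n = "Suc m"] sum_words_Suc[where n = m])
qed

lemma ev_del_Suc:
  assumes "k < n"
  shows "ev (Suc n) (\<lambda>l. \<Psi> (del (Suc k) l)) = ev n \<Psi>"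
proof -
  have "term_at (\<lambda>l. \<Psi> (del (Suc k) l)) w = term_at \<Psi> (contract G k w)" if w: "w \<in> words S (Suc n)" for w
  proof (cases "conj_to_g (word_prod G w)")
    case True
    show ?thesis
      using contract_props[OF conjugator(1)[OF True] words_letters(1)[OF w], of k] words_letters(2)[OF w] assms
      by (simp add: term_at_def)
  next
    case False
    then show ?thesis
      using contract_props[OF one_closed words_letters(1)[OF w], of k] words_letters(2)[OF w] assms
      by (simp add: term_at_def)
  qed
  then have "ev (Suc n) (\<lambda>l. \<Psi> (del (Suc k) l)) = (\<Sum>w\<in>words S (Suc n). smul (C w) (term_at \<Psi> (contract G k w)))"
    by (simp add: ev_def)
  also have "\<dots> = ev n \<Psi>"
    using sum_words_contract[OF assms, of "[]" "term_at \<Psi>"] by (simp add: ev_def)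
  finally show ?thesis .
qed

lemma invariant_del: "invariant \<Psi> \<Longrightarrow> invariant (\<lambda>l. \<Psi> (del k l))"
  using set_del by (fastforce simp: invariant_def map_del[symmetric])

text \<open>Every vertex but the first is erased by a contraction; the first one is rotated to the
  last place, which has index n.\<close>

lemma ev_del:
  assumes "invariant \<Psi>" "0 < n" "k \<le> n"
  shows "ev (Suc n) (\<lambda>l. \<Psi> (del k l)) = ev n \<Psi>"
proof (cases k)
  case 0
  obtain m where n: "n = Suc m" using assms by (cases n) auto
  have "ev (Suc n) (\<lambda>l. \<Psi> (del 0 l)) = ev (Suc n) (\<lambda>l. \<Psi> (del n (tl l @ [g \<otimes> hd l])))"
  proof (rule ev_cong)
    fix l :: "'a list" assume "length l = Suc n"
    then obtain x t where "l = x # t" "length t = n" by (cases l) auto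
    then show "\<Psi> (del 0 l) = \<Psi> (del n (tl l @ [g \<otimes> hd l]))"
      using del_last[of t] by simp
  qed
  also have "\<dots> = ev (Suc n) (\<lambda>l. \<Psi> (del n l))"
    by (rule ev_rotate[OF invariant_del[OF assms(1)]])
  also have "\<dots> = ev n \<Psi>" unfolding n by (rule ev_del_Suc) simp
  finally show ?thesis using 0 by simp
next
  case (Suc j)
  then show ?thesis using assms by (simp add: ev_del_Suc)
qed

end


section \<open>The cycles attached to an idempotent and their cap products\<close>

text \<open>In the application Q is the centralizer of g modulo the powers of g, p is the
  projection, and q is its composition with an equivariant map from G to the centralizer.\<close>

locale chern_cycles = cyclic_words G S C g "TYPE('q list)"
  for G :: "('a, 'm) monoid_scheme" (structure) and S C g +
  fixes Q :: "('q, 'n) monoid_scheme" and p q :: "'a \<Rightarrow> 'q"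
  assumes group_Q: "group Q"
    and q_closed: "x \<in> carrier G \<Longrightarrow> q x \<in> carrier Q"
    and p_closed: "z \<in> carrier G \<Longrightarrow> z \<otimes> g = g \<otimes> z \<Longrightarrow> p z \<in> carrier Q"
    and q_equivariant: "z \<in> carrier G \<Longrightarrow> z \<otimes> g = g \<otimes> z \<Longrightarrow> x \<in> carrier G \<Longrightarrow> q (z \<otimes> x) = p z \<otimes>\<^bsub>Q\<^esub> q x"
    and q_g: "x \<in> carrier G \<Longrightarrow> q (g \<otimes> x) = q x"
begin

sublocale Q: group Q by (rule group_Q)

definition qbar :: "'a list \<Rightarrow> ('q list \<Rightarrow>\<^sub>0 complex)" where
  "qbar t = bar_chain Q (map q t)"

definition A :: "'a list \<Rightarrow> ('q list \<Rightarrow>\<^sub>0 complex)" where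
  "A l = alt l qbar"

lemma set_map_q: "set l \<subseteq> carrier G \<Longrightarrow> set (map q l) \<subseteq> carrier Q"
  using q_closed by auto

lemma A_chains: "set l \<subseteq> carrier G \<Longrightarrow> length l = Suc n \<Longrightarrow> A l \<in> chains Q n"
  unfolding A_def qbar_def
  by (intro chains_alt Q.bar_chain_chains set_map_q) auto

lemma bar_boundary_qbar:
  "set l \<subseteq> carrier G \<Longrightarrow> length l \<ge> 2 \<Longrightarrow> bar_boundary Q (qbar l) = asum l (\<lambda>_ r. qbar r)"
  unfolding qbar_def by (subst Q.bar_boundary_bar_chain) (auto simp: asum_map q_closed)

lemma bar_boundary_A:
  assumes "set l \<subseteq> carrier G" "length l \<ge> 2"
  shows "bar_boundary Q (A l) = smul (of_nat (length l)) (asum l (\<lambda>_ r. A r))"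
proof -
  have "bar_boundary Q (A l) = alt l (\<lambda>t. asum t (\<lambda>_ r. qbar r))"
    unfolding A_def bar_boundary_alt using assms
    by (intro alt_cong bar_boundary_qbar) auto
  also have "\<dots> = smul (of_nat (length l)) (asum l (\<lambda>_ r. A r))"
    using assms unfolding A_def by (intro alt_boundary) auto
  finally show ?thesis .
qed

lemma A_g_snoc: "x \<in> carrier G \<Longrightarrow> A (r @ [g \<otimes> x]) = A (r @ [x])"
  using alt_map[of q "r @ [g \<otimes> x]" "bar_chain Q"] alt_map[of q "r @ [x]" "bar_chain Q"]
  by (simp add: A_def qbar_def[abs_def] q_g)

lemma bars_translate:
  "u \<in> carrier Q \<Longrightarrow> set l \<subseteq> carrier Q \<Longrightarrow> bars Q (map ((\<otimes>\<^bsub>Q\<^esub>) u) l) = bars Q l"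
proof (induction l rule: induct_list012)
  case (3 x y r)
  then show ?case
    by (simp add: Q.inv_mult_group Q.m_assoc Q.inv_cancel_left)
qed auto

text \<open>Translation of the vertices by z becomes translation by \<open>p z\<close> in Q, which
  \<open>bars\<close> does not see.\<close>

lemma invariant_A: "invariant A"
  unfolding invariant_def
proof (intro ballI allI impI)
  fix z l assume z: "z \<in> carrier G" "z \<otimes> g = g \<otimes> z" and l: "set l \<subseteq> carrier G"
  have "qbar (map ((\<otimes>) z) t) = qbar t" if "set t \<subseteq> carrier G" for t
  proof -
    have "map q (map ((\<otimes>) z) t) = map ((\<otimes>\<^bsub>Q\<^esub>) (p z)) (map q t)"
      using that q_equivariant[OF z] by auto
    then show ?thesis
      using bars_translate[OF p_closed[OF z] set_map_q[OF that]]
      by (simp add: qbar_def bar_chain_def del: map_map)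
  qed
  then show "A (map ((\<otimes>) z) l) = A l"
    unfolding A_def alt_map using l by (intro alt_cong) auto
qed

lemma alternating_sum_even: "even n \<Longrightarrow> (\<Sum>k<Suc n. smul ((- 1) ^ k) x) = x"
  by (induction n rule: induct_nat_012) auto

text \<open>All n + 1 deletions have the same value by \<open>ev_del\<close>; as n + 1 is odd, the
  alternating signs leave one copy.\<close>

lemma ev_asum:
  assumes "invariant \<Psi>" "even n" "0 < n"
  shows "ev (Suc n) (\<lambda>l. asum l (\<lambda>_ r. \<Psi> r)) = ev n \<Psi>"
proof -
  have "ev (Suc n) (\<lambda>l. asum l (\<lambda>_ r. \<Psi> r)) = ev (Suc n) (\<lambda>l. \<Sum>k<Suc n. smul ((- 1) ^ k) (\<Psi> (del k l)))"
    by (rule ev_cong) (simp add: asum_conv_sum)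
  also have "\<dots> = (\<Sum>k<Suc n. smul ((- 1) ^ k) (ev n \<Psi>))"
    unfolding ev_sum using assms by (intro sum.cong refl) (auto simp: ev_smul ev_del simp del: smul_power_minus_one)
  finally show ?thesis unfolding alternating_sum_even[OF assms(2)] .
qed

text \<open>Odd refers to the simplicial degree 2n + 1, where the rotation reverses the sign of
  \<open>A\<close>; the factor g that it introduces disappears under q.\<close>

lemma ev_A_odd: "ev (Suc (Suc (2 * n))) A = 0"
proof -
  let ?n = "Suc (2 * n)"
  have "ev (Suc ?n) A = ev (Suc ?n) (\<lambda>l. A (tl l @ [g \<otimes> hd l]))"
    by (rule ev_rotate[OF invariant_A, symmetric])
  also have "\<dots> = ev (Suc ?n) (\<lambda>l. smul (- 1) (A l))"
  proof (rule ev_cong)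
    fix l assume "set l \<subseteq> carrier G" "length l = Suc ?n"
    then obtain x t where l: "l = x # t" "length t = ?n" "x \<in> carrier G" by (cases l) auto
    have "A (x # t) = - A (t @ [x])"
      using alt_rotate[of x t qbar] l by (simp add: A_def)
    then show "A (tl l @ [g \<otimes> hd l]) = smul (- 1) (A l)"
      using l by (simp add: A_g_snoc)
  qed
  also have "\<dots> = - ev (Suc ?n) A" using ev_smul[of "Suc ?n" "-1" A] by simp
  finally show ?thesis by (simp add: eq_neg_chain)
qed

definition cycle :: "nat \<Rightarrow> ('q list \<Rightarrow>\<^sub>0 complex)" where
  "cycle n = ev (Suc (2 * n)) A"

lemma ev_chains:
  assumes "\<And>l. set l \<subseteq> carrier G \<Longrightarrow> length l = n \<Longrightarrow> \<Phi> l \<in> chains Q k"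
  shows "ev n \<Phi> \<in> chains Q k"
proof -
  have "term_at \<Phi> w \<in> chains Q k" if w: "w \<in> words S n" for w
    using words_letters[OF w] assms by (auto simp: term_at_def conjugator set_vertices)
  then show ?thesis unfolding ev_def by (intro chains_sum chains_smul)
qed

lemma cycle_chains: "cycle n \<in> chains Q (2 * n)"
  unfolding cycle_def by (intro ev_chains A_chains)

lemma bar_boundary_ev: "bar_boundary Q (ev n \<Phi>) = ev n (\<lambda>l. bar_boundary Q (\<Phi> l))"
  by (rule ev_linear) (simp_all add: bar_boundary_add bar_boundary_smul)

lemma cap_chain_ev: "cap_chain k \<phi> (ev n \<Phi>) = ev n (\<lambda>l. cap_chain k \<phi> (\<Phi> l))"
  by (rule ev_linear) (simp_all add: cap_chain_add cap_chain_smul)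

lemma bar_boundary_cycle: "bar_boundary Q (cycle n) = 0"
proof (cases n)
  case 0
  then have "Poly_Mapping.keys (cycle n) \<subseteq> {[]}"
    using cycle_chains[of n] by (auto simp: chains_def bar_simplices_def)
  then have "Poly_Mapping.keys (cycle n) - {[]} = {}" by blast
  then show ?thesis by (simp only: bar_boundary_def sum.empty)
next
  case (Suc m)
  have "bar_boundary Q (cycle n) = ev (Suc (2 * n)) (\<lambda>l. smul (of_nat (Suc (2 * n))) (asum l (\<lambda>_ r. A r)))"
    unfolding cycle_def bar_boundary_ev
    by (rule ev_cong) (simp add: bar_boundary_A Suc)
  also have "\<dots> = smul (of_nat (Suc (2 * n))) (ev (2 * n) A)"
    unfolding ev_smul by (subst ev_asum[OF invariant_A]) (auto simp: Suc)
  also have "ev (2 * n) A = 0" using ev_A_odd[of m] by (simp add: Suc)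
  finally show ?thesis by simp
qed

end

text \<open>The cochain a is only defined on pairs of vertices in G, but by coboundary_a its coboundary is
  the pullback of the cocycle phi on the quotient Q.\<close>

locale cap_with_coboundary = chern_cycles G S C g Q p q
  for G :: "('a, 'm) monoid_scheme" (structure) and S C g and Q :: "('q, 'n) monoid_scheme" and p q +
  fixes a :: "'a \<Rightarrow> 'a \<Rightarrow> complex" and \<phi> :: "'q list \<Rightarrow> int"
  assumes a_invariant: "z \<in> carrier G \<Longrightarrow> z \<otimes> g = g \<otimes> z \<Longrightarrow> x \<in> carrier G \<Longrightarrow> y \<in> carrier G
      \<Longrightarrow> a (z \<otimes> x) (z \<otimes> y) = a x y"
    and a_g: "x \<in> carrier G \<Longrightarrow> y \<in> carrier G \<Longrightarrow> a x (g \<otimes> y) = a x y - 1"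
    and coboundary_a: "x \<in> carrier G \<Longrightarrow> y \<in> carrier G \<Longrightarrow> z \<in> carrier G \<Longrightarrow>
      of_int (\<phi> [inv\<^bsub>Q\<^esub> q x \<otimes>\<^bsub>Q\<^esub> q y, inv\<^bsub>Q\<^esub> q y \<otimes>\<^bsub>Q\<^esub> q z]) = a x y + a y z - a x z"
begin

text \<open>The edge from x to y carries the weight a, and both of its ends are dropped from the
  simplex. Keeping x apart allows rotating the remaining vertices alone.\<close>

definition J :: "'a \<Rightarrow> 'a list \<Rightarrow> ('q list \<Rightarrow>\<^sub>0 complex)" where
  "J x l = asum l (\<lambda>y r. smul (a x y) (A r))"

definition K :: "'a list \<Rightarrow> ('q list \<Rightarrow>\<^sub>0 complex)" where
  "K l = asum l (\<lambda>x r. asum r (\<lambda>y s. smul (a x y) (alt s (\<lambda>t. qbar (y # t)))))"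

lemma K_chains: "set l \<subseteq> carrier G \<Longrightarrow> length l = Suc (Suc n) \<Longrightarrow> K l \<in> chains Q n"
  unfolding K_def qbar_def
  by (intro chains_asum chains_smul chains_alt Q.bar_chain_chains set_map_q) auto

text \<open>Of the three terms of the coboundary of a, the one in the first two vertices gives asum l J.
  The other two agree after antisymmetrization; there the common vertex is still the first vertex of
  the remaining simplex, and coning off that vertex (the chain K l) reduces them to asum l J.\<close>

lemma cap_chain_A:
  assumes "set l \<subseteq> carrier G" "length l = n + 3"
  shows "smul (of_nat (n + 1)) (cap_chain 2 \<phi> (A l))
    = smul (of_nat (n + 3)) (asum l J) - smul 2 (bar_boundary Q (K l))"
proof -
  let ?b = "\<lambda>z t. alt t (\<lambda>e. qbar (z # e))"
  let ?T = "asum l (\<lambda>x r. asum r (\<lambda>y s. asum s (\<lambda>z t. smul (a y z) (?b z t))))"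
  have H: "asum l J = asum l (\<lambda>x r. asum r (\<lambda>y s. smul (a x y) (A s)))"
    by (simp add: J_def[abs_def])
  have "A l = asum l (\<lambda>x r. asum r (\<lambda>y s. asum s (\<lambda>z t. alt t (\<lambda>e. qbar (x # y # z # e)))))"
    unfolding A_def
    by (subst alt_rec, use assms in force, intro asum_cong, subst alt_rec, use assms in force,
        intro asum_cong alt_rec, use assms in force)
  then have "cap_chain 2 \<phi> (A l)
     = asum l (\<lambda>x r. asum r (\<lambda>y s. asum s (\<lambda>z t. alt t (\<lambda>e. cap_chain 2 \<phi> (qbar (x # y # z # e))))))"
    by (simp add: cap_chain_asum cap_chain_alt)
  also have "\<dots> = asum l (\<lambda>x r. asum r (\<lambda>y s. asum s (\<lambda>z t. alt t (\<lambda>e. smul (a x y + a y z - a x z) (qbar (z # e))))))"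
    using assms(1)
    by (intro asum_cong alt_cong) (auto simp: qbar_def Q.cap_chain_2_bar_chain coboundary_a subset_iff)
  also have "\<dots> = asum l (\<lambda>x r. asum r (\<lambda>y s. smul (a x y) (asum s ?b)))
      + ?T - asum l (\<lambda>x r. asum r (\<lambda>y s. asum s (\<lambda>z t. smul (a x z) (?b z t))))"
    by (simp add: alt_smul alt_add alt_diff chains.scale_left_distrib chains.scale_left_diff_distrib
        asum_add asum_diff asum_smul)
  also have "asum l (\<lambda>x r. asum r (\<lambda>y s. smul (a x y) (asum s ?b))) = asum l J"
    unfolding H A_def using assms by (intro asum_cong arg_cong[of _ _ "smul _"] alt_rec[symmetric]) force
  \<comment> \<open>Exchanging the first two removals turns the weight \<open>a x z\<close> into
    \<open>a y z\<close> at the cost of a sign.\<close>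
  also have "asum l (\<lambda>x r. asum r (\<lambda>y s. asum s (\<lambda>z t. smul (a x z) (?b z t)))) = - ?T"
    by (rule asum_asum)
  finally have cap: "cap_chain 2 \<phi> (A l) = asum l J + smul 2 ?T"
    using chains.scale_left_distrib[of 1 1 ?T] by simp
  have "bar_boundary Q (K l) = asum l (\<lambda>x r. asum r (\<lambda>y s. smul (a x y)
      (A s - smul (of_nat (n + 1)) (asum s (\<lambda>_ t. ?b y t)))))"
    unfolding K_def bar_boundary_asum bar_boundary_smul bar_boundary_alt
  proof (intro asum_cong arg_cong[of _ _ "smul _"])
    fix x y and r s :: "'a list"
    assume r: "set r \<subseteq> set l" "Suc (length r) = length l"
      and s: "y \<in> set r" "set s \<subseteq> set r" "Suc (length s) = length r"
    have ls: "length s = n + 1" using assms r s by simp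
    \<comment> \<open>The boundary of the cone from y over t is t minus the cone over the boundary
      of t.\<close>
    have "alt s (\<lambda>t. bar_boundary Q (qbar (y # t))) = alt s (\<lambda>t. qbar t - asum t (\<lambda>_ e. qbar (y # e)))"
    proof (rule alt_cong)
      fix t assume "set t \<subseteq> set s" "length t = length s"
      then show "bar_boundary Q (qbar (y # t)) = qbar t - asum t (\<lambda>_ e. qbar (y # e))"
        using assms r s ls by (subst bar_boundary_qbar) auto
    qed
    also have "\<dots> = A s - smul (of_nat (length s)) (asum s (\<lambda>_ t. ?b y t))"
      unfolding alt_diff A_def using ls by (subst alt_boundary[of s "\<lambda>e. qbar (y # e)"]) auto
    finally show "alt s (\<lambda>t. bar_boundary Q (qbar (y # t))) = A s - smul (of_nat (n + 1)) (asum s (\<lambda>_ t. ?b y t))"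
      by (simp add: ls)
  qed
  also have "\<dots> = asum l J - asum l (\<lambda>x r. asum r (\<lambda>y s. smul (of_nat (n + 1)) (asum s (\<lambda>_ t. smul (a x y) (?b y t)))))"
    by (simp add: H chains.scale_right_diff_distrib asum_diff asum_smul mult.commute)
  also have "asum l (\<lambda>x r. asum r (\<lambda>y s. smul (of_nat (n + 1)) (asum s (\<lambda>_ t. smul (a x y) (?b y t)))))
     = smul (of_nat (n + 1)) (asum l (\<lambda>x r. asum r (\<lambda>y s. asum s (\<lambda>_ t. smul (a x y) (?b y t)))))"
    by (simp only: asum_smul)
  also have "asum l (\<lambda>x r. asum r (\<lambda>y s. asum s (\<lambda>_ t. smul (a x y) (?b y t)))) = ?T"
  proof -
    \<comment> \<open>Taking w out first instead of third is a cyclic permutation of three removals,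
      that is, two exchanges.\<close>
    have "asum l (\<lambda>x r. asum r (\<lambda>y s. asum s (\<lambda>w t. smul (a x y) (?b y t))))
       = - asum l (\<lambda>x r. asum r (\<lambda>w s. asum s (\<lambda>y t. smul (a x y) (?b y t))))"
      by (subst asum_asum) (simp add: asum_uminus)
    also have "\<dots> = ?T" by (subst asum_asum) simp
    finally show ?thesis .
  qed
  finally have dK: "bar_boundary Q (K l) = asum l J - smul (of_nat (n + 1)) ?T" .
  \<comment> \<open>Eliminates t between \<open>cap\<close>, which reads h + 2 t, and
    \<open>dK\<close>, which reads h - u t with u = n + 1; the coefficient left at h is u + 2 = n +
    3.\<close>
  have "smul u (h + smul 2 t) = smul (u + 2) h - smul 2 (h - smul u t)" for u and h t :: "'q list \<Rightarrow>\<^sub>0 complex"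
    by (simp add: chains.scale_right_distrib chains.scale_right_diff_distrib chains.scale_left_distrib mult.commute)
  moreover have "of_nat (n + 3) = of_nat (n + 1) + (2 :: complex)" by simp
  ultimately show ?thesis
    unfolding cap dK by (simp only:)
qed

text \<open>The rotated list has even length, so without the factor g the rotation would only
  reverse the sign of \<open>J\<close>. The shift by - 1 in \<open>a_g\<close> adds one copy of
  \<open>A r\<close>, the source of the nonzero multiple of the previous cycle.\<close>

lemma J_g_snoc:
  assumes "y \<in> carrier G" "set r \<subseteq> carrier G" "x \<in> carrier G" "odd (length r)"
  shows "J x (r @ [g \<otimes> y]) = A r - J x (y # r)"
proof -
  have 1: "asum r (\<lambda>y' ys. smul (a x y') (A (y # ys))) = asum r (\<lambda>y' ys. smul (a x y') (A (ys @ [y])))"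
  proof (rule asum_cong)
    fix y' and ys :: "'a list" assume "Suc (length ys) = length r"
    with assms(4) have "even (length ys)" by (metis even_Suc)
    then show "smul (a x y') (A (y # ys)) = smul (a x y') (A (ys @ [y]))"
      using alt_rotate[of y ys qbar] by (simp add: A_def)
  qed
  show ?thesis
    using assms by (simp add: J_def asum_snoc A_g_snoc a_g 1 chains.scale_left_diff_distrib)
qed

lemma invariant_J:
  assumes "z \<in> carrier G" "z \<otimes> g = g \<otimes> z" "x \<in> carrier G" "set l \<subseteq> carrier G"
  shows "J (z \<otimes> x) (map ((\<otimes>) z) l) = J x l"
  unfolding J_def asum_map
proof (rule asum_cong)
  fix y ys assume "y \<in> set l" "set ys \<subseteq> set l"
  then have "y \<in> carrier G" "set ys \<subseteq> carrier G" using assms by auto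
  then show "smul (a (z \<otimes> x) (z \<otimes> y)) (A (map ((\<otimes>) z) ys)) = smul (a x y) (A ys)"
    using assms invariant_A by (simp add: a_invariant invariant_def)
qed

text \<open>Splits \<open>asum l J\<close> into its terms, sign included; the value 0 past the end
  keeps it invariant on lists of every length.\<close>

definition J_at :: "nat \<Rightarrow> 'a list \<Rightarrow> ('q list \<Rightarrow>\<^sub>0 complex)" where
  "J_at i l = (if i < length l then smul ((- 1) ^ i) (J (l ! i) (del i l)) else 0)"

lemma invariant_J_at: "invariant (J_at i)"
  unfolding invariant_def
proof (intro ballI allI impI)
  fix z l assume z: "z \<in> carrier G" "z \<otimes> g = g \<otimes> z" and l: "set l \<subseteq> carrier G"
  show "J_at i (map ((\<otimes>) z) l) = J_at i l"
  proof (cases "i < length l")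
    case True
    then have "l ! i \<in> carrier G" "set (del i l) \<subseteq> carrier G" using l set_del[of i l] nth_mem by blast+
    with True show ?thesis
      using invariant_J[OF z] by (simp add: J_at_def map_del[symmetric] del: smul_power_minus_one)
  qed (simp add: J_at_def)
qed

text \<open>Rotation brings the vertex in position i + 1 to position i. For i < n + 2 the vertex
  that acquires the factor g is not the selected one, so \<open>J_g_snoc\<close> applies; its extra
  term is \<open>A\<close> with two vertices deleted, which \<open>ev_del\<close> evaluates.\<close>

lemma ev_J_at_Suc:
  assumes "even n" "i < n + 2"
  shows "ev (n + 3) (J_at i) = ev (n + 3) (J_at (Suc i)) + smul ((- 1) ^ i) (ev (Suc n) A)"
proof -
  have "ev (n + 3) (J_at i) = ev (n + 3) (\<lambda>l. J_at i (tl l @ [g \<otimes> hd l]))"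
    using ev_rotate[OF invariant_J_at, of "n + 2"] by (simp add: numeral_3_eq_3)
  also have "\<dots> = ev (n + 3) (\<lambda>l. J_at (Suc i) l + smul ((- 1) ^ i) (A (del i (del 0 l))))"
  proof (rule ev_cong)
    fix l assume l: "set l \<subseteq> carrier G" "length l = n + 3"
    then obtain y t where yt: "l = y # t" "length t = n + 2" "y \<in> carrier G" "set t \<subseteq> carrier G"
      by (cases l) auto
    have i: "i < length t" using yt assms by simp
    have len: "odd (length (del i t))" using assms i yt by (simp add: length_del)
    have cl: "set (del i t) \<subseteq> carrier G" "t ! i \<in> carrier G" using yt set_del[of i t] nth_mem[OF i] by blast+
    have "J_at i (t @ [g \<otimes> y]) = smul ((- 1) ^ i) (A (del i t) - J (t ! i) (y # del i t))"
      using i J_g_snoc[OF yt(3) cl len] by (simp add: J_at_def nth_append del_snoc del: smul_power_minus_one)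
    also have "\<dots> = J_at (Suc i) l + smul ((- 1) ^ i) (A (del i t))"
      using i by (simp add: yt(1) J_at_def)
    finally show "J_at i (tl l @ [g \<otimes> hd l]) = J_at (Suc i) l + smul ((- 1) ^ i) (A (del i (del 0 l)))"
      by (simp add: yt(1))
  qed
  also have "\<dots> = ev (n + 3) (J_at (Suc i)) + smul ((- 1) ^ i) (ev (n + 3) (\<lambda>l. A (del i (del 0 l))))"
    by (simp only: ev_add ev_smul)
  also have "ev (n + 3) (\<lambda>l. A (del i (del 0 l))) = ev (Suc n) A"
  proof -
    have "ev (n + 3) (\<lambda>l. A (del i (del 0 l))) = ev (Suc (Suc n)) (\<lambda>l. A (del i l))"
      using ev_del[OF invariant_del[OF invariant_A, of i], of "n + 2" 0] by (simp add: numeral_3_eq_3)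
    also have "\<dots> = ev (Suc n) A"
      using assms by (intro ev_del invariant_A) auto
    finally show ?thesis .
  qed
  finally show ?thesis .
qed

text \<open>The increments alternate in sign, so their partial sums are 0 or a single copy.\<close>

lemma ev_J_at:
  assumes "even n" "i \<le> n + 2"
  shows "ev (n + 3) (J_at i) = ev (n + 3) (J_at 0) - (if odd i then ev (Suc n) A else 0)"
  using assms(2)
proof (induction i)
  case (Suc i)
  have "ev (n + 3) (J_at (Suc i)) = ev (n + 3) (J_at i) - smul ((- 1) ^ i) (ev (Suc n) A)"
    using ev_J_at_Suc[OF assms(1), of i] Suc.prems by (simp del: smul_power_minus_one)
  also have "ev (n + 3) (J_at i) = ev (n + 3) (J_at 0) - (if odd i then ev (Suc n) A else 0)"
    using Suc by simp
  finally have *: "ev (n + 3) (J_at (Suc i)) = ev (n + 3) (J_at 0) - (if odd i then ev (Suc n) A else 0)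
      - smul ((- 1) ^ i) (ev (Suc n) A)" .
  show ?case unfolding * by (cases "even i") simp_all
qed simp

lemma sum_odd:
  "even n \<Longrightarrow> (\<Sum>i<n + 3. if odd i then x else 0) = smul (of_nat (n + 2) / 2) x"
proof (induction n rule: induct_nat_012)
  case 0
  then show ?case by (simp add: eval_nat_numeral)
next
  case (ge2 n)
  have "(\<Sum>i<Suc (Suc n) + 3. if odd i then x else 0) = x + (\<Sum>i<n + 3. if odd i then x else 0)"
    using ge2.prems unfolding add_Suc sum.lessThan_Suc by (simp add: add.commute)
  also have "\<dots> = x + smul (of_nat (n + 2) / 2) x"
    using ge2.IH(1) ge2.prems by simp
  also have "\<dots> = smul (1 + of_nat (n + 2) / 2) x" by (simp only: chains.scale_left_distrib chains.scale_one)
  finally show ?case by (simp add: field_simps)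
qed simp

text \<open>Each of the (n + 2) / 2 odd positions contributes one copy of the shorter sum; here the
  multiple of the previous cycle is counted.\<close>

lemma ev_asum_J:
  assumes "even n"
  shows "ev (n + 3) (\<lambda>l. asum l J)
    = smul (of_nat (n + 3)) (ev (n + 3) (J_at 0)) - smul (of_nat (n + 2) / 2) (ev (Suc n) A)"
proof -
  have "ev (n + 3) (\<lambda>l. asum l J) = ev (n + 3) (\<lambda>l. \<Sum>i<n + 3. J_at i l)"
    by (rule ev_cong) (simp add: asum_conv_sum J_at_def del: smul_power_minus_one)
  also have "\<dots> = (\<Sum>i<n + 3. ev (n + 3) (J_at 0) - (if odd i then ev (Suc n) A else 0))"
    unfolding ev_sum using assms by (intro sum.cong refl ev_J_at) auto
  also have "\<dots> = smul (of_nat (n + 3)) (ev (n + 3) (J_at 0)) - smul (of_nat (n + 2) / 2) (ev (Suc n) A)"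
    using sum_odd[OF assms, of "ev (Suc n) A"] by (simp only: sum_subtractf chains.sum_constant_scale card_lessThan)
  finally show ?thesis .
qed

text \<open>The bounding chain has one more vertex. Its first vertex x is kept only as an argument
  of a, and the boundary deletes the n + 3 others; under \<open>ev\<close> all these deletions have
  the same value, and as their number is odd, one copy survives.\<close>

lemma ev_J_boundary:
  assumes "even n"
  shows "ev (n + 3) (J_at 0) \<in> boundaries Q n"
proof -
  let ?X = "ev (Suc (n + 3)) (\<lambda>l. J (hd l) (tl l))"
  have "bar_boundary Q ?X = ev (Suc (n + 3)) (\<lambda>l. smul (- of_nat (n + 2))
      (\<Sum>k<n + 3. smul ((- 1) ^ k) (J_at 0 (del (Suc k) l))))"
    unfolding bar_boundary_ev
  proof (rule ev_cong)
    fix l assume l: "set l \<subseteq> carrier G" "length l = Suc (n + 3)"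
    then obtain x t where xt: "l = x # t" "length t = n + 3" "x \<in> carrier G" "set t \<subseteq> carrier G"
      by (cases l) auto
    have "bar_boundary Q (J x t) = asum t (\<lambda>y r. smul (a x y) (smul (of_nat (n + 2)) (asum r (\<lambda>_ s. A s))))"
      unfolding J_def bar_boundary_asum bar_boundary_smul
    proof (intro asum_cong arg_cong[of _ _ "smul _"])
      fix y r assume "set r \<subseteq> set t" "Suc (length r) = length t"
      then have "set r \<subseteq> carrier G" "length r = n + 2" using xt by auto
      then show "bar_boundary Q (A r) = smul (of_nat (n + 2)) (asum r (\<lambda>_ s. A s))"
        using bar_boundary_A[of r] by simp
    qed
    also have "\<dots> = asum t (\<lambda>y r. asum r (\<lambda>_ s. smul (of_nat (n + 2)) (smul (a x y) (A s))))"
      by (simp add: asum_smul mult.commute)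
    \<comment> \<open>The vertex deleted by the boundary is now taken out first, which leaves a
      shorter \<open>J x\<close>.\<close>
    also have "\<dots> = - asum t (\<lambda>_ r. asum r (\<lambda>y s. smul (of_nat (n + 2)) (smul (a x y) (A s))))"
      by (rule asum_asum)
    also have "\<dots> = smul (- of_nat (n + 2)) (asum t (\<lambda>_ r. J x r))"
      by (simp only: J_def asum_smul chains.scale_minus_left)
    also have "asum t (\<lambda>_ r. J x r) = (\<Sum>k<n + 3. smul ((- 1) ^ k) (J_at 0 (del (Suc k) l)))"
      unfolding asum_conv_sum xt by (simp add: J_at_def)
    finally show "bar_boundary Q (J (hd l) (tl l)) = smul (- of_nat (n + 2))
      (\<Sum>k<n + 3. smul ((- 1) ^ k) (J_at 0 (del (Suc k) l)))" by (simp only: xt list.sel)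
  qed
  also have "\<dots> = smul (- of_nat (n + 2)) (\<Sum>k<n + 3. smul ((- 1) ^ k) (ev (Suc (n + 3)) (\<lambda>l. J_at 0 (del (Suc k) l))))"
    by (simp only: ev_smul ev_sum)
  also have "(\<Sum>k<n + 3. smul ((- 1) ^ k) (ev (Suc (n + 3)) (\<lambda>l. J_at 0 (del (Suc k) l))))
     = (\<Sum>k<n + 3. smul ((- 1) ^ k) (ev (n + 3) (J_at 0)))"
    by (intro sum.cong refl arg_cong[of _ _ "smul _"] ev_del_Suc) auto
  also have "\<dots> = ev (n + 3) (J_at 0)"
    using alternating_sum_even[of "n + 2"] assms by (simp add: numeral_3_eq_3)
  finally have *: "bar_boundary Q ?X = smul (- of_nat (n + 2)) (ev (n + 3) (J_at 0))" .
  have "?X \<in> chains Q (Suc n)"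
  proof (rule ev_chains)
    fix l assume "set l \<subseteq> carrier G" "length l = Suc (n + 3)"
    then show "J (hd l) (tl l) \<in> chains Q (Suc n)"
      unfolding J_def by (cases l) (auto intro!: chains_asum chains_smul A_chains)
  qed
  then have "smul (- of_nat (n + 2)) (ev (n + 3) (J_at 0)) \<in> boundaries Q n"
    unfolding boundaries_eq *[symmetric] by blast
  then have "smul (- 1 / of_nat (n + 2)) (smul (- of_nat (n + 2)) (ev (n + 3) (J_at 0))) \<in> boundaries Q n"
    by (rule boundaries_smul)
  moreover have "(- 1 / of_nat (n + 2)) * (- of_nat (n + 2)) = (1 :: complex)"
    using of_nat_neq_0[of "Suc n", where 'a = complex] by (simp add: field_simps)
  ultimately show ?thesis by (simp only: chains.scale_scale chains.scale_one)
qed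

text \<open>With m = 2n, the factor m + 1 comes from the boundary of the cone \<open>K\<close>, m +
  3 = (m + 1) + 2 from the elimination in \<open>cap_chain_A\<close>, and n + 1 = (m + 2) / 2 from
  the count in \<open>ev_asum_J\<close>.\<close>

lemma cap_chain_cycle:
  "smul (of_nat (2 * n + 1)) (cap_chain 2 \<phi> (cycle (Suc n))) + smul (of_nat ((2 * n + 3) * (n + 1))) (cycle n)
    \<in> boundaries Q (2 * n)"
proof -
  let ?n = "2 * n"
  have "smul (of_nat (?n + 1)) (cap_chain 2 \<phi> (cycle (Suc n)))
     = ev (?n + 3) (\<lambda>l. smul (of_nat (?n + 1)) (cap_chain 2 \<phi> (A l)))"
    by (simp add: cycle_def cap_chain_ev ev_smul eval_nat_numeral)
  also have "\<dots> = ev (?n + 3) (\<lambda>l. smul (of_nat (?n + 3)) (asum l J) - smul 2 (bar_boundary Q (K l)))"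
    by (intro ev_cong cap_chain_A)
  also have "\<dots> = smul (of_nat (?n + 3)) (ev (?n + 3) (\<lambda>l. asum l J)) - smul 2 (bar_boundary Q (ev (?n + 3) K))"
    by (simp only: ev_diff ev_smul bar_boundary_ev)
  also have "\<dots> = smul (of_nat (?n + 3) * of_nat (?n + 3)) (ev (?n + 3) (J_at 0))
      - smul (of_nat ((2 * n + 3) * (n + 1))) (cycle n) - smul 2 (bar_boundary Q (ev (?n + 3) K))"
  proof -
    have "of_nat (?n + 3) * (of_nat (?n + 2) / 2) = (of_nat ((2 * n + 3) * (n + 1)) :: complex)"
      by (simp add: field_simps)
    moreover have "even ?n" by simp
    ultimately show ?thesis
      by (simp only: ev_asum_J chains.scale_right_diff_distrib chains.scale_scale cycle_def)
  qed
  finally have "smul (of_nat (?n + 1)) (cap_chain 2 \<phi> (cycle (Suc n))) + smul (of_nat ((2 * n + 3) * (n + 1))) (cycle n)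
     = smul (of_nat (?n + 3) * of_nat (?n + 3)) (ev (?n + 3) (J_at 0)) - smul 2 (bar_boundary Q (ev (?n + 3) K))"
    by simp
  moreover have "ev (?n + 3) K \<in> chains Q (Suc ?n)"
    by (intro ev_chains K_chains) auto
  then have "bar_boundary Q (ev (?n + 3) K) \<in> boundaries Q ?n" by (auto simp: boundaries_eq)
  ultimately show ?thesis
    using ev_J_boundary[of ?n] by (simp add: boundaries_diff boundaries_smul)
qed

end


section \<open>The Gysin homomorphism on cosets\<close>

text \<open>The operation of \<open>cycle_group Q m\<close> is the same addition in every degree m,
  so cosets formed in different degrees can be compared.\<close>

lemma boundaries_coset: "boundaries Q n #>\<^bsub>cycle_group Q m\<^esub> c = {b + c | b. b \<in> boundaries Q n}"
  by (auto simp: r_coset_def cycle_group_def chain_group_def)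

lemma boundaries_coset_eq:
  assumes "c - d \<in> boundaries Q n"
  shows "boundaries Q n #>\<^bsub>cycle_group Q m\<^esub> c = boundaries Q n #>\<^bsub>cycle_group Q k\<^esub> d"
proof -
  have "b + c \<in> {b + d | b. b \<in> boundaries Q n}" if "b \<in> boundaries Q n" for b
    using boundaries_add[OF that assms] by (auto intro!: exI[of _ "b + (c - d)"])
  moreover have "b + d \<in> {b + c | b. b \<in> boundaries Q n}" if "b \<in> boundaries Q n" for b
    using boundaries_diff[OF that assms] by (auto intro!: exI[of _ "b - (c - d)"])
  ultimately show ?thesis unfolding boundaries_coset by blast
qed

lemma boundaries_coset_zero: "boundaries Q n #>\<^bsub>cycle_group Q m\<^esub> 0 = boundaries Q n"
  by (auto simp: boundaries_coset)

lemma mem_boundaries_coset: "c \<in> boundaries Q n #>\<^bsub>cycle_group Q m\<^esub> c"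
  unfolding boundaries_coset by (rule CollectI, rule exI[of _ 0]) simp

context group begin

lemma subgroup_centralizer:
  assumes "g \<in> carrier G"
  shows "subgroup {h \<in> carrier G. h \<otimes> g = g \<otimes> h} G"
proof (rule subgroupI)
  fix a assume "a \<in> {h \<in> carrier G. h \<otimes> g = g \<otimes> h}"
  then have a: "a \<in> carrier G" "a \<otimes> g = g \<otimes> a" by auto
  have "inv a \<otimes> g = inv a \<otimes> (g \<otimes> a) \<otimes> inv a" using a(1) assms by (simp add: m_assoc)
  also have "\<dots> = g \<otimes> inv a" unfolding a(2)[symmetric] using a(1) assms by (simp add: m_assoc[symmetric])
  finally show "inv a \<in> {h \<in> carrier G. h \<otimes> g = g \<otimes> h}" using a by simp
next
  fix a b assume "a \<in> {h \<in> carrier G. h \<otimes> g = g \<otimes> h}" "b \<in> {h \<in> carrier G. h \<otimes> g = g \<otimes> h}"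
  then have a: "a \<in> carrier G" "a \<otimes> g = g \<otimes> a" and b: "b \<in> carrier G" "b \<otimes> g = g \<otimes> b" by auto
  have "a \<otimes> b \<otimes> g = a \<otimes> (g \<otimes> b)" using a(1) b assms by (simp add: m_assoc)
  also have "\<dots> = g \<otimes> (a \<otimes> b)" using a b(1) assms by (simp add: m_assoc[symmetric])
  finally show "a \<otimes> b \<in> {h \<in> carrier G. h \<otimes> g = g \<otimes> h}" using a b by simp
qed (use assms in auto)

end

section \<open>The central extension of the reduced centralizer by the powers of g\<close>

locale infinite_order_element = group G for G :: "('a, 'm) monoid_scheme" (structure) +
  fixes g :: 'a
  assumes g_in: "g \<in> carrier G" and ord_g: "ord g = 0"
begin

abbreviation "Z \<equiv> centralizer G g"
abbreviation "Q \<equiv> reduced_centralizer G g"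

definition proj :: "'a \<Rightarrow> 'a set" where
  "proj z = generate G {g} #> z"

lemma carrier_Z: "z \<in> carrier Z \<longleftrightarrow> z \<in> carrier G \<and> z \<otimes> g = g \<otimes> z"
  by (simp add: centralizer_def)

lemma mult_Z [simp]: "monoid.mult Z = monoid.mult G" and one_Z [simp]: "\<one>\<^bsub>Z\<^esub> = \<one>"
  by (simp_all add: centralizer_def)

lemma subgroup_Z: "subgroup (carrier Z) G"
  using subgroup_centralizer[OF g_in] by (simp add: centralizer_def)

lemma Z_closed:
  "x \<in> carrier Z \<Longrightarrow> y \<in> carrier Z \<Longrightarrow> x \<otimes> y \<in> carrier Z"
  "x \<in> carrier Z \<Longrightarrow> inv x \<in> carrier Z"
  "g \<in> carrier Z" "\<one> \<in> carrier Z"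
  "x \<in> carrier Z \<Longrightarrow> x \<in> carrier G"
  using subgroup.m_closed[OF subgroup_Z] subgroup.m_inv_closed[OF subgroup_Z] subgroup.one_closed[OF subgroup_Z]
    subgroup.mem_carrier[OF subgroup_Z] g_in by (blast, blast, simp add: carrier_Z, blast, blast)

lemma group_Z: "group Z"
proof -
  have "Z = G\<lparr>carrier := carrier Z\<rparr>" by (simp add: centralizer_def)
  then show ?thesis using subgroup_imp_group[OF subgroup_Z] by simp
qed

lemma pow_closed [simp]: "g [^] (k::int) \<in> carrier G"
  using g_in by simp

lemma pow_central: "z \<in> carrier Z \<Longrightarrow> z \<otimes> g [^] (k::int) = g [^] k \<otimes> z"
  using subgroup_int_pow_closed[OF subgroup_centralizer, of z g k] g_in by (auto simp: carrier_Z)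

lemma powers: "generate G {g} = {g [^] (k::int) | k. True}"
  using generate_pow[OF g_in] by simp

lemma pow_Z: "g [^] (k::int) \<in> carrier Z"
  using pow_central[of g k] g_in by (simp add: carrier_Z)

lemma normal_powers: "generate G {g} \<lhd> Z"
proof (rule group.normalI[OF group_Z])
  have "subgroup (generate G {g}) (G\<lparr>carrier := carrier Z\<rparr>)"
    by (intro subgroup_incl generate_is_subgroup subgroup_Z) (use g_in powers pow_Z in auto)
  then show "subgroup (generate G {g}) Z" by (simp add: centralizer_def)
  show "\<forall>x\<in>carrier Z. generate G {g} #>\<^bsub>Z\<^esub> x = x <#\<^bsub>Z\<^esub> generate G {g}"
    by (auto simp: r_coset_def l_coset_def powers pow_central)
qed

lemma coset_Z: "generate G {g} #>\<^bsub>Z\<^esub> z = proj z"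
  by (simp add: proj_def r_coset_def)

lemma mem_proj: "x \<in> proj z \<longleftrightarrow> (\<exists>k::int. x = g [^] k \<otimes> z)"
  by (auto simp: proj_def r_coset_def powers)

lemma carrier_Q: "carrier Q = proj ` carrier Z"
  by (auto simp: reduced_centralizer_def FactGroup_def RCOSETS_def coset_Z)

lemma group_Q: "group Q"
  unfolding reduced_centralizer_def by (rule normal.factorgroup_is_group[OF normal_powers])

lemma mult_Q: "x \<in> carrier Z \<Longrightarrow> y \<in> carrier Z \<Longrightarrow> proj x \<otimes>\<^bsub>Q\<^esub> proj y = proj (x \<otimes> y)"
  using normal.rcos_sum[OF normal_powers, of x y]
  by (simp add: reduced_centralizer_def FactGroup_def coset_Z)

lemma proj_in: "z \<in> carrier Z \<Longrightarrow> proj z \<in> carrier Q"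
  by (simp add: carrier_Q)

lemma one_Q: "\<one>\<^bsub>Q\<^esub> = proj \<one>"
proof -
  have "proj \<one> = generate G {g}"
    using g_in by (auto simp: proj_def r_coset_def powers)
  then show ?thesis by (simp add: reduced_centralizer_def FactGroup_def)
qed

lemma inv_Q: "x \<in> carrier Z \<Longrightarrow> inv\<^bsub>Q\<^esub> proj x = proj (inv x)"
  by (rule group.inv_equality[OF group_Q]) (simp_all add: mult_Q Z_closed proj_in one_Q)

lemma proj_pow: "z \<in> carrier Z \<Longrightarrow> proj (g [^] (k::int) \<otimes> z) = proj z"
proof -
  assume z: "z \<in> carrier Z"
  have "proj (g [^] k) = proj \<one>"
  proof -
    have "\<exists>j::int. g [^] i = g [^] j \<otimes> g [^] k" for i :: int
      using int_pow_mult[OF g_in, of "i - k" k] by (intro exI[of _ "i - k"]) simp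
    moreover have "\<exists>j::int. g [^] i \<otimes> g [^] k = g [^] j" for i :: int
      using int_pow_mult[OF g_in, of i k] by metis
    ultimately show ?thesis using g_in by (auto simp: set_eq_iff mem_proj)
  qed
  then have "proj (g [^] k \<otimes> z) = proj (\<one> \<otimes> z)"
    using mult_Q[OF pow_Z[of k] z] mult_Q[OF Z_closed(4) z] by simp
  then show ?thesis using z by (simp add: Z_closed)
qed

text \<open>The predicate depends on x only through the coset Z x, hence so does the choice, and
  this makes \<open>retract\<close> equivariant. On Z itself \<open>retract\<close> is right
  translation by a fixed element.\<close>

definition coset_rep :: "'a \<Rightarrow> 'a" where
  "coset_rep x = (SOME t. t \<in> carrier G \<and> x \<otimes> inv t \<in> carrier Z)"

definition retract :: "'a \<Rightarrow> 'a" where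
  "retract x = x \<otimes> inv (coset_rep x)"

lemma coset_rep:
  assumes "x \<in> carrier G"
  shows "coset_rep x \<in> carrier G" "retract x \<in> carrier Z"
proof -
  have "\<exists>t. t \<in> carrier G \<and> x \<otimes> inv t \<in> carrier Z"
    using assms Z_closed by (intro exI[of _ x]) simp
  from someI_ex[OF this] show "coset_rep x \<in> carrier G" "retract x \<in> carrier Z"
    unfolding coset_rep_def retract_def by blast+
qed

lemma retract_mult:
  assumes "z \<in> carrier Z" "x \<in> carrier G"
  shows "retract (z \<otimes> x) = z \<otimes> retract x"
proof -
  note z = assms(1) Z_closed(5)[OF assms(1)]
  have "z \<otimes> x \<otimes> inv t \<in> carrier Z \<longleftrightarrow> x \<otimes> inv t \<in> carrier Z" if t: "t \<in> carrier G" for t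
  proof
    assume "z \<otimes> x \<otimes> inv t \<in> carrier Z"
    then have "inv z \<otimes> (z \<otimes> x \<otimes> inv t) \<in> carrier Z"
      by (rule Z_closed(1)[OF Z_closed(2)[OF z(1)]])
    moreover have "inv z \<otimes> (z \<otimes> x \<otimes> inv t) = x \<otimes> inv t"
      using z assms(2) t by (simp add: m_assoc inv_cancel_left)
    ultimately show "x \<otimes> inv t \<in> carrier Z" by simp
  next
    assume "x \<otimes> inv t \<in> carrier Z"
    then have "z \<otimes> (x \<otimes> inv t) \<in> carrier Z" by (rule Z_closed(1)[OF z(1)])
    then show "z \<otimes> x \<otimes> inv t \<in> carrier Z" using z(2) assms(2) t by (simp add: m_assoc)
  qed
  then have "coset_rep (z \<otimes> x) = coset_rep x" unfolding coset_rep_def by meson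
  then show ?thesis using z assms coset_rep by (simp add: retract_def m_assoc)
qed

text \<open>The coordinate of z along the powers of g with respect to the section s, unique because
  g has infinite order.\<close>

definition exponent :: "('a set \<Rightarrow> 'a) \<Rightarrow> 'a \<Rightarrow> int" where
  "exponent s z = (THE k. z = g [^] k \<otimes> s (proj z))"

lemma pow_inj: "g [^] (k::int) = g [^] (j::int) \<Longrightarrow> k = j"
  using int_pow_eq[OF g_in, of k j] ord_g by simp

lemma pow_cancel: "x \<in> carrier G \<Longrightarrow> g [^] (k::int) \<otimes> x = g [^] (j::int) \<otimes> x \<Longrightarrow> k = j"
  using pow_inj[of k j] g_in by simp

lemma exponent_unique:
  assumes "s \<in> centralizer_sections G g" "z \<in> carrier Z" "z = g [^] k \<otimes> s (proj z)"
  shows "exponent s z = k"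
  unfolding exponent_def
proof (rule the_equality, rule assms(3))
  fix j :: int assume j: "z = g [^] j \<otimes> s (proj z)"
  have "s (proj z) \<in> proj z" using assms proj_in by (auto simp: centralizer_sections_def)
  then have "s (proj z) \<in> carrier G" using assms(2) g_in Z_closed by (auto simp: mem_proj)
  then show "j = k" using pow_cancel[of "s (proj z)" j k] j assms(3) by simp
qed

lemma section_closed:
  assumes "s \<in> centralizer_sections G g" "z \<in> carrier Z"
  shows "s (proj z) \<in> carrier G"
proof -
  have "s (proj z) \<in> proj z" using assms proj_in by (auto simp: centralizer_sections_def)
  then show ?thesis using assms(2) g_in Z_closed by (auto simp: mem_proj)
qed

lemma exponent:
  assumes s: "s \<in> centralizer_sections G g" and z: "z \<in> carrier Z"
  shows "z = g [^] exponent s z \<otimes> s (proj z)"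
proof -
  have "s (proj z) \<in> proj z" using assms proj_in by (auto simp: centralizer_sections_def)
  then obtain k :: int where k: "s (proj z) = g [^] k \<otimes> z" by (auto simp: mem_proj)
  then have "z = g [^] (- k) \<otimes> s (proj z)"
    using z g_in Z_closed(5)[OF z] by (simp add: int_pow_neg inv_cancel_left)
  with exponent_unique[OF s z this] show ?thesis by simp
qed

lemma exponent_g_mult:
  assumes s: "s \<in> centralizer_sections G g" and z: "z \<in> carrier Z"
  shows "exponent s (g \<otimes> z) = exponent s z + 1"
proof (rule exponent_unique[OF s])
  have p: "proj (g \<otimes> z) = proj z" using proj_pow[OF z, of 1] g_in by (simp add: int_pow_1)
  have "g \<otimes> z = g [^] (1::int) \<otimes> (g [^] exponent s z \<otimes> s (proj z))"
    using exponent[OF s z] g_in by (simp add: int_pow_1)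
  also have "\<dots> = g [^] (1 + exponent s z) \<otimes> s (proj z)"
    using section_closed[OF s z] g_in by (simp add: int_pow_mult m_assoc del: int_pow_1)
  finally show "g \<otimes> z = g [^] (exponent s z + 1) \<otimes> s (proj (g \<otimes> z))"
    unfolding p by (simp only: add.commute)
qed (use z Z_closed in auto)

text \<open>Powers of g are central in Z, so they can be collected when the representatives of u and
  v are multiplied. Pulled back to Z, the factor set is thus the coboundary of minus the
  exponent.\<close>

lemma factor_set_eq:
  assumes s: "s \<in> centralizer_sections G g" and u: "u \<in> carrier Z" and v: "v \<in> carrier Z"
  shows "factor_set G g s [proj u, proj v] = exponent s (u \<otimes> v) - exponent s u - exponent s v"
proof -
  let ?su = "s (proj u)" and ?sv = "s (proj v)" and ?suv = "s (proj (u \<otimes> v))"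
  let ?a = "exponent s u" and ?b = "exponent s v" and ?c = "exponent s (u \<otimes> v)"
  have uv: "u \<otimes> v \<in> carrier Z" using u v by (rule Z_closed)
  note closed = section_closed[OF s u] section_closed[OF s v] section_closed[OF s uv]
    Z_closed(5)[OF u] Z_closed(5)[OF v]
  have inv1: "s (proj z) = g [^] (- exponent s z) \<otimes> z" if z: "z \<in> carrier Z" for z
  proof -
    have "g [^] (- exponent s z) \<otimes> z = g [^] (- exponent s z) \<otimes> (g [^] exponent s z \<otimes> s (proj z))"
      by (rule arg_cong[OF exponent[OF s z]])
    then show ?thesis
      using section_closed[OF s z] g_in by (simp add: int_pow_neg inv_cancel_left)
  qed
  have "?su \<otimes> ?sv = g [^] (- ?a) \<otimes> (u \<otimes> g [^] (- ?b)) \<otimes> v"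
    unfolding inv1[OF u] inv1[OF v] using closed g_in by (simp add: m_assoc)
  also have "\<dots> = g [^] (- ?a) \<otimes> g [^] (- ?b) \<otimes> (u \<otimes> v)"
    unfolding pow_central[OF u] using closed g_in by (simp add: m_assoc)
  also have "\<dots> = g [^] (- ?a) \<otimes> g [^] (- ?b) \<otimes> (g [^] ?c \<otimes> ?suv)"
    using exponent[OF s uv] by simp
  also have "\<dots> = g [^] (?c - ?a - ?b) \<otimes> ?suv"
  proof -
    have "g [^] (- ?a) \<otimes> g [^] (- ?b) \<otimes> g [^] ?c = g [^] (?c - ?a - ?b)"
      by (simp only: int_pow_mult[OF g_in, symmetric]) (simp add: algebra_simps)
    then show ?thesis using closed g_in by (simp add: m_assoc[symmetric])
  qed
  finally have eq: "?su \<otimes> ?sv = g [^] (?c - ?a - ?b) \<otimes> ?suv" .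
  have "[proj u, proj v] \<in> bar_simplices Q 2"
    using u v by (simp add: bar_simplices_def proj_in)
  then have "factor_set G g s [proj u, proj v] = (THE k::int. ?su \<otimes> ?sv = g [^] k \<otimes> ?suv)"
    using u v by (simp add: factor_set_def mult_Q)
  also have "\<dots> = ?c - ?a - ?b"
    by (rule the_equality, rule eq) (use eq closed pow_cancel in auto)
  finally show ?thesis .
qed

text \<open>Lifted to Z, every value is a combination of three exponents, and these cancel in the
  alternating sum.\<close>

lemma factor_set_cocycle:
  assumes s: "s \<in> centralizer_sections G g" and "{x, y, z, w} \<subseteq> carrier Q"
  shows "factor_set G g s [inv\<^bsub>Q\<^esub> y \<otimes>\<^bsub>Q\<^esub> z, inv\<^bsub>Q\<^esub> z \<otimes>\<^bsub>Q\<^esub> w] - factor_set G g s [inv\<^bsub>Q\<^esub> x \<otimes>\<^bsub>Q\<^esub> z, inv\<^bsub>Q\<^esub> z \<otimes>\<^bsub>Q\<^esub> w]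
      + factor_set G g s [inv\<^bsub>Q\<^esub> x \<otimes>\<^bsub>Q\<^esub> y, inv\<^bsub>Q\<^esub> y \<otimes>\<^bsub>Q\<^esub> w] - factor_set G g s [inv\<^bsub>Q\<^esub> x \<otimes>\<^bsub>Q\<^esub> y, inv\<^bsub>Q\<^esub> y \<otimes>\<^bsub>Q\<^esub> z] = 0"
proof -
  have lift: "\<exists>v. q = proj v \<and> v \<in> carrier Z" if "q \<in> carrier Q" for q
    using that by (auto simp: carrier_Q)
  obtain x' y' z' w' where xs: "x = proj x'" "y = proj y'" "z = proj z'" "w = proj w'"
    and Z: "x' \<in> carrier Z" "y' \<in> carrier Z" "z' \<in> carrier Z" "w' \<in> carrier Z"
    using lift[of x] lift[of y] lift[of z] lift[of w] assms(2) by auto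
  note Z' = Z[THEN Z_closed(5)]
  have *: "inv a \<otimes> b \<otimes> (inv b \<otimes> c) = inv a \<otimes> c" if "a \<in> carrier G" "b \<in> carrier G" "c \<in> carrier G" for a b c
    using that by (simp add: m_assoc inv_cancel_left)
  show ?thesis unfolding xs using Z Z'
    by (simp add: inv_Q mult_Q Z_closed factor_set_eq[OF s] *)
qed

end


section \<open>Independence of the Gysin homomorphism from representatives, and the lift to the
  inverse limit\<close>

context infinite_order_element begin

lemma centralizer_section_exists: "centralizer_sections G g \<noteq> {}"
proof -
  have "(\<lambda>q. SOME z. z \<in> q) \<in> centralizer_sections G g"
    unfolding centralizer_sections_def
  proof (rule Pi_I)
    fix q assume "q \<in> carrier Q"
    then obtain z where "z \<in> carrier Z" "q = proj z" by (auto simp: carrier_Q)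
    then have "z \<in> q" using Z_closed(5)[of z] by (auto simp: mem_proj intro!: exI[of _ 0])
    then show "(SOME z. z \<in> q) \<in> q" by (rule someI)
  qed
  then show ?thesis by blast
qed

text \<open>The cochains agree pointwise only on 2-simplices over Q, so the decomposition is
  recorded through cap products with chains.\<close>

lemma cap_chain_euler_class:
  assumes "\<phi> \<in> euler_class G g"
  obtains s \<psi> where "s \<in> centralizer_sections G g"
    and "\<And>n x. x \<in> chains Q (2 + n) \<Longrightarrow>
      cap_chain 2 \<phi> x = cap_chain 2 (coboundary Q 1 \<psi>) x + cap_chain 2 (factor_set G g s) x"
proof -
  have cb: "coboundaries Q 2 = coboundary Q 1 ` carrier (cochain_group Q 1)"
    unfolding coboundaries_def numeral_2_eq_2 by simp
  from assms obtain s \<psi> where s: "s \<in> centralizer_sections G g"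
    and \<phi>: "\<phi> = (\<lambda>xs\<in>bar_simplices Q 2. coboundary Q 1 \<psi> xs + factor_set G g s xs)"
    by (auto simp: euler_class_def r_coset_def cocycle_group_def cochain_group_def cb)
  have "cap_chain 2 \<phi> x = cap_chain 2 (coboundary Q 1 \<psi>) x + cap_chain 2 (factor_set G g s) x"
    if "x \<in> chains Q (2 + n)" for n x
    unfolding cap_chain_lin lin_fun_add[symmetric]
  proof (rule group.lin_ext[OF group_Q that])
    fix xs assume "xs \<in> bar_simplices Q (2 + n)"
    then have "take 2 xs \<in> bar_simplices Q 2" by (auto simp: bar_simplices_def dest: in_set_takeD)
    then show "Poly_Mapping.single (drop 2 xs) (of_int (\<phi> (take 2 xs)))
      = Poly_Mapping.single (drop 2 xs) (of_int (coboundary Q 1 \<psi> (take 2 xs)))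
        + Poly_Mapping.single (drop 2 xs) (complex_of_int (factor_set G g s (take 2 xs)))"
      by (simp add: \<phi> single_add)
  qed
  with s that show ?thesis by blast
qed

text \<open>The Gysin homomorphism is a union over the Euler class; for an empty class its value
  would be the empty set instead of a coset.\<close>

lemma euler_class_nonempty: "euler_class G g \<noteq> {}"
proof -
  obtain s where "s \<in> centralizer_sections G g" using centralizer_section_exists by blast
  moreover have "coboundaries Q 2 \<noteq> {}"
  proof -
    have "(\<lambda>xs\<in>bar_simplices Q 1. 0) \<in> carrier (cochain_group Q 1)"
      by (simp add: cochain_group_def)
    then show ?thesis unfolding coboundaries_def numeral_2_eq_2 by auto
  qed
  ultimately show ?thesis by (auto simp: euler_class_def r_coset_def)
qed

text \<open>Changing the cocycle by a coboundary adds a boundary by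
  \<open>cap_chain_coboundary\<close>, and changing the cycle by a boundary does so by
  \<open>cap_chain_2_boundary\<close>. The Euler class collects the factor sets of all sections, so
  y has to serve every s.\<close>

lemma gysin_coset:
  assumes x: "x \<in> chains Q (Suc (Suc n))" "bar_boundary Q x = 0"
    and y: "\<And>s. s \<in> centralizer_sections G g \<Longrightarrow> cap_chain 2 (factor_set G g s) x - y \<in> boundaries Q n"
  shows "gysin G g n (boundaries Q (Suc (Suc n)) #>\<^bsub>cycle_group Q m\<^esub> x) = boundaries Q n #>\<^bsub>cycle_group Q k\<^esub> y"
proof -
  interpret Q: group Q by (rule group_Q)
  let ?X = "boundaries Q (Suc (Suc n)) #>\<^bsub>cycle_group Q m\<^esub> x"
  have "boundaries Q n #>\<^bsub>cycle_group Q n\<^esub> cap_chain 2 \<phi> c = boundaries Q n #>\<^bsub>cycle_group Q k\<^esub> y"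
    if \<phi>: "\<phi> \<in> euler_class G g" and c: "c \<in> ?X" for \<phi> c
  proof (rule boundaries_coset_eq)
    obtain s \<psi> where s: "s \<in> centralizer_sections G g"
      and cap: "\<And>n x. x \<in> chains Q (2 + n) \<Longrightarrow>
        cap_chain 2 \<phi> x = cap_chain 2 (coboundary Q 1 \<psi>) x + cap_chain 2 (factor_set G g s) x"
      using cap_chain_euler_class[OF \<phi>] by blast
    from c obtain b where b: "b \<in> chains Q (Suc (Suc (Suc n)))" "c = bar_boundary Q b + x"
      unfolding boundaries_coset by (auto simp: boundaries_eq)
    have c': "c \<in> chains Q (Suc (Suc n))" "bar_boundary Q c = 0"
      using b x by (auto simp: chains_add Q.bar_boundary_chains bar_boundary_add Q.bar_boundary_bar_boundary)
    have "cap_chain 1 \<psi> c \<in> chains Q (Suc n)" using c' by (intro Q.cap_chain_chains) simp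
    moreover have "cap_chain 2 (coboundary Q 1 \<psi>) c = bar_boundary Q (cap_chain 1 \<psi> c)"
      using Q.cap_chain_coboundary[OF c'(1), of \<psi>] c'(2) by (simp add: cap_chain_def)
    ultimately have 1: "cap_chain 2 (coboundary Q 1 \<psi>) c \<in> boundaries Q n" by (auto simp: boundaries_eq)
    have "cap_chain 2 (factor_set G g s) b \<in> chains Q (Suc n)" using b by (intro Q.cap_chain_chains) simp
    moreover have "cap_chain 2 (factor_set G g s) (bar_boundary Q b) = bar_boundary Q (cap_chain 2 (factor_set G g s) b)"
      by (rule Q.cap_chain_2_boundary[OF _ b(1)]) (rule factor_set_cocycle[OF s])
    ultimately have 2: "cap_chain 2 (factor_set G g s) (bar_boundary Q b) \<in> boundaries Q n"
      by (auto simp: boundaries_eq)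
    have "cap_chain 2 \<phi> c - y = cap_chain 2 (coboundary Q 1 \<psi>) c
        + (cap_chain 2 (factor_set G g s) (bar_boundary Q b) + (cap_chain 2 (factor_set G g s) x - y))"
      using cap[of c n] c' by (simp add: b(2) cap_chain_add)
    then show "cap_chain 2 \<phi> c - y \<in> boundaries Q n"
      by (simp only:) (intro boundaries_add 1 2 y[OF s])
  qed
  moreover have "?X \<noteq> {}" using mem_boundaries_coset by blast
  ultimately show ?thesis
    using euler_class_nonempty unfolding gysin_def cap_product_def by auto
qed

lemma chern_cycles:
  assumes "cyclic_words TYPE('a set list) G S C g"
  shows "chern_cycles G S C g Q proj (\<lambda>x. proj (retract x))"
proof (intro chern_cycles.intro assms chern_cycles_axioms.intro group_Q)
  fix x assume x: "x \<in> carrier G"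
  show "proj (retract x) \<in> carrier Q" using x coset_rep by (simp add: proj_in)
  show "proj (retract (g \<otimes> x)) = proj (retract x)"
    using x retract_mult[OF Z_closed(3) x] proj_pow[of "retract x" 1] coset_rep g_in by (simp add: int_pow_1)
  fix z assume z: "z \<in> carrier G" "z \<otimes> g = g \<otimes> z"
  then show "proj (retract (z \<otimes> x)) = proj z \<otimes>\<^bsub>Q\<^esub> proj (retract x)"
    using x retract_mult[of z x] coset_rep(2)[OF x] mult_Q[of z "retract x"] by (simp add: carrier_Z)
next
  fix z assume "z \<in> carrier G" "z \<otimes> g = g \<otimes> z"
  then show "proj z \<in> carrier Q" by (simp add: proj_in carrier_Z)
qed

text \<open>The minus sign is that of \<open>factor_set_eq\<close>, and it yields the shift by - 1
  in \<open>a_g\<close>. Invariance holds because z cancels between the two retracted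
  points.\<close>

lemma cap_with_coboundary:
  assumes "cyclic_words TYPE('a set list) G S C g" and s: "s \<in> centralizer_sections G g"
  shows "cap_with_coboundary G S C g Q proj (\<lambda>x. proj (retract x))
     (\<lambda>x y. - of_int (exponent s (inv (retract x) \<otimes> retract y))) (factor_set G g s)"
proof (intro cap_with_coboundary.intro chern_cycles assms(1) cap_with_coboundary_axioms.intro)
  have r: "retract x \<in> carrier Z" "retract x \<in> carrier G" if "x \<in> carrier G" for x
    using coset_rep(2)[OF that] Z_closed(5) by auto
  fix x y assume x: "x \<in> carrier G" and y: "y \<in> carrier G"
  show "- complex_of_int (exponent s (inv retract (z \<otimes> x) \<otimes> retract (z \<otimes> y)))
     = - of_int (exponent s (inv retract x \<otimes> retract y))" if z: "z \<in> carrier G" "z \<otimes> g = g \<otimes> z" for z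
  proof -
    have "z \<in> carrier Z" using z by (simp add: carrier_Z)
    then have "inv retract (z \<otimes> x) \<otimes> retract (z \<otimes> y) = inv retract x \<otimes> retract y"
      using r[OF x] r[OF y] x y z(1) by (simp add: retract_mult inv_mult_group m_assoc inv_cancel_left)
    then show ?thesis by simp
  qed
  show "- complex_of_int (exponent s (inv retract x \<otimes> retract (g \<otimes> y)))
     = - of_int (exponent s (inv retract x \<otimes> retract y)) - 1"
  proof -
    have "inv retract x \<otimes> (g \<otimes> retract y) = g \<otimes> (inv retract x \<otimes> retract y)"
      using r[OF x] r[OF y] g_in Z_closed(2)[OF r(1)[OF x]]
      by (simp add: m_assoc[symmetric] carrier_Z)
    then show ?thesis
      using exponent_g_mult[OF s, of "inv retract x \<otimes> retract y"] r[OF x] r[OF y] y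
      by (simp add: retract_mult Z_closed)
  qed
  fix z assume z: "z \<in> carrier G"
  have *: "inv retract x \<otimes> retract y \<otimes> (inv retract y \<otimes> retract z) = inv retract x \<otimes> retract z"
    using r[OF x] r[OF y] r[OF z] by (simp add: m_assoc inv_cancel_left)
  show "complex_of_int (factor_set G g s [inv\<^bsub>Q\<^esub> proj (retract x) \<otimes>\<^bsub>Q\<^esub> proj (retract y),
       inv\<^bsub>Q\<^esub> proj (retract y) \<otimes>\<^bsub>Q\<^esub> proj (retract z)])
     = - of_int (exponent s (inv retract x \<otimes> retract y)) + - of_int (exponent s (inv retract y \<otimes> retract z))
       - - of_int (exponent s (inv retract x \<otimes> retract z))"
    using r[OF x] r[OF y] r[OF z] by (simp add: inv_Q mult_Q Z_closed factor_set_eq[OF s] *)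
qed

text \<open>Both faces of a 1-simplex are the empty simplex, and they cancel.\<close>

lemma boundaries_0: "boundaries Q 0 = {0}"
proof -
  have "bar_boundary Q c = 0" if "c \<in> chains Q (Suc 0)" for c
  proof -
    have "bar_boundary Q c = lin (\<lambda>_. 0) c"
      unfolding bar_boundary_lin
      by (rule group.lin_ext[OF group_Q that])
         (auto simp: bar_simplices_def length_Suc_conv face_def simp flip: single_add)
    then show ?thesis by (simp add: lin_def)
  qed
  then show ?thesis using boundaries_zero[of Q 0] by (auto simp: boundaries_eq)
qed

primrec chern_factor :: "nat \<Rightarrow> complex" where
  "chern_factor 0 = 1"
| "chern_factor (Suc n) = - chern_factor n * of_nat (2 * n + 1) / of_nat ((2 * n + 3) * (n + 1))"

lemma carrier_homology:
  "carrier (homology Q n) = {boundaries Q n #>\<^bsub>cycle_group Q n\<^esub> c | c. c \<in> chains Q n \<and> bar_boundary Q c = 0}"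
  by (auto simp: homology_def FactGroup_def RCOSETS_def chains_def cycle_group_def chain_group_def)

lemma one_burghelea_T: "\<one>\<^bsub>burghelea_T G g k\<^esub> = (\<lambda>n. boundaries Q (k + 2 * n))"
  by (auto simp: burghelea_T_def Let_def homology_def FactGroup_def)

lemma carrier_burghelea_T:
  "carrier (burghelea_T G g k) = {x. (\<forall>n. x n \<in> carrier (homology Q (k + 2 * n)))
     \<and> (\<forall>n. gysin G g (k + 2 * n) (x (Suc n)) = x n)}"
  by (auto simp: burghelea_T_def Let_def)

text \<open>Needed to extend an element of one summand by neutral elements to the whole direct
  sum.\<close>

lemma one_in_burghelea_T: "\<one>\<^bsub>burghelea_T G g k\<^esub> \<in> carrier (burghelea_T G g k)"
proof -
  have "boundaries Q n \<in> carrier (homology Q n)" for n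
    using boundaries_coset_zero[of Q n n] unfolding carrier_homology
    by (auto intro!: exI[of _ 0])
  moreover have "gysin G g n (boundaries Q (Suc (Suc n))) = boundaries Q n" for n
    using gysin_coset[of 0 n 0 n n] by (simp add: boundaries_coset_zero cap_chain_def)
  ultimately show ?thesis by (simp add: carrier_burghelea_T one_burghelea_T)
qed

theorem trace_vanishes:
  assumes words: "cyclic_words TYPE('a set list) G S C g"
    and T: "carrier (burghelea_T G g 0) = {\<one>\<^bsub>burghelea_T G g 0\<^esub>}"
  shows "(\<Sum>x\<in>S. if \<exists>c\<in>carrier G. c \<otimes> x = g \<otimes> c then C [x] else 0) = 0"
proof -
  interpret chern_cycles G S C g Q proj "\<lambda>x. proj (retract x)" by (rule chern_cycles[OF words])
  define Y where "Y n = boundaries Q (2 * n) #>\<^bsub>cycle_group Q (2 * n)\<^esub> smul (chern_factor n) (cycle n)" for n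
  have "gysin G g (2 * n) (Y (Suc n)) = Y n" for n
  proof -
    have "cap_chain 2 (factor_set G g s) (smul (chern_factor (Suc n)) (cycle (Suc n))) - smul (chern_factor n) (cycle n)
        \<in> boundaries Q (2 * n)" if s: "s \<in> centralizer_sections G g" for s
    proof -
      interpret cap_with_coboundary G S C g Q proj "\<lambda>x. proj (retract x)"
        "\<lambda>x y. - of_int (exponent s (inv (retract x) \<otimes> retract y))" "factor_set G g s"
        by (rule cap_with_coboundary[OF words s])
      let ?u = "of_nat (2 * n + 1) :: complex" and ?v = "of_nat ((2 * n + 3) * (n + 1)) :: complex"
      have nz: "?u \<noteq> 0" "?v \<noteq> 0" by (simp_all only: of_nat_eq_0_iff) simp_all
      have "smul (- chern_factor n / ?v) (smul ?u (cap_chain 2 (factor_set G g s) (cycle (Suc n))) + smul ?v (cycle n))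
         \<in> boundaries Q (2 * n)"
        by (intro boundaries_smul cap_chain_cycle)
      moreover have "smul (- chern_factor n / ?v) (smul ?u (cap_chain 2 (factor_set G g s) (cycle (Suc n))) + smul ?v (cycle n))
         = cap_chain 2 (factor_set G g s) (smul (chern_factor (Suc n)) (cycle (Suc n))) - smul (chern_factor n) (cycle n)"
      proof -
        have "- chern_factor n / ?v * ?u = chern_factor (Suc n)" "- chern_factor n / ?v * ?v = - chern_factor n"
          using nz by (simp_all only: chern_factor.simps times_divide_eq_left nonzero_divide_eq_eq)
            (simp add: field_simps)
        then show ?thesis
          by (simp only: chains.scale_right_distrib chains.scale_scale cap_chain_smul chains.scale_minus_left add_uminus_conv_diff)
      qed
      ultimately show ?thesis by simp
    qed
    then show ?thesis
      unfolding Y_def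
      using gysin_coset[of "smul (chern_factor (Suc n)) (cycle (Suc n))" "2 * n"] cycle_chains[of "Suc n"]
      by (simp add: chains_smul bar_boundary_smul bar_boundary_cycle del: chern_factor.simps)
  qed
  moreover have "Y n \<in> carrier (homology Q (2 * n))" for n
    unfolding Y_def carrier_homology
    by (rule CollectI, rule exI, rule conjI[OF refl]) (simp add: chains_smul bar_boundary_smul bar_boundary_cycle cycle_chains)
  ultimately have "Y \<in> carrier (burghelea_T G g 0)" by (simp add: carrier_burghelea_T)
  with T have "Y 0 = boundaries Q 0" by (simp add: one_burghelea_T)
  moreover have "cycle 0 \<in> Y 0" using mem_boundaries_coset[of "cycle 0" Q 0 0] by (simp add: Y_def)
  ultimately have 0: "cycle 0 = 0" using boundaries_0 by simp
  \<comment> \<open>A one-letter word has a single vertex and hence the empty simplex, so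
    \<open>cycle 0\<close> is a number times [].\<close>
  have "term_at A [x] = Poly_Mapping.single [] (if \<exists>c\<in>carrier G. c \<otimes> x = g \<otimes> c then 1 else 0)" if "x \<in> S" for x
    using letters that by (auto simp: term_at_def conj_to_g_def A_def qbar_def bar_chain_def)
  then have "Poly_Mapping.lookup (cycle 0) [] = (\<Sum>x\<in>S. C [x] * (if \<exists>c\<in>carrier G. c \<otimes> x = g \<otimes> c then 1 else 0))"
    by (simp add: cycle_def ev_def sum_words_Suc lookup_sum)
  then show ?thesis by (simp add: 0 if_distrib cong: if_cong)
qed

end


section \<open>Conjugacy classes\<close>

context group begin

lemma conj_class_conj:
  assumes d: "d \<in> carrier G" and h: "h \<in> carrier G"
  shows "conj_class G (d \<otimes> h \<otimes> inv d) = conj_class G h"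
proof
  have sub: "conj_class G (d \<otimes> h \<otimes> inv d) \<subseteq> conj_class G h"
    if "d \<in> carrier G" "h \<in> carrier G" for d h
  proof
    fix y assume "y \<in> conj_class G (d \<otimes> h \<otimes> inv d)"
    then obtain x where x: "x \<in> carrier G" "y = x \<otimes> (d \<otimes> h \<otimes> inv d) \<otimes> inv x"
      by (auto simp: conj_class_def)
    then have "y = (x \<otimes> d) \<otimes> h \<otimes> inv (x \<otimes> d)"
      using that by (simp add: inv_mult_group m_assoc)
    then show "y \<in> conj_class G h"
      unfolding conj_class_def using x(1) that by blast
  qed
  show "conj_class G (d \<otimes> h \<otimes> inv d) \<subseteq> conj_class G h" by (rule sub[OF d h])
  have "inv d \<otimes> (d \<otimes> h \<otimes> inv d) \<otimes> inv (inv d) = h"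
    using d h by (simp add: m_assoc inv_cancel_left)
  then show "conj_class G h \<subseteq> conj_class G (d \<otimes> h \<otimes> inv d)"
    using sub[of "inv d" "d \<otimes> h \<otimes> inv d"] d h by simp
qed

lemma mem_conj_class: "h \<in> carrier G \<Longrightarrow> h \<in> conj_class G h"
  unfolding conj_class_def by (rule CollectI, rule exI[of _ \<one>]) simp

lemma conj_class_eq_iff:
  assumes x: "x \<in> carrier G" and g: "g \<in> carrier G"
  shows "conj_class G x = conj_class G g \<longleftrightarrow> (\<exists>c\<in>carrier G. c \<otimes> x = g \<otimes> c)"
proof
  assume "conj_class G x = conj_class G g"
  then have "x \<in> conj_class G g" using mem_conj_class[OF x] by simp
  then obtain d where d: "d \<in> carrier G" "x = d \<otimes> g \<otimes> inv d" by (auto simp: conj_class_def)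
  then have "inv d \<otimes> x = g \<otimes> inv d" using g by (simp add: m_assoc inv_cancel_left)
  then show "\<exists>c\<in>carrier G. c \<otimes> x = g \<otimes> c" using d by blast
next
  assume "\<exists>c\<in>carrier G. c \<otimes> x = g \<otimes> c"
  then obtain c where c: "c \<in> carrier G" "c \<otimes> x = g \<otimes> c" by blast
  have "c \<otimes> x \<otimes> inv c = g" unfolding c(2) using c(1) g by (simp add: m_assoc)
  then show "conj_class G x = conj_class G g" using conj_class_conj[OF c(1) x] by simp
qed

lemma conj_class_mult_commute:
  "x \<in> carrier G \<Longrightarrow> y \<in> carrier G \<Longrightarrow> conj_class G (x \<otimes> y) = conj_class G (y \<otimes> x)"
  using conj_class_eq_iff[of "x \<otimes> y" "y \<otimes> x"] by (auto simp: m_assoc)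

lemma ord_conj_eq_0:
  assumes d: "d \<in> carrier G" and h: "h \<in> carrier G" and "ord h = 0"
  shows "ord (d \<otimes> h \<otimes> inv d) = 0"
proof -
  let ?k = "d \<otimes> h \<otimes> inv d"
  have k: "?k \<in> carrier G" using d h by simp
  have pow: "?k [^] n = d \<otimes> h [^] n \<otimes> inv d" for n :: nat
    using d h by (induction n) (simp_all add: m_assoc inv_cancel_left)
  have "?k [^] n \<noteq> \<one>" if "n \<noteq> 0" for n :: nat
  proof
    assume "?k [^] n = \<one>"
    then have "inv d \<otimes> (d \<otimes> h [^] n \<otimes> inv d) \<otimes> d = inv d \<otimes> \<one> \<otimes> d" by (simp add: pow)
    then have "h [^] n = \<one>" using d h by (simp add: m_assoc inv_cancel_left)
    then show False using that assms(3) ord_eq_0[OF h] by blast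
  qed
  then show ?thesis using ord_eq_0[OF k] by blast
qed

lemma inf_conj_class_representative:
  assumes "D \<in> inf_conj_classes G"
  shows "infinite_order_element G (SOME g. g \<in> D)" "conj_class G (SOME g. g \<in> D) = D"
proof -
  obtain h where h: "h \<in> carrier G" "ord h = 0" "D = conj_class G h"
    using assms by (auto simp: inf_conj_classes_def)
  have "(SOME g. g \<in> D) \<in> conj_class G h"
    unfolding h(3) using mem_conj_class[OF h(1)] by (rule someI)
  then obtain d where d: "d \<in> carrier G" "(SOME g. g \<in> D) = d \<otimes> h \<otimes> inv d" by (auto simp: conj_class_def)
  show "conj_class G (SOME g. g \<in> D) = D"
    unfolding d(2) using conj_class_conj[OF d(1) h(1)] h(3) by simp
  show "infinite_order_element G (SOME g. g \<in> D)"
    unfolding d(2) using d(1) h ord_conj_eq_0 by unfold_locales auto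
qed

text \<open>Extension by neutral elements embeds each summand in the direct sum. The argument relies
  only on generators lying in the generated subgroup and so avoids the group structure of the
  inverse limits.\<close>

lemma burghelea_T_trivial:
  assumes "burghelea_conjecture G" and D: "D \<in> inf_conj_classes G"
  shows "carrier (burghelea_T G (SOME g. g \<in> D) 0) = {\<one>\<^bsub>burghelea_T G (SOME g. g \<in> D) 0\<^esub>}"
proof -
  let ?T = "\<lambda>D. burghelea_T G (SOME g. g \<in> D) 0" and ?I = "inf_conj_classes G"
  have triv: "carrier (sum_group ?I ?T) = {\<lambda>D\<in>?I. \<one>\<^bsub>?T D\<^esub>}"
    using assms(1) by (simp add: burghelea_conjecture_def trivial_group_def)
  have one: "\<one>\<^bsub>?T E\<^esub> \<in> carrier (?T E)" if "E \<in> ?I" for E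
    by (rule infinite_order_element.one_in_burghelea_T[OF inf_conj_class_representative(1)[OF that]])
  have "y = \<one>\<^bsub>?T D\<^esub>" if y: "y \<in> carrier (?T D)" for y
  proof -
    let ?x = "\<lambda>E\<in>?I. if E = D then y else \<one>\<^bsub>?T E\<^esub>"
    have "{E \<in> ?I. ?x E \<noteq> \<one>\<^bsub>?T E\<^esub>} \<subseteq> {D}" by auto
    then have "finite {E \<in> ?I. ?x E \<noteq> \<one>\<^bsub>?T E\<^esub>}" by (rule finite_subset) simp
    moreover have "?x \<in> (\<Pi>\<^sub>E E\<in>?I. carrier (?T E))" using y one by auto
    ultimately have "?x \<in> carrier (sum_group ?I ?T)"
      unfolding sum_group_def carrier_subgroup_generated by (intro generate.incl) auto
    then have "?x D = (\<lambda>D\<in>?I. \<one>\<^bsub>?T D\<^esub>) D" unfolding triv by simp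
    then show ?thesis using D by simp
  qed
  then show ?thesis using one[OF D] by blast
qed

end


section \<open>The group ring and traces\<close>

lemma lin_swap: "lin (\<lambda>x. lin (\<lambda>y. f x y) b) a = lin (\<lambda>y. lin (\<lambda>x. f x y) a) b"
  unfolding lin_def chains.scale_sum_right chains.scale_scale
  by (subst sum.swap) (simp add: mult.commute)

lemma class_sums_lin: "class_sums G a = lin (\<lambda>x. Poly_Mapping.single (conj_class G x) 1) a"
  by (simp add: class_sums_def lin_def)

lemma class_sums_add: "class_sums G (a + b) = class_sums G a + class_sums G b"
  and class_sums_diff: "class_sums G (a - b) = class_sums G a - class_sums G b"
  and class_sums_uminus: "class_sums G (- a) = - class_sums G a"
  and class_sums_sum: "class_sums G (\<Sum>i\<in>I. f i) = (\<Sum>i\<in>I. class_sums G (f i))"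
  and class_sums_zero [simp]: "class_sums G 0 = 0"
  by (simp_all add: class_sums_lin lin_add lin_diff lin_uminus lin_sum)

context group begin

abbreviation "CG \<equiv> group_ring G"

lemma carrier_CG: "a \<in> carrier CG \<longleftrightarrow> Poly_Mapping.keys a \<subseteq> carrier G"
  by (simp add: group_ring_def)

lemma zero_CG [simp]: "\<zero>\<^bsub>CG\<^esub> = 0" and add_CG [simp]: "a \<oplus>\<^bsub>CG\<^esub> b = a + b"
  by (simp_all add: group_ring_def)

lemma mult_CG: "a \<otimes>\<^bsub>CG\<^esub> b = lin (\<lambda>x. lin (\<lambda>y. Poly_Mapping.single (x \<otimes> y) 1) b) a"
  by (simp add: group_ring_def lin_def chains.scale_sum_right)

lemma lin_mult_CG: "lin f (a \<otimes>\<^bsub>CG\<^esub> b) = lin (\<lambda>x. lin (\<lambda>y. f (x \<otimes> y)) b) a"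
  by (simp add: mult_CG lin_lin)

lemma mult_CG_closed [simp]:
  assumes "a \<in> carrier CG" "b \<in> carrier CG"
  shows "a \<otimes>\<^bsub>CG\<^esub> b \<in> carrier CG"
proof -
  have "Poly_Mapping.keys (lin (\<lambda>y. Poly_Mapping.single (x \<otimes> y) 1) b) \<subseteq> carrier G" if "x \<in> carrier G" for x
    by (rule subset_trans[OF keys_lin]) (use that assms(2) in \<open>auto simp: carrier_CG\<close>)
  then show ?thesis
    unfolding carrier_CG mult_CG
    by (intro subset_trans[OF keys_lin]) (use assms(1) in \<open>auto simp: carrier_CG\<close>)
qed

lemma mult_CG_zero [simp]: "0 \<otimes>\<^bsub>CG\<^esub> b = 0" "a \<otimes>\<^bsub>CG\<^esub> 0 = 0"
  by (simp_all add: mult_CG) (simp add: lin_def)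

lemma add_CG_closed: "a \<in> carrier CG \<Longrightarrow> b \<in> carrier CG \<Longrightarrow> a + b \<in> carrier CG"
  using keys_add[of a b] by (auto simp: carrier_CG)

lemma zero_CG_closed [simp]: "0 \<in> carrier CG"
  by (simp add: carrier_CG)

lemma uminus_CG_closed: "a \<in> carrier CG \<Longrightarrow> - a \<in> carrier CG"
  by (simp add: carrier_CG)

lemma abelian_group_CG: "abelian_group CG"
proof (rule abelian_groupI)
  show "\<exists>y\<in>carrier CG. y \<oplus>\<^bsub>CG\<^esub> x = \<zero>\<^bsub>CG\<^esub>" if "x \<in> carrier CG" for x
    using uminus_CG_closed[OF that] by (intro bexI[of _ "- x"]) auto
qed (auto simp: add_CG_closed algebra_simps)

lemma finsum_CG:
  assumes "\<And>i. i \<in> I \<Longrightarrow> f i \<in> carrier CG"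
  shows "finsum CG f I = sum f I"
proof -
  interpret CG: abelian_group CG by (rule abelian_group_CG)
  show ?thesis
    using assms by (induction I rule: infinite_finite_induct) (auto simp: CG.finsum_insert Pi_def CG.finsum_infinite)
qed

lemma minus_CG:
  assumes "a \<in> carrier CG" "b \<in> carrier CG"
  shows "a \<ominus>\<^bsub>CG\<^esub> b = a - b"
proof -
  interpret CG: abelian_group CG by (rule abelian_group_CG)
  have "\<ominus>\<^bsub>CG\<^esub> b = - b"
    using assms uminus_CG_closed by (intro CG.minus_equality) auto
  then show ?thesis by (simp add: a_minus_def)
qed

lemma matrix_mult_CG:
  assumes "A \<in> matrices CG m n" "B \<in> matrices CG n k"
  shows "matrix_mult CG n A B i j = (\<Sum>l<n. A i l \<otimes>\<^bsub>CG\<^esub> B l j)"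
  using assms unfolding matrix_mult_def by (intro finsum_CG) (auto simp: matrices_def)

lemma matrix_trace_CG:
  assumes "A \<in> matrices CG n n"
  shows "matrix_trace CG (n, A) = (\<Sum>i<n. A i i)"
  using assms by (auto simp: matrix_trace_def matrices_def intro!: finsum_CG)

text \<open>Products x y and y x of group elements are conjugate, so \<open>class_sums\<close> is a
  trace on the group ring.\<close>

lemma class_sums_mult_commute:
  assumes "a \<in> carrier CG" "b \<in> carrier CG"
  shows "class_sums G (a \<otimes>\<^bsub>CG\<^esub> b) = class_sums G (b \<otimes>\<^bsub>CG\<^esub> a)"
proof -
  have "class_sums G (a \<otimes>\<^bsub>CG\<^esub> b)
      = lin (\<lambda>x. lin (\<lambda>y. Poly_Mapping.single (conj_class G (x \<otimes> y)) 1) b) a"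
    by (simp add: class_sums_lin lin_mult_CG)
  also have "\<dots> = lin (\<lambda>x. lin (\<lambda>y. Poly_Mapping.single (conj_class G (y \<otimes> x)) 1) b) a"
    using assms by (intro lin_cong) (auto simp: carrier_CG conj_class_mult_commute subset_iff)
  also have "\<dots> = class_sums G (b \<otimes>\<^bsub>CG\<^esub> a)"
    by (subst lin_swap) (simp add: class_sums_lin lin_mult_CG)
  finally show ?thesis .
qed

lemma matrix_mult_closed:
  assumes "A \<in> matrices CG m n" "B \<in> matrices CG n k"
  shows "matrix_mult CG n A B \<in> matrices CG m k"
proof -
  interpret CG: abelian_group CG by (rule abelian_group_CG)
  have c: "A i j \<in> carrier CG" "B i j \<in> carrier CG" for i j using assms by (auto simp: matrices_def)
  have "matrix_mult CG n A B i j \<in> carrier CG" for i j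
    unfolding matrix_mult_def by (rule CG.finsum_closed) (simp add: c)
  moreover have "matrix_mult CG n A B i j = \<zero>\<^bsub>CG\<^esub>" if "\<not> (i < m \<and> j < k)" for i j
    unfolding matrix_mult_CG[OF assms] using that assms
    by (auto simp: matrices_def intro!: sum.neutral)
  ultimately show ?thesis by (auto simp: matrices_def)
qed

section \<open>The trace on idempotents and its compatibility with the Grothendieck group\<close>

definition trace_class :: "nat \<times> (nat \<Rightarrow> nat \<Rightarrow> ('a \<Rightarrow>\<^sub>0 complex)) \<Rightarrow> ('a set \<Rightarrow>\<^sub>0 complex)" where
  "trace_class p = class_sums G (matrix_trace CG p)"

lemma trace_class_mult_commute:
  assumes A: "A \<in> matrices CG m n" and B: "B \<in> matrices CG n m"
  shows "trace_class (m, matrix_mult CG n A B) = trace_class (n, matrix_mult CG m B A)"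
proof -
  have "trace_class (m, matrix_mult CG n A B) = (\<Sum>i<m. \<Sum>k<n. class_sums G (A i k \<otimes>\<^bsub>CG\<^esub> B k i))"
    unfolding trace_class_def matrix_trace_CG[OF matrix_mult_closed[OF A B]]
    by (simp add: class_sums_sum matrix_mult_CG[OF A B])
  also have "\<dots> = (\<Sum>i<m. \<Sum>k<n. class_sums G (B k i \<otimes>\<^bsub>CG\<^esub> A i k))"
    using A B by (intro sum.cong refl class_sums_mult_commute) (auto simp: matrices_def)
  also have "\<dots> = (\<Sum>k<n. \<Sum>i<m. class_sums G (B k i \<otimes>\<^bsub>CG\<^esub> A i k))" by (rule sum.swap)
  also have "\<dots> = trace_class (n, matrix_mult CG m B A)"
    unfolding trace_class_def matrix_trace_CG[OF matrix_mult_closed[OF B A]]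
    by (simp add: class_sums_sum matrix_mult_CG[OF B A])
  finally show ?thesis .
qed

lemma trace_class_idem_equiv: "idem_equiv CG p q \<Longrightarrow> trace_class p = trace_class q"
  by (auto simp: idem_equiv_def trace_class_mult_commute)

lemma sum_lessThan_add: "(\<Sum>i<m + n. f i) = (\<Sum>i<m. f i) + (\<Sum>i<n. f (m + i))"
  for f :: "nat \<Rightarrow> 'c :: comm_monoid_add"
  by (induction n) (auto simp: algebra_simps)

lemma idempotents_iff: "(n, P) \<in> idempotents CG \<longleftrightarrow> P \<in> matrices CG n n \<and> matrix_mult CG n P P = P"
  by (simp add: idempotents_def)

lemma block_sum_idempotents:
  assumes "p \<in> idempotents CG" "q \<in> idempotents CG"
  shows "block_sum CG p q \<in> idempotents CG"
proof -
  obtain m P where p: "p = (m, P)" "P \<in> matrices CG m m" "matrix_mult CG m P P = P"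
    using assms(1) by (cases p) (auto simp: idempotents_iff)
  obtain n Q where q: "q = (n, Q)" "Q \<in> matrices CG n n" "matrix_mult CG n Q Q = Q"
    using assms(2) by (cases q) (auto simp: idempotents_iff)
  define B where "B i j = (if i < m \<and> j < m then P i j else if m \<le> i \<and> m \<le> j then Q (i - m) (j - m) else 0)" for i j
  have eq: "block_sum CG p q = (m + n, B)" by (auto simp: block_sum_def p(1) q(1) B_def fun_eq_iff)
  have B: "B \<in> matrices CG (m + n) (m + n)"
    using p(2) q(2) by (auto simp: matrices_def B_def less_diff_conv2)
  have Pm: "(\<Sum>k<m. P i k \<otimes>\<^bsub>CG\<^esub> P k j) = P i j" for i j
    using matrix_mult_CG[OF p(2,2), of i j] by (simp add: p(3))
  have Qm: "(\<Sum>k<n. Q i k \<otimes>\<^bsub>CG\<^esub> Q k j) = Q i j" for i j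
    using matrix_mult_CG[OF q(2,2), of i j] by (simp add: q(3))
  have "matrix_mult CG (m + n) B B i j = B i j" for i j
    unfolding matrix_mult_CG[OF B B] sum_lessThan_add
    by (cases "i < m"; cases "j < m") (simp_all add: B_def Pm Qm)
  then show ?thesis unfolding eq idempotents_iff using B by blast
qed

lemma trace_class_block_sum:
  assumes "p \<in> idempotents CG" "q \<in> idempotents CG"
  shows "trace_class (block_sum CG p q) = trace_class p + trace_class q"
proof -
  obtain m P where p: "p = (m, P)" "P \<in> matrices CG m m" using assms(1) by (cases p) (auto simp: idempotents_iff)
  obtain n Q where q: "q = (n, Q)" "Q \<in> matrices CG n n" using assms(2) by (cases q) (auto simp: idempotents_iff)
  obtain B where B: "block_sum CG p q = (m + n, B)" by (auto simp: block_sum_def p q)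
  have BM: "B \<in> matrices CG (m + n) (m + n)"
    using block_sum_idempotents[OF assms] by (simp add: B idempotents_iff)
  have "B i i = P i i" if "i < m" for i using B that by (auto simp: block_sum_def p q)
  moreover have "B (m + i) (m + i) = Q i i" for i using B by (auto simp: block_sum_def p q)
  ultimately show ?thesis
    unfolding B unfolding p(1) q(1) trace_class_def matrix_trace_CG[OF BM] matrix_trace_CG[OF p(2)] matrix_trace_CG[OF q(2)]
      sum_lessThan_add class_sums_add[symmetric]
    by simp
qed

text \<open>Guarantees that a class in K_0 contains the pair defining it, so that the union in
  \<open>hattori_stallings\<close> is not empty. The 0 by 0 matrix serves as the stabilizing
  summand.\<close>

lemma K0_rel_refl:
  assumes "p \<in> idempotents CG" "q \<in> idempotents CG"
  shows "((p, q), (p, q)) \<in> K0_rel CG"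
proof -
  let ?t = "(0, \<lambda>_ _. 0) :: nat \<times> (nat \<Rightarrow> nat \<Rightarrow> ('a \<Rightarrow>\<^sub>0 complex))"
  have t: "?t \<in> idempotents CG"
    by (auto simp: idempotents_def matrices_def matrix_mult_def finsum_CG)
  have idem_refl: "idem_equiv CG x x" if "x \<in> idempotents CG" for x
  proof -
    obtain n P where x: "x = (n, P)" by (cases x)
    with that have "P \<in> matrices CG n n" "P = matrix_mult CG n P P" by (simp_all add: idempotents_iff)
    then show ?thesis unfolding x idem_equiv_def by auto
  qed
  have "idem_equiv CG (block_sum CG (block_sum CG p q) ?t) (block_sum CG (block_sum CG p q) ?t)"
    by (intro idem_refl block_sum_idempotents assms t)
  then have "\<exists>t\<in>idempotents CG. idem_equiv CG (block_sum CG (block_sum CG p q) t) (block_sum CG (block_sum CG p q) t)"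
    using t by (rule bexI)
  then show ?thesis
    unfolding K0_rel_def
    by (intro CollectI exI conjI) (rule refl, use assms in simp_all)
qed

lemma K0_rel_trace_class:
  assumes "((p, q), (p', q')) \<in> K0_rel CG"
  shows "trace_class p - trace_class q = trace_class p' - trace_class q'"
proof -
  from assms obtain t where id: "{p, q, p', q', t} \<subseteq> idempotents CG"
    and equiv: "idem_equiv CG (block_sum CG (block_sum CG p q') t) (block_sum CG (block_sum CG p' q) t)"
    by (auto simp: K0_rel_def)
  have "trace_class p + trace_class q' + trace_class t = trace_class p' + trace_class q + trace_class t"
    using trace_class_idem_equiv[OF equiv] id by (simp add: trace_class_block_sum block_sum_idempotents)
  then show ?thesis by (simp add: algebra_simps)
qed

lemma class_sums_commutator_subgroup:
  assumes "h \<in> commutator_subgroup CG"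
  shows "class_sums G h = 0 \<and> h \<in> carrier CG"
  using assms unfolding commutator_subgroup_def
proof (induction rule: generate.induct)
  interpret CG: abelian_group CG by (rule abelian_group_CG)
  let ?H = "{a \<otimes>\<^bsub>CG\<^esub> b \<ominus>\<^bsub>CG\<^esub> b \<otimes>\<^bsub>CG\<^esub> a | a b. a \<in> carrier CG \<and> b \<in> carrier CG}"
  have *: "class_sums G h = 0 \<and> h \<in> carrier CG" if "h \<in> ?H" for h
    using that class_sums_mult_commute CG.minus_closed
    by (auto simp: minus_CG class_sums_diff)
  case (incl h) then show ?case by (rule *)
next
  interpret CG: abelian_group CG by (rule abelian_group_CG)
  case (inv h)
  then obtain a b where h: "h = a \<otimes>\<^bsub>CG\<^esub> b \<ominus>\<^bsub>CG\<^esub> b \<otimes>\<^bsub>CG\<^esub> a" "a \<in> carrier CG" "b \<in> carrier CG" by blast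
  then have hc: "h \<in> carrier CG" by simp
  have "inv\<^bsub>add_monoid CG\<^esub> h = \<ominus>\<^bsub>CG\<^esub> h" by (simp add: a_inv_def)
  also have "\<dots> = - h" using hc uminus_CG_closed by (intro CG.minus_equality) auto
  finally show ?case
    using h hc class_sums_mult_commute[OF h(2,3)] uminus_CG_closed[OF hc]
    by (simp add: minus_CG class_sums_diff class_sums_uminus)
next
  case (eng h1 h2)
  then show ?case by (simp add: class_sums_add add_CG_closed)
qed (simp add: carrier_CG)

end


section \<open>Words with coefficients in an idempotent matrix\<close>

text \<open>The (i, j) entry of the product P(x_1) ... P(x_m) for a word x_1 ... x_m, where P(x) is
  the complex n by n matrix of the coefficients of x in the entries of P.\<close>

primrec path :: "nat \<Rightarrow> (nat \<Rightarrow> nat \<Rightarrow> ('a \<Rightarrow>\<^sub>0 complex)) \<Rightarrow> nat \<Rightarrow> 'a list \<Rightarrow> nat \<Rightarrow> complex" where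
  "path n P i [] j = (if i = j then 1 else 0)"
| "path n P i (x # w) j = (\<Sum>k<n. Poly_Mapping.lookup (P i k) x * path n P k w j)"

definition cyclic_coeff :: "nat \<Rightarrow> (nat \<Rightarrow> nat \<Rightarrow> ('a \<Rightarrow>\<^sub>0 complex)) \<Rightarrow> 'a list \<Rightarrow> complex" where
  "cyclic_coeff n P w = (\<Sum>i<n. path n P i w i)"

lemma path_append: "i < n \<Longrightarrow> path n P i (u @ v) j = (\<Sum>k<n. path n P i u k * path n P k v j)"
proof (induction u arbitrary: i)
  case Nil
  have "(\<Sum>k<n. path n P i [] k * path n P k v j) = (\<Sum>k<n. if k = i then path n P k v j else 0)"
    by (intro sum.cong) auto
  then show ?case using Nil by simp
next
  case (Cons x u)
  have "path n P i ((x # u) @ v) j = (\<Sum>l<n. \<Sum>k<n. Poly_Mapping.lookup (P i l) x * path n P l u k * path n P k v j)"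
    using Cons.IH by (simp add: sum_distrib_left mult.assoc)
  also have "\<dots> = (\<Sum>k<n. \<Sum>l<n. Poly_Mapping.lookup (P i l) x * path n P l u k * path n P k v j)"
    by (rule sum.swap)
  finally show ?case by (simp add: sum_distrib_right)
qed

lemma path_singleton: "j < n \<Longrightarrow> path n P i [x] j = Poly_Mapping.lookup (P i j) x"
proof -
  assume "j < n"
  have "path n P i [x] j = (\<Sum>k<n. if k = j then Poly_Mapping.lookup (P i k) x else 0)"
    unfolding path.simps by (intro sum.cong) auto
  then show ?thesis using \<open>j < n\<close> by simp
qed

lemma cyclic_coeff_rotate: "cyclic_coeff n P (w @ [x]) = cyclic_coeff n P (x # w)"
proof -
  have "cyclic_coeff n P (w @ [x]) = (\<Sum>i<n. \<Sum>k<n. path n P i w k * path n P k [x] i)"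
    unfolding cyclic_coeff_def by (intro sum.cong refl path_append) auto
  also have "\<dots> = (\<Sum>k<n. \<Sum>i<n. path n P k [x] i * path n P i w k)"
    by (subst sum.swap) (simp add: mult.commute)
  also have "\<dots> = (\<Sum>k<n. path n P k ([x] @ w) k)"
    by (intro sum.cong refl path_append[symmetric]) auto
  finally show ?thesis by (simp add: cyclic_coeff_def)
qed

context group begin

text \<open>P P = P compared coefficient by coefficient. As S need not be closed under products, the
  identity is tested against an arbitrary \<Theta>: each product a b outside S has total coefficient
  0.\<close>

lemma idempotent_convolution:
  fixes \<Theta> :: "'a \<Rightarrow> ('c \<Rightarrow>\<^sub>0 complex)"
  assumes P: "P \<in> matrices CG n n" "matrix_mult CG n P P = P"
    and S: "finite S" "\<And>i j. i < n \<Longrightarrow> j < n \<Longrightarrow> Poly_Mapping.keys (P i j) \<subseteq> S"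
    and ij: "i < n" "j < n"
  shows "(\<Sum>a\<in>S. \<Sum>b\<in>S. smul (\<Sum>k<n. Poly_Mapping.lookup (P i k) a * Poly_Mapping.lookup (P k j) b) (\<Theta> (a \<otimes> b)))
     = (\<Sum>x\<in>S. smul (Poly_Mapping.lookup (P i j) x) (\<Theta> x))"
proof -
  have "(\<Sum>x\<in>S. smul (Poly_Mapping.lookup (P i j) x) (\<Theta> x)) = lin \<Theta> (P i j)"
    using S ij by (simp add: lin_superset[of S])
  also have "\<dots> = lin \<Theta> (\<Sum>k<n. P i k \<otimes>\<^bsub>CG\<^esub> P k j)"
    using matrix_mult_CG[OF P(1,1), of i j] by (simp add: P(2))
  also have "\<dots> = (\<Sum>k<n. lin (\<lambda>x. lin (\<lambda>y. \<Theta> (x \<otimes> y)) (P k j)) (P i k))"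
    by (simp add: lin_sum lin_mult_CG)
  also have "\<dots> = (\<Sum>k<n. \<Sum>a\<in>S. \<Sum>b\<in>S. smul (Poly_Mapping.lookup (P i k) a * Poly_Mapping.lookup (P k j) b) (\<Theta> (a \<otimes> b)))"
    using S ij by (intro sum.cong refl) (simp add: lin_superset[of S] chains.scale_sum_right)
  also have "\<dots> = (\<Sum>a\<in>S. \<Sum>k<n. \<Sum>b\<in>S. smul (Poly_Mapping.lookup (P i k) a * Poly_Mapping.lookup (P k j) b) (\<Theta> (a \<otimes> b)))"
    by (rule sum.swap)
  also have "\<dots> = (\<Sum>a\<in>S. \<Sum>b\<in>S. \<Sum>k<n. smul (Poly_Mapping.lookup (P i k) a * Poly_Mapping.lookup (P k j) b) (\<Theta> (a \<otimes> b)))"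
    by (intro sum.cong refl sum.swap)
  finally show ?thesis by (simp add: chains.scale_sum_left)
qed

text \<open>The closed path is cut before and after the letters to be contracted. The part outside
  is h, indexed by the base point i and the cut points j and l; the part inside is
  \<open>idempotent_convolution\<close>.\<close>

lemma cyclic_words_idempotent:
  assumes P: "P \<in> matrices CG n n" "matrix_mult CG n P P = P"
    and S: "finite S" "S \<subseteq> carrier G" "\<And>i j. i < n \<Longrightarrow> j < n \<Longrightarrow> Poly_Mapping.keys (P i j) \<subseteq> S"
    and g: "g \<in> carrier G"
  shows "cyclic_words TYPE('c) G S (cyclic_coeff n P) g"
proof unfold_locales
  fix u v and \<Theta> :: "'a \<Rightarrow> ('c \<Rightarrow>\<^sub>0 complex)"
  let ?T = "{..<n} \<times> {..<n} \<times> {..<n}"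
  define h where "h = (\<lambda>(i, j, l). path n P i u j * path n P l v i)"
  have triple: "(\<Sum>t\<in>?T. F t) = (\<Sum>i<n. \<Sum>j<n. \<Sum>l<n. F (i, j, l))" for F :: "nat \<times> nat \<times> nat \<Rightarrow> complex"
    by (simp add: sum.cartesian_product)
  have C2: "cyclic_coeff n P (u @ a # b # v)
      = (\<Sum>(i, j, l)\<in>?T. h (i, j, l) * (\<Sum>k<n. Poly_Mapping.lookup (P j k) a * Poly_Mapping.lookup (P k l) b))" for a b
  proof -
    have "path n P j (a # b # v) i
        = (\<Sum>l<n. (\<Sum>k<n. Poly_Mapping.lookup (P j k) a * Poly_Mapping.lookup (P k l) b) * path n P l v i)" for i j
      unfolding path.simps sum_distrib_left sum_distrib_right
      by (subst sum.swap) (simp add: mult.assoc)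
    then show ?thesis
      unfolding triple by (simp add: cyclic_coeff_def path_append sum_distrib_left h_def mult_ac del: path.simps)
  qed
  have C1: "cyclic_coeff n P (u @ x # v) = (\<Sum>(i, j, l)\<in>?T. h (i, j, l) * Poly_Mapping.lookup (P j l) x)" for x
    unfolding triple by (simp add: cyclic_coeff_def path_append sum_distrib_left h_def mult_ac)
  have "(\<Sum>a\<in>S. \<Sum>b\<in>S. smul (cyclic_coeff n P (u @ a # b # v)) (\<Theta> (a \<otimes> b)))
     = (\<Sum>a\<in>S. \<Sum>b\<in>S. \<Sum>(i, j, l)\<in>?T. smul (h (i, j, l)) (smul (\<Sum>k<n. Poly_Mapping.lookup (P j k) a * Poly_Mapping.lookup (P k l) b) (\<Theta> (a \<otimes> b))))"
    unfolding C2 chains.scale_scale split_def by (intro sum.cong refl) (rule chains.scale_sum_left)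
  also have "\<dots> = (\<Sum>a\<in>S. \<Sum>(i, j, l)\<in>?T. \<Sum>b\<in>S. smul (h (i, j, l)) (smul (\<Sum>k<n. Poly_Mapping.lookup (P j k) a * Poly_Mapping.lookup (P k l) b) (\<Theta> (a \<otimes> b))))"
    unfolding split_def by (intro sum.cong refl sum.swap)
  also have "\<dots> = (\<Sum>(i, j, l)\<in>?T. \<Sum>a\<in>S. \<Sum>b\<in>S. smul (h (i, j, l)) (smul (\<Sum>k<n. Poly_Mapping.lookup (P j k) a * Poly_Mapping.lookup (P k l) b) (\<Theta> (a \<otimes> b))))"
    unfolding split_def by (rule sum.swap)
  also have "\<dots> = (\<Sum>(i, j, l)\<in>?T. smul (h (i, j, l)) (\<Sum>x\<in>S. smul (Poly_Mapping.lookup (P j l) x) (\<Theta> x)))"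
  proof (rule sum.cong[OF refl])
    fix t assume "t \<in> ?T"
    then obtain i j l where t: "t = (i, j, l)" "i < n" "j < n" "l < n" by auto
    show "(case t of (i, j, l) \<Rightarrow> \<Sum>a\<in>S. \<Sum>b\<in>S. smul (h (i, j, l)) (smul (\<Sum>k<n. Poly_Mapping.lookup (P j k) a * Poly_Mapping.lookup (P k l) b) (\<Theta> (a \<otimes> b))))
      = (case t of (i, j, l) \<Rightarrow> smul (h (i, j, l)) (\<Sum>x\<in>S. smul (Poly_Mapping.lookup (P j l) x) (\<Theta> x)))"
      by (simp only: t(1) prod.case chains.scale_sum_right[symmetric] idempotent_convolution[OF P S(1,3) t(3,4)])
  qed
  also have "\<dots> = (\<Sum>(i, j, l)\<in>?T. \<Sum>x\<in>S. smul (h (i, j, l) * Poly_Mapping.lookup (P j l) x) (\<Theta> x))"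
    by (simp add: chains.scale_sum_right)
  also have "\<dots> = (\<Sum>x\<in>S. \<Sum>(i, j, l)\<in>?T. smul (h (i, j, l) * Poly_Mapping.lookup (P j l) x) (\<Theta> x))"
    unfolding split_def by (rule sum.swap)
  also have "\<dots> = (\<Sum>x\<in>S. smul (cyclic_coeff n P (u @ x # v)) (\<Theta> x))"
    by (simp add: C1 chains.scale_sum_left split_def)
  finally show "(\<Sum>a\<in>S. \<Sum>b\<in>S. smul (cyclic_coeff n P (u @ a # b # v)) (\<Theta> (a \<otimes> b)))
     = (\<Sum>x\<in>S. smul (cyclic_coeff n P (u @ x # v)) (\<Theta> x))" .
qed (use S g cyclic_coeff_rotate in auto)


section \<open>The strong Bass conjecture\<close>

text \<open>The condition c x = g c is the one under which a one-letter word contributes to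
  \<open>cycle 0\<close>, which links the trace to \<open>trace_vanishes\<close>.\<close>

lemma lookup_trace_class:
  assumes P: "P \<in> matrices CG n n"
    and S: "finite S" "S \<subseteq> carrier G" "\<And>i j. i < n \<Longrightarrow> j < n \<Longrightarrow> Poly_Mapping.keys (P i j) \<subseteq> S"
    and g: "g \<in> carrier G"
  shows "Poly_Mapping.lookup (trace_class (n, P)) (conj_class G g)
    = (\<Sum>x\<in>S. if \<exists>c\<in>carrier G. c \<otimes> x = g \<otimes> c then cyclic_coeff n P [x] else 0)"
proof -
  have "Poly_Mapping.lookup (trace_class (n, P)) (conj_class G g)
     = (\<Sum>i<n. \<Sum>x\<in>S. if conj_class G x = conj_class G g then Poly_Mapping.lookup (P i i) x else 0)"
    unfolding trace_class_def matrix_trace_CG[OF P] class_sums_sum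
    unfolding class_sums_lin using S by (simp add: lin_superset[of S] lookup_sum lookup_single when_def if_distrib cong: if_cong)
  also have "\<dots> = (\<Sum>x\<in>S. \<Sum>i<n. if conj_class G x = conj_class G g then Poly_Mapping.lookup (P i i) x else 0)"
    by (rule sum.swap)
  also have "\<dots> = (\<Sum>x\<in>S. if \<exists>c\<in>carrier G. c \<otimes> x = g \<otimes> c then cyclic_coeff n P [x] else 0)"
  proof (rule sum.cong[OF refl])
    fix x assume "x \<in> S"
    then have "conj_class G x = conj_class G g \<longleftrightarrow> (\<exists>c\<in>carrier G. c \<otimes> x = g \<otimes> c)"
      using S(2) g by (intro conj_class_eq_iff) auto
    moreover have "cyclic_coeff n P [x] = (\<Sum>i<n. Poly_Mapping.lookup (P i i) x)"
      unfolding cyclic_coeff_def by (intro sum.cong refl path_singleton) auto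
    ultimately show "(\<Sum>i<n. if conj_class G x = conj_class G g then Poly_Mapping.lookup (P i i) x else 0)
        = (if \<exists>c\<in>carrier G. c \<otimes> x = g \<otimes> c then cyclic_coeff n P [x] else 0)" by simp
  qed
  finally show ?thesis .
qed

lemma keys_trace_class:
  assumes "P \<in> matrices CG n n"
  shows "Poly_Mapping.keys (trace_class (n, P)) \<subseteq> conj_classes G"
proof -
  interpret CG: abelian_group CG by (rule abelian_group_CG)
  have "matrix_trace CG (n, P) \<in> carrier CG"
    using assms unfolding matrix_trace_def by (auto simp: matrices_def intro!: CG.finsum_closed)
  then show ?thesis
    unfolding trace_class_def class_sums_lin conj_classes_def
    by (intro subset_trans[OF keys_lin]) (auto simp: carrier_CG)
qed

lemma trace_class_fin_summand:
  assumes "burghelea_conjecture G" and p: "p \<in> idempotents CG"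
  shows "trace_class p \<in> fin_summand G"
proof -
  obtain n P where np: "p = (n, P)" and P: "P \<in> matrices CG n n" "matrix_mult CG n P P = P"
    using p by (cases p) (auto simp: idempotents_iff)
  \<comment> \<open>The alphabet consists of all group elements that occur in entries of P, a finite
    set.\<close>
  let ?S = "\<Union>(i, j)\<in>{..<n} \<times> {..<n}. Poly_Mapping.keys (P i j)"
  have S: "finite ?S" "?S \<subseteq> carrier G" "\<And>i j. i < n \<Longrightarrow> j < n \<Longrightarrow> Poly_Mapping.keys (P i j) \<subseteq> ?S"
    using P(1) by (fastforce simp: matrices_def carrier_CG)+
  have "D \<in> fin_conj_classes G" if D: "D \<in> Poly_Mapping.keys (trace_class p)" for D
  proof (rule ccontr)
    assume "D \<notin> fin_conj_classes G"
    moreover have "D \<in> conj_classes G" using D keys_trace_class[OF P(1)] np by auto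
    ultimately have Dinf: "D \<in> inf_conj_classes G"
      by (auto simp: conj_classes_def fin_conj_classes_def inf_conj_classes_def)
    let ?g = "SOME g. g \<in> D"
    note rep = inf_conj_class_representative[OF Dinf]
    interpret infinite_order_element G ?g by (rule rep(1))
    have "cyclic_words TYPE('a set list) G ?S (cyclic_coeff n P) ?g"
      by (intro cyclic_words_idempotent P S g_in)
    then have "(\<Sum>x\<in>?S. if \<exists>c\<in>carrier G. c \<otimes> x = ?g \<otimes> c then cyclic_coeff n P [x] else 0) = 0"
      by (rule trace_vanishes[OF _ burghelea_T_trivial[OF assms(1) Dinf]])
    moreover have "Poly_Mapping.lookup (trace_class (n, P)) (conj_class G ?g)
        = (\<Sum>x\<in>?S. if \<exists>c\<in>carrier G. c \<otimes> x = ?g \<otimes> c then cyclic_coeff n P [x] else 0)"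
      by (intro lookup_trace_class P S g_in)
    ultimately have "Poly_Mapping.lookup (trace_class (n, P)) (conj_class G ?g) = 0" by simp
    then show False using D by (simp add: np rep(2) in_keys_iff)
  qed
  then show ?thesis by (auto simp: fin_summand_def)
qed

text \<open>\<open>hattori_stallings\<close> is a union of cosets over all pairs representing U, but
  \<open>class_sums\<close> kills commutators and respects \<open>K0_rel\<close>. Its image is
  therefore a singleton, to which \<open>the_elem\<close> applies.\<close>

lemma HH0_decomposition_hattori_stallings:
  assumes "U \<in> carrier (K0 CG)"
  obtains p q where "p \<in> idempotents CG" "q \<in> idempotents CG"
    "HH0_decomposition G (hattori_stallings CG U) = trace_class p - trace_class q"
proof -
  interpret CG: abelian_group CG by (rule abelian_group_CG)
  obtain p q where p: "p \<in> idempotents CG" and q: "q \<in> idempotents CG" and U: "U = K0_rel CG `` {(p, q)}"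
    using assms by (auto simp: K0_def elim!: quotientE)
  have tr: "matrix_trace CG r \<in> carrier CG" if "r \<in> idempotents CG" for r
    using that by (auto simp: idempotents_def matrix_trace_def matrices_def intro!: CG.finsum_closed)
  have mem: "(p, q) \<in> U" using K0_rel_refl[OF p q] by (simp add: U)
  have "class_sums G ` hattori_stallings CG U = {trace_class p - trace_class q}"
  proof
    show "class_sums G ` hattori_stallings CG U \<subseteq> {trace_class p - trace_class q}"
    proof clarify
      fix x assume "x \<in> hattori_stallings CG U"
      then obtain p' q' h where pq: "((p, q), (p', q')) \<in> K0_rel CG" and h: "h \<in> commutator_subgroup CG"
        and x: "x = h + (matrix_trace CG p' \<ominus>\<^bsub>CG\<^esub> matrix_trace CG q')"
        by (auto simp: hattori_stallings_def U r_coset_def)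
      have "p' \<in> idempotents CG" "q' \<in> idempotents CG" using pq by (auto simp: K0_rel_def)
      then have "class_sums G x = trace_class p' - trace_class q'"
        using class_sums_commutator_subgroup[OF h]
        by (simp add: x minus_CG tr class_sums_add class_sums_diff trace_class_def)
      then show "class_sums G x = trace_class p - trace_class q"
        using K0_rel_trace_class[OF pq] by simp
    qed
    have "0 \<in> commutator_subgroup CG"
      unfolding commutator_subgroup_def using generate.one[of "add_monoid CG"] by simp
    then have "matrix_trace CG p \<ominus>\<^bsub>CG\<^esub> matrix_trace CG q \<in> hattori_stallings CG U"
      using mem unfolding hattori_stallings_def r_coset_def
      by (auto intro!: bexI[of _ "(p, q)"] bexI[of _ 0])
    then show "{trace_class p - trace_class q} \<subseteq> class_sums G ` hattori_stallings CG U"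
      by (auto simp: minus_CG tr p q class_sums_diff trace_class_def intro!: image_eqI)
  qed
  then have "HH0_decomposition G (hattori_stallings CG U) = trace_class p - trace_class q"
    by (simp add: HH0_decomposition_def)
  with p q that show ?thesis by blast
qed

end

theorem mainTheorem3:
  fixes G :: "('a, 'm) monoid_scheme"
  assumes "group G"
    and "burghelea_conjecture G"
  shows "strong_bass_conjecture G"
proof -
  interpret group G by fact
  have "HH0_decomposition G (hattori_stallings CG U) \<in> fin_summand G" if U: "U \<in> carrier (K0 CG)" for U
  proof -
    obtain p q where p: "p \<in> idempotents CG" and q: "q \<in> idempotents CG"
      and eq: "HH0_decomposition G (hattori_stallings CG U) = trace_class p - trace_class q"
      using HH0_decomposition_hattori_stallings[OF U] by blast
    have "Poly_Mapping.keys (trace_class p - trace_class q)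
        \<subseteq> Poly_Mapping.keys (trace_class p) \<union> Poly_Mapping.keys (trace_class q)"
      by (rule keys_diff)
    then show ?thesis
      using trace_class_fin_summand[OF assms(2) p] trace_class_fin_summand[OF assms(2) q]
      unfolding eq fin_summand_def by blast
  qed
  then show ?thesis by (auto simp: strong_bass_conjecture_def)
qed

end
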